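(* The restriction of the functor $$(\cdot)^{\mathrm{Top}}\colon\mathrm{Cond}(\mathrm{Set})\to\mathrm{Top},\qquad X\mapsto X(\ast)^{\mathrm{Top}}$$ to group objects in $\mathrm{Cond}(\mathrm{Set})$ lands in the category of quasi-topological groups, i.e. it restricts to a functor $\mathrm{Cond}(\mathrm{Grp})\to\mathrm{qTopGrp}$. Moreover, the underlying topological group functor $(\cdot)^{\mathrm{TopGrp}}\colon\mathrm{Cond}(\mathrm{Grp})\to\mathrm{TopGrp}$, defined as the left adjoint of $\underline{(\cdot)}\colon\mathrm{TopGrp}\to\mathrm{Cond}(\mathrm{Grp})$, is given by the composition $$(\cdot)^{\tau}\colon\mathrm{Cond}(\mathrm{Grp})\to\mathrm{qTopGrp}\xrightarrow{\ \tau\ }\mathrm{TopGrp}.$$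
   Context: Set-theoretic convention: fix strongly inaccessible cardinals $\delta<\epsilon$; profinite sets are $\delta$-small and condensed objects take $\epsilon$-small values. $\mathrm{Extr}$ is the category of extremally disconnected compact Hausdorff spaces. $\mathrm{Cond}(\mathrm{Set})$ (condensed sets) and $\mathrm{Cond}(\mathrm{Grp})$ (condensed groups, equivalently group objects in condensed sets) are the categories of finite-product-preserving functors $\mathrm{Extr}^{\mathrm{op}}\to\mathrm{Set}$, resp. $\mathrm{Extr}^{\mathrm{op}}\to\mathrm{Grp}$. The functor $\mathrm{Top}\to\mathrm{Cond}(\mathrm{Set})$, $T\mapsto\underline T$, $\underline T(K)=\mathrm{Hom}_{\mathrm{Top}}(K,T)$, has the left adjoint $X\mapsto X(\ast)^{\mathrm{Top}}$, the set $X(\ast)$ with the quotient topology from $\bigsqcup_{K\to X}K\to X(\ast)$, the disjoint union running over all profinite sets $K$ mapping to $X$. The functor $T\mapsto\underline T$ restricts to group objects, giving $\underline{(\cdot)}\colon\mathrm{TopGrp}\to\mathrm{Cond}(\mathrm{Grp})$ ($\mathrm{TopGrp}$: topological groups). A quasi-topological group is a group $G$ with a topology such that inversion is continuous and the multiplication $G\times G\to G$ is continuous in each variable separately; $\mathrm{qTopGrp}$ is the category of these with continuous group homomorphisms. The full inclusion $\mathrm{TopGrp}\hookrightarrow\mathrm{qTopGrp}$ has a left adjoint $\tau$, which keeps the underlying group and coarsens the topology. *)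

theory Defs
  imports "HOL-Analysis.Analysis" "HOL-Algebra.Group"
begin

unbundle cardinal_syntax

section \<open>Categories, functors, adjunctions\<close>

text \<open>
  \<open>Comp C X Y Z g f\<close> is the composite of \<open>f : X \<rightarrow> Y\<close> and \<open>g : Y \<rightarrow> Z\<close>. Arrows do not carry
  their domain and codomain, so the hom-sets need not be disjoint and the three objects are
  passed explicitly.
\<close>

record ('o, 'm) cat =
  Obj :: "'o set"
  Hom :: "'o \<Rightarrow> 'o \<Rightarrow> 'm set"
  Comp :: "'o \<Rightarrow> 'o \<Rightarrow> 'o \<Rightarrow> 'm \<Rightarrow> 'm \<Rightarrow> 'm"
  Ident :: "'o \<Rightarrow> 'm"

definition is_category :: "('o, 'm) cat \<Rightarrow> bool" where
  "is_category C \<longleftrightarrow>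
    (\<forall>X\<in>Obj C. Ident C X \<in> Hom C X X) \<and>
    (\<forall>X\<in>Obj C. \<forall>Y\<in>Obj C. \<forall>Z\<in>Obj C. \<forall>f\<in>Hom C X Y. \<forall>g\<in>Hom C Y Z. Comp C X Y Z g f \<in> Hom C X Z) \<and>
    (\<forall>X\<in>Obj C. \<forall>Y\<in>Obj C. \<forall>f\<in>Hom C X Y.
        Comp C X X Y f (Ident C X) = f \<and> Comp C X Y Y (Ident C Y) f = f) \<and>
    (\<forall>W\<in>Obj C. \<forall>X\<in>Obj C. \<forall>Y\<in>Obj C. \<forall>Z\<in>Obj C. \<forall>f\<in>Hom C W X. \<forall>g\<in>Hom C X Y. \<forall>h\<in>Hom C Y Z.
        Comp C W X Z (Comp C X Y Z h g) f = Comp C W Y Z h (Comp C W X Y g f))"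

definition op_cat :: "('o, 'm) cat \<Rightarrow> ('o, 'm) cat" where
  "op_cat C = \<lparr>Obj = Obj C, Hom = (\<lambda>X Y. Hom C Y X),
     Comp = (\<lambda>X Y Z g f. Comp C Z Y X f g), Ident = Ident C\<rparr>"

definition full_subcat :: "('o, 'm) cat \<Rightarrow> ('o \<Rightarrow> bool) \<Rightarrow> ('o, 'm) cat" where
  "full_subcat C P = C\<lparr>Obj := {X \<in> Obj C. P X}\<rparr>"

record ('o1, 'm1, 'o2, 'm2) fctr =
  FObj :: "'o1 \<Rightarrow> 'o2"
  FMap :: "'o1 \<Rightarrow> 'o1 \<Rightarrow> 'm1 \<Rightarrow> 'm2"

definition is_functor ::
    "('o1, 'm1) cat \<Rightarrow> ('o2, 'm2) cat \<Rightarrow> ('o1, 'm1, 'o2, 'm2) fctr \<Rightarrow> bool" where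
  "is_functor C D F \<longleftrightarrow>
    is_category C \<and> is_category D \<and>
    (\<forall>X\<in>Obj C. FObj F X \<in> Obj D) \<and>
    (\<forall>X\<in>Obj C. \<forall>Y\<in>Obj C. \<forall>f\<in>Hom C X Y. FMap F X Y f \<in> Hom D (FObj F X) (FObj F Y)) \<and>
    (\<forall>X\<in>Obj C. FMap F X X (Ident C X) = Ident D (FObj F X)) \<and>
    (\<forall>X\<in>Obj C. \<forall>Y\<in>Obj C. \<forall>Z\<in>Obj C. \<forall>f\<in>Hom C X Y. \<forall>g\<in>Hom C Y Z.
        FMap F X Z (Comp C X Y Z g f) =
        Comp D (FObj F X) (FObj F Y) (FObj F Z) (FMap F Y Z g) (FMap F X Y f))"

definition functor_comp ::
    "('o2, 'm2, 'o3, 'm3) fctr \<Rightarrow> ('o1, 'm1, 'o2, 'm2) fctr \<Rightarrow> ('o1, 'm1, 'o3, 'm3) fctr"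
    (infixr "\<circ>\<^sub>F" 55) where
  "G \<circ>\<^sub>F F = \<lparr>FObj = (\<lambda>X. FObj G (FObj F X)),
     FMap = (\<lambda>X Y f. FMap G (FObj F X) (FObj F Y) (FMap F X Y f))\<rparr>"

text \<open>
  Natural transformations are made extensional (\<open>undefined\<close> off the objects of \<open>C\<close>), so that equality
  of families is equality of natural transformations.
\<close>

definition nat_trans ::
    "('o1, 'm1) cat \<Rightarrow> ('o2, 'm2) cat \<Rightarrow> ('o1, 'm1, 'o2, 'm2) fctr \<Rightarrow> ('o1, 'm1, 'o2, 'm2) fctr
      \<Rightarrow> ('o1 \<Rightarrow> 'm2) set" where
  "nat_trans C D F G = {\<eta> \<in> (\<Pi>\<^sub>E X\<in>Obj C. Hom D (FObj F X) (FObj G X)).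
     \<forall>X\<in>Obj C. \<forall>Y\<in>Obj C. \<forall>f\<in>Hom C X Y.
       Comp D (FObj F X) (FObj F Y) (FObj G Y) (\<eta> Y) (FMap F X Y f) =
       Comp D (FObj F X) (FObj G X) (FObj G Y) (FMap G X Y f) (\<eta> X)}"

definition functor_cat ::
    "('o1, 'm1) cat \<Rightarrow> ('o2, 'm2) cat \<Rightarrow> (('o1, 'm1, 'o2, 'm2) fctr, 'o1 \<Rightarrow> 'm2) cat" where
  "functor_cat C D = \<lparr>Obj = {F. is_functor C D F}, Hom = nat_trans C D,
     Comp = (\<lambda>F G H \<beta> \<alpha>. \<lambda>X\<in>Obj C. Comp D (FObj F X) (FObj G X) (FObj H X) (\<beta> X) (\<alpha> X)),
     Ident = (\<lambda>F. \<lambda>X\<in>Obj C. Ident D (FObj F X))\<rparr>"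

definition is_product ::
    "('o, 'm) cat \<Rightarrow> nat set \<Rightarrow> (nat \<Rightarrow> 'o) \<Rightarrow> 'o \<Rightarrow> (nat \<Rightarrow> 'm) \<Rightarrow> bool" where
  "is_product C I X P p \<longleftrightarrow>
    P \<in> Obj C \<and> (\<forall>i\<in>I. X i \<in> Obj C \<and> p i \<in> Hom C P (X i)) \<and>
    (\<forall>Z\<in>Obj C. \<forall>f. (\<forall>i\<in>I. f i \<in> Hom C Z (X i)) \<longrightarrow>
       (\<exists>!u. u \<in> Hom C Z P \<and> (\<forall>i\<in>I. Comp C Z P (X i) (p i) u = f i)))"

definition preserves_finite_products ::
    "('o1, 'm1) cat \<Rightarrow> ('o2, 'm2) cat \<Rightarrow> ('o1, 'm1, 'o2, 'm2) fctr \<Rightarrow> bool" where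
  "preserves_finite_products C D F \<longleftrightarrow>
    (\<forall>I X P p. finite I \<longrightarrow> is_product C I X P p \<longrightarrow>
       is_product D I (\<lambda>i. FObj F (X i)) (FObj F P) (\<lambda>i. FMap F P (X i) (p i)))"

definition left_adjoint ::
    "('o1, 'm1) cat \<Rightarrow> ('o2, 'm2) cat \<Rightarrow> ('o1, 'm1, 'o2, 'm2) fctr \<Rightarrow> ('o2, 'm2, 'o1, 'm1) fctr
      \<Rightarrow> bool" where
  "left_adjoint C D F U \<longleftrightarrow>
    is_functor C D F \<and> is_functor D C U \<and>
    (\<exists>\<phi>. (\<forall>X\<in>Obj C. \<forall>Y\<in>Obj D. bij_betw (\<phi> X Y) (Hom D (FObj F X) Y) (Hom C X (FObj U Y))) \<and>
      (\<forall>X\<in>Obj C. \<forall>X'\<in>Obj C. \<forall>Y\<in>Obj D. \<forall>Y'\<in>Obj D.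
        \<forall>h\<in>Hom C X' X. \<forall>u\<in>Hom D (FObj F X) Y. \<forall>g\<in>Hom D Y Y'.
          \<phi> X' Y' (Comp D (FObj F X') (FObj F X) Y' (Comp D (FObj F X) Y Y' g u) (FMap F X' X h)) =
          Comp C X' X (FObj U Y') (Comp C X (FObj U Y) (FObj U Y') (FMap U Y Y' g) (\<phi> X Y u)) h))"


section \<open>Small sets, groups and spaces\<close>

text \<open>
  For a strongly inaccessible cardinal \<open>\<kappa>\<close> on a type \<open>'a\<close>, the \<open>\<kappa>\<close>-small sets are represented by the
  subsets of \<open>'a\<close> of cardinality less than \<open>\<kappa>\<close>. Since \<open>Field \<kappa>\<close> is a subset of \<open>'a\<close> of cardinality
  \<open>\<kappa>\<close>, every set of cardinality less than \<open>\<kappa>\<close> has a copy of this kind.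
\<close>

definition strongly_inaccessible :: "'a rel \<Rightarrow> bool" where
  "strongly_inaccessible \<kappa> \<longleftrightarrow>
    Card_order \<kappa> \<and> natLeq <o \<kappa> \<and> regularCard \<kappa> \<and>
    (\<forall>A :: 'a set. |A| <o \<kappa> \<longrightarrow> |Pow A| <o \<kappa>)"

definition Set_cat :: "'e rel \<Rightarrow> ('e set, 'e \<Rightarrow> 'e) cat" where
  "Set_cat \<kappa> = \<lparr>Obj = {A. |A| <o \<kappa>}, Hom = (\<lambda>A B. A \<rightarrow>\<^sub>E B),
     Comp = (\<lambda>A B C g f. compose A g f), Ident = (\<lambda>A. \<lambda>x\<in>A. x)\<rparr>"

definition Grp_cat :: "'e rel \<Rightarrow> ('e monoid, 'e \<Rightarrow> 'e) cat" where
  "Grp_cat \<kappa> = \<lparr>Obj = {G. group G \<and> |carrier G| <o \<kappa>},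
     Hom = (\<lambda>G H. hom G H \<inter> extensional (carrier G)),
     Comp = (\<lambda>G H K g f. compose (carrier G) g f), Ident = (\<lambda>G. \<lambda>x\<in>carrier G. x)\<rparr>"

definition cmaps :: "'a topology \<Rightarrow> 'b topology \<Rightarrow> ('a \<Rightarrow> 'b) set" where
  "cmaps X Y = {f \<in> extensional (topspace X). continuous_map X Y f}"

definition Top_cat :: "'e rel \<Rightarrow> ('e topology, 'e \<Rightarrow> 'e) cat" where
  "Top_cat \<kappa> = \<lparr>Obj = {X. |topspace X| <o \<kappa>}, Hom = cmaps,
     Comp = (\<lambda>X Y Z g f. compose (topspace X) g f), Ident = (\<lambda>X. \<lambda>x\<in>topspace X. x)\<rparr>"

definition profinite_space :: "'a topology \<Rightarrow> bool" where
  "profinite_space X \<longleftrightarrow>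
    compact_space X \<and> Hausdorff_space X \<and> (\<forall>S. connectedin X S \<longrightarrow> (\<exists>a. S \<subseteq> {a}))"

definition extremally_disconnected_space :: "'a topology \<Rightarrow> bool" where
  "extremally_disconnected_space X \<longleftrightarrow> (\<forall>U. openin X U \<longrightarrow> openin X (X closure_of U))"

definition Extr :: "'d rel \<Rightarrow> ('d topology, 'd \<Rightarrow> 'd) cat" where
  "Extr \<delta> = full_subcat (Top_cat \<delta>)
     (\<lambda>K. compact_space K \<and> Hausdorff_space K \<and> extremally_disconnected_space K)"


section \<open>Topological and quasi-topological groups\<close>

record 'a topgrp = "'a monoid" +
  topol :: "'a topology"

definition quasi_topological_group :: "'a topgrp \<Rightarrow> bool" where
  "quasi_topological_group G \<longleftrightarrow>
    group G \<and> topspace (topol G) = carrier G \<and>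
    continuous_map (topol G) (topol G) (\<lambda>x. inv\<^bsub>G\<^esub> x) \<and>
    (\<forall>a\<in>carrier G. continuous_map (topol G) (topol G) (\<lambda>x. a \<otimes>\<^bsub>G\<^esub> x) \<and>
                   continuous_map (topol G) (topol G) (\<lambda>x. x \<otimes>\<^bsub>G\<^esub> a))"

definition topological_group :: "'a topgrp \<Rightarrow> bool" where
  "topological_group G \<longleftrightarrow>
    group G \<and> topspace (topol G) = carrier G \<and>
    continuous_map (topol G) (topol G) (\<lambda>x. inv\<^bsub>G\<^esub> x) \<and>
    continuous_map (prod_topology (topol G) (topol G)) (topol G) (\<lambda>(x, y). x \<otimes>\<^bsub>G\<^esub> y)"

definition qTopGrp :: "'e rel \<Rightarrow> ('e topgrp, 'e \<Rightarrow> 'e) cat" where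
  "qTopGrp \<kappa> = \<lparr>Obj = {G. quasi_topological_group G \<and> |carrier G| <o \<kappa>},
     Hom = (\<lambda>G H. hom G H \<inter> cmaps (topol G) (topol H)),
     Comp = (\<lambda>G H K g f. compose (carrier G) g f), Ident = (\<lambda>G. \<lambda>x\<in>carrier G. x)\<rparr>"

definition TopGrp :: "'e rel \<Rightarrow> ('e topgrp, 'e \<Rightarrow> 'e) cat" where
  "TopGrp \<kappa> = full_subcat (qTopGrp \<kappa>) topological_group"

definition TopGrp_incl :: "('e topgrp, 'e \<Rightarrow> 'e, 'e topgrp, 'e \<Rightarrow> 'e) fctr" where
  "TopGrp_incl = \<lparr>FObj = (\<lambda>G. G), FMap = (\<lambda>G H f. f)\<rparr>"


section \<open>The reflection of quasi-topological groups in topological groups\<close>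

text \<open>
  The inclusion of topological groups into quasi-topological groups has a left adjoint that keeps
  the underlying group and coarsens the topology, namely to the finest group topology contained
  in the given one.
\<close>

definition group_topologies :: "'a topgrp \<Rightarrow> 'a topology set" where
  "group_topologies G =
    {T. topological_group (G\<lparr>topol := T\<rparr>) \<and> (\<forall>U. openin T U \<longrightarrow> openin (topol G) U)}"

definition group_reflection :: "('e topgrp, 'e \<Rightarrow> 'e, 'e topgrp, 'e \<Rightarrow> 'e) fctr" where
  "group_reflection =
    \<lparr>FObj = (\<lambda>G. G\<lparr>topol := topology_generated_by {U. \<exists>T\<in>group_topologies G. openin T U}\<rparr>),
     FMap = (\<lambda>G H f. f)\<rparr>"

lemma group_topol_update [simp]: "group (G\<lparr>topol := T\<rparr>) \<longleftrightarrow> group G"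
  for G :: "'a topgrp"
  by (cases G) (simp only: group_def group_axioms_def monoid_def Units_def topgrp.simps
      monoid.simps partial_object.simps)

lemma inv_topol_update [simp]: "inv\<^bsub>G\<lparr>topol := T\<rparr>\<^esub> x = inv\<^bsub>G\<^esub> x"
  for G :: "'a topgrp"
  by (simp add: m_inv_def)

lemma hom_topol_update [simp]:
  "hom (G\<lparr>topol := T\<rparr>) H = hom G H" "hom K (G\<lparr>topol := T\<rparr>) = hom K G"
  for G :: "'a topgrp"
  by (simp_all add: hom_def)

lemma topological_imp_quasi_topological:
  assumes "topological_group G"
  shows "quasi_topological_group G"
proof -
  have m: "continuous_map (prod_topology (topol G) (topol G)) (topol G) (\<lambda>(x, y). x \<otimes>\<^bsub>G\<^esub> y)"
    and s: "topspace (topol G) = carrier G"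
    using assms by (auto simp: topological_group_def)
  have "continuous_map (topol G) (topol G) (\<lambda>x. a \<otimes>\<^bsub>G\<^esub> x)" if "a \<in> carrier G" for a
  proof -
    have "continuous_map (topol G) (prod_topology (topol G) (topol G)) (\<lambda>x. (a, x))"
      using that s by (simp add: continuous_map_pairwise o_def)
    from continuous_map_compose[OF this m] show ?thesis by (simp add: o_def)
  qed
  moreover have "continuous_map (topol G) (topol G) (\<lambda>x. x \<otimes>\<^bsub>G\<^esub> a)" if "a \<in> carrier G" for a
  proof -
    have "continuous_map (topol G) (prod_topology (topol G) (topol G)) (\<lambda>x. (x, a))"
      using that s by (simp add: continuous_map_pairwise o_def)
    from continuous_map_compose[OF this m] show ?thesis by (simp add: o_def)
  qed
  ultimately show ?thesis
    using assms by (auto simp: quasi_topological_group_def topological_group_def)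
qed

lemma indiscrete_group_topology:
  assumes "quasi_topological_group G"
  shows "topology_generated_by {carrier G} \<in> group_topologies G"
proof -
  have G: "group G" and s: "topspace (topol G) = carrier G"
    using assms by (auto simp: quasi_topological_group_def)
  interpret group G by (rule G)
  have o: "openin (topol G) U" if "openin (topology_generated_by {carrier G}) U" for U
    using that unfolding openin_topology_generated_by_iff
  proof (induction rule: generate_topology_on.induct)
    case (Basis s)
    then show ?case using s openin_topspace[of "topol G"] by auto
  qed auto
  have c: "continuous_map X (topology_generated_by {carrier G}) f"
    if "f \<in> topspace X \<rightarrow> carrier G" for f and X :: "'c topology"
  proof -
    have "f -` carrier G \<inter> topspace X = topspace X" using that by auto
    then show ?thesis
      using that by (auto simp: continuous_on_generated_topo_iff)
  qed
  have "continuous_map (topology_generated_by {carrier G}) (topology_generated_by {carrier G})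
      (\<lambda>x. inv\<^bsub>G\<^esub> x)"
    by (rule c) auto
  moreover have "continuous_map
      (prod_topology (topology_generated_by {carrier G}) (topology_generated_by {carrier G}))
      (topology_generated_by {carrier G}) (\<lambda>(x, y). x \<otimes>\<^bsub>G\<^esub> y)"
    by (rule c) auto
  ultimately show ?thesis
    using G o by (auto simp: group_topologies_def topological_group_def)
qed

lemma generated_carrier:
  assumes "quasi_topological_group G"
  shows "topspace (topology_generated_by {U. \<exists>T\<in>group_topologies G. openin T U}) = carrier G"
proof -
  have "topspace T = carrier G" if "T \<in> group_topologies G" for T
    using that by (simp add: group_topologies_def topological_group_def)
  then show ?thesis
    using indiscrete_group_topology[OF assms] by (auto dest: openin_subset)
qed

lemma group_reflection_coarser:
  assumes "quasi_topological_group G" "openin (topol (FObj group_reflection G)) U"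
  shows "openin (topol G) U"
proof -
  have "generate_topology_on {U. \<exists>T\<in>group_topologies G. openin T U} U"
    using assms(2) by (simp add: group_reflection_def openin_topology_generated_by_iff)
  then show ?thesis
    by (induction rule: generate_topology_on.induct) (auto simp: group_topologies_def)
qed

lemma topological_group_reflection:
  fixes G :: "'a topgrp"
  assumes "quasi_topological_group G"
  shows "topological_group (FObj group_reflection G)"
proof -
  let ?S = "{U. \<exists>T\<in>group_topologies G. openin T U}"
  let ?J = "topology_generated_by ?S"
  have G: "group G" using assms by (auto simp: quasi_topological_group_def)
  interpret group G by (rule G)
  have J: "topspace ?J = carrier G" by (rule generated_carrier[OF assms])
  have un: "\<Union>?S = carrier G" using J by simp
  have Tsp: "topspace T = carrier G" if "T \<in> group_topologies G" for T
    using that by (simp add: group_topologies_def topological_group_def)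
  have fine: "openin ?J U" if "T \<in> group_topologies G" "openin T U" for T U
    using that by (auto intro!: topology_generated_by_Basis)
  have idT: "continuous_map ?J T (\<lambda>x. x)" if T: "T \<in> group_topologies G" for T
    unfolding continuous_map_def
  proof (intro conjI allI impI)
    show "(\<lambda>x. x) \<in> topspace ?J \<rightarrow> topspace T" unfolding J Tsp[OF T] by simp
  next
    fix U assume U: "openin T U"
    then have "{x \<in> topspace ?J. x \<in> U} = U"
      using openin_subset[OF U] unfolding J Tsp[OF T] by auto
    then show "openin ?J {x \<in> topspace ?J. x \<in> U}" using fine[OF T U] by simp
  qed
  have inv_T: "continuous_map T T (\<lambda>x. inv\<^bsub>G\<^esub> x)"
    and mult_T: "continuous_map (prod_topology T T) T (\<lambda>(x, y). x \<otimes>\<^bsub>G\<^esub> y)"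
    if "T \<in> group_topologies G" for T
    using that by (auto simp: group_topologies_def topological_group_def)
  have "continuous_map ?J ?J (\<lambda>x. inv\<^bsub>G\<^esub> x)"
    unfolding continuous_on_generated_topo_iff
  proof safe
    fix U T assume T: "T \<in> group_topologies G" "openin T U"
    have "continuous_map ?J T (\<lambda>x. inv\<^bsub>G\<^esub> x)"
      using continuous_map_compose[OF idT[OF T(1)] inv_T[OF T(1)]] by (simp add: o_def)
    from openin_continuous_map_preimage[OF this T(2)]
    show "openin ?J ((\<lambda>x. inv\<^bsub>G\<^esub> x) -` U \<inter> topspace ?J)"
      by (simp add: vimage_def Int_def conj_commute)
  next
    fix x assume "x \<in> topspace ?J"
    then have "inv\<^bsub>G\<^esub> x \<in> \<Union>?S" unfolding un J by simp
    then show "inv\<^bsub>G\<^esub> x \<in> \<Union>?S" .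
  qed
  moreover have "continuous_map (prod_topology ?J ?J) ?J (\<lambda>(x, y). x \<otimes>\<^bsub>G\<^esub> y)"
    unfolding continuous_on_generated_topo_iff
  proof safe
    fix U T assume T: "T \<in> group_topologies G" "openin T U"
    have "continuous_map (prod_topology ?J ?J) (prod_topology T T) (\<lambda>(x, y). (x, y))"
      using continuous_map_prod_top[THEN iffD2, OF disjI2, OF conjI, OF idT[OF T(1)] idT[OF T(1)]]
      by simp
    from continuous_map_compose[OF this mult_T[OF T(1)]]
    have "continuous_map (prod_topology ?J ?J) T (\<lambda>(x, y). x \<otimes>\<^bsub>G\<^esub> y)"
      by (simp add: o_def case_prod_unfold)
    from openin_continuous_map_preimage[OF this T(2)]
    show "openin (prod_topology ?J ?J)
        ((\<lambda>(x, y). x \<otimes>\<^bsub>G\<^esub> y) -` U \<inter> topspace (prod_topology ?J ?J))"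
      by (simp add: vimage_def Int_def conj_commute)
  next
    fix x y assume "(x, y) \<in> topspace (prod_topology ?J ?J)"
    then have "x \<otimes>\<^bsub>G\<^esub> y \<in> \<Union>?S" unfolding un topspace_prod_topology J by simp
    then show "x \<otimes>\<^bsub>G\<^esub> y \<in> \<Union>?S" .
  qed
  ultimately show ?thesis
    using G J by (simp add: group_reflection_def topological_group_def del: topology_generated_by_topspace)
qed

lemma pullback_group_topology:
  assumes G: "quasi_topological_group G" and H: "topological_group H"
    and f: "f \<in> hom G H" "continuous_map (topol G) (topol H) f"
  shows "pullback_topology (carrier G) f (topol H) \<in> group_topologies G"
proof -
  let ?T = "pullback_topology (carrier G) f (topol H)"
  have gG: "group G" and gH: "group H"
    and sG: "topspace (topol G) = carrier G" and sH: "topspace (topol H) = carrier H"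
    using G H by (auto simp: quasi_topological_group_def topological_group_def)
  interpret f: group_hom G H f using gG gH f(1) by (simp add: group_hom_def group_hom_axioms_def)
  have fc: "f x \<in> carrier H" if "x \<in> carrier G" for x using that by simp
  have sT: "topspace ?T = carrier G"
    using sH by (auto simp: topspace_pullback_topology)
  have fT: "continuous_map ?T (topol H) f"
    using continuous_map_pullback[of "topol H" "topol H" id "carrier G" f] by simp
  have "continuous_map ?T ?T (\<lambda>x. inv\<^bsub>G\<^esub> x)"
  proof (rule continuous_map_pullback')
    have "continuous_map ?T (topol H) (\<lambda>x. inv\<^bsub>H\<^esub> (f x))"
      using continuous_map_compose[OF fT, of "topol H" "\<lambda>x. inv\<^bsub>H\<^esub> x"] H
      by (simp add: topological_group_def o_def)
    then show "continuous_map ?T (topol H) (f \<circ> (\<lambda>x. inv\<^bsub>G\<^esub> x))"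
      by (rule continuous_map_eq) (simp add: sT)
  qed (auto simp: sT)
  moreover have "continuous_map (prod_topology ?T ?T) ?T (\<lambda>(x, y). x \<otimes>\<^bsub>G\<^esub> y)"
  proof (rule continuous_map_pullback')
    have "continuous_map (prod_topology ?T ?T) (prod_topology (topol H) (topol H))
        (\<lambda>(x, y). (f x, f y))"
      using fT by (simp add: continuous_map_prod_top)
    from continuous_map_compose[OF this, of "topol H" "\<lambda>(x, y). x \<otimes>\<^bsub>H\<^esub> y"]
    have "continuous_map (prod_topology ?T ?T) (topol H) (\<lambda>(x, y). f x \<otimes>\<^bsub>H\<^esub> f y)"
      using H by (simp add: topological_group_def o_def case_prod_unfold)
    then show "continuous_map (prod_topology ?T ?T) (topol H) (f \<circ> (\<lambda>(x, y). x \<otimes>\<^bsub>G\<^esub> y))"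
      by (rule continuous_map_eq) (auto simp: sT)
  qed (auto simp: sT)
  moreover have "openin (topol G) U" if "openin ?T U" for U
  proof -
    from that obtain V where V: "openin (topol H) V" "U = f -` V \<inter> carrier G"
      by (auto simp: openin_pullback_topology)
    from openin_continuous_map_preimage[OF f(2) V(1)] V(2) sG show ?thesis
      by (simp add: vimage_def Int_def conj_commute)
  qed
  ultimately show ?thesis
    using gG sT by (simp add: group_topologies_def topological_group_def)
qed

lemma group_reflection_continuous_iff:
  assumes G: "quasi_topological_group G" and H: "topological_group H" and f: "f \<in> hom G H"
  shows "continuous_map (topol (FObj group_reflection G)) (topol H) f
    \<longleftrightarrow> continuous_map (topol G) (topol H) f"
proof -
  let ?J = "topol (FObj group_reflection G)"
  have sJ: "topspace ?J = carrier G"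
    using generated_carrier[OF G] by (simp add: group_reflection_def)
  have sG: "topspace (topol G) = carrier G"
    using G by (simp add: quasi_topological_group_def)
  show ?thesis
  proof
    assume "continuous_map ?J (topol H) f"
    then show "continuous_map (topol G) (topol H) f"
      using group_reflection_coarser[OF G] sJ sG unfolding continuous_map_def by auto
  next
    assume c: "continuous_map (topol G) (topol H) f"
    have "openin ?J {x \<in> topspace ?J. f x \<in> V}" if "openin (topol H) V" for V
    proof -
      have "openin (pullback_topology (carrier G) f (topol H)) {x \<in> carrier G. f x \<in> V}"
        using that by (auto simp: openin_pullback_topology)
      then show ?thesis
        using pullback_group_topology[OF G H f c] unfolding sJ
        by (auto simp: group_reflection_def intro!: topology_generated_by_Basis)
    qed
    then show "continuous_map ?J (topol H) f"
      using c sJ sG unfolding continuous_map_def by auto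
  qed
qed

lemma qTopGrp_Hom_ext:
  assumes "G \<in> Obj (qTopGrp \<kappa>)" "f \<in> Hom (qTopGrp \<kappa>) G H"
  shows "f \<in> extensional (carrier G)"
  using assms by (auto simp: qTopGrp_def cmaps_def quasi_topological_group_def)

lemma is_category_qTopGrp: "is_category (qTopGrp \<kappa>)"
proof -
  have A: "compose (carrier G) g f \<in> hom G K \<inter> cmaps (topol G) (topol K)"
    if "quasi_topological_group G" "f \<in> hom G H \<inter> cmaps (topol G) (topol H)"
       "g \<in> hom H K \<inter> cmaps (topol H) (topol K)" for G H K :: "'a topgrp" and f g
  proof -
    have "continuous_map (topol G) (topol K) (g \<circ> f)"
      using that by (auto simp: cmaps_def intro: continuous_map_compose)
    then have "continuous_map (topol G) (topol K) (compose (carrier G) g f)"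
      by (rule continuous_map_eq)
         (use that in \<open>auto simp: compose_def quasi_topological_group_def\<close>)
    then show ?thesis
      using that group.hom_compose[of G f H g K]
      by (auto simp: cmaps_def quasi_topological_group_def)
  qed
  have I: "(\<lambda>x\<in>carrier G. x) \<in> hom G G \<inter> cmaps (topol G) (topol G)"
    if "quasi_topological_group G" for G :: "'a topgrp"
  proof -
    have "continuous_map (topol G) (topol G) (\<lambda>x\<in>carrier G. x)"
      by (rule continuous_map_eq[OF continuous_map_id])
         (use that in \<open>auto simp: quasi_topological_group_def\<close>)
    moreover have "group G" using that by (simp add: quasi_topological_group_def)
    ultimately show ?thesis
      using that by (auto simp: hom_def cmaps_def quasi_topological_group_def
          group.is_monoid monoid.m_closed)
  qed
  have cl: "compose (carrier G) g f \<in> Hom (qTopGrp \<kappa>) G K"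
    if "G \<in> Obj (qTopGrp \<kappa>)" "f \<in> Hom (qTopGrp \<kappa>) G H" "g \<in> Hom (qTopGrp \<kappa>) H K"
    for G H K :: "'a topgrp" and f g
    using A[of G f H g K] that by (simp add: qTopGrp_def)
  have fc: "f x \<in> carrier H" if "f \<in> Hom (qTopGrp \<kappa>) G H" "x \<in> carrier G"
    for G H :: "'a topgrp" and f x
    using that by (auto simp: qTopGrp_def hom_def)
  have idG: "(\<lambda>x\<in>carrier G. x) \<in> Hom (qTopGrp \<kappa>) G G" if "G \<in> Obj (qTopGrp \<kappa>)" for G :: "'a topgrp"
    using I that by (simp add: qTopGrp_def)
  have C: "Comp (qTopGrp \<kappa>) X Y Z g f = compose (carrier X) g f"
      "Ident (qTopGrp \<kappa>) X = (\<lambda>x\<in>carrier X. x)" for X Y Z :: "'a topgrp" and f g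
    by (simp_all add: qTopGrp_def)
  show ?thesis
    unfolding is_category_def C
  proof (intro conjI ballI)
    fix X Y f assume "X \<in> Obj (qTopGrp \<kappa>)" "Y \<in> Obj (qTopGrp \<kappa>)" "f \<in> Hom (qTopGrp \<kappa>) X Y"
    then show "compose (carrier X) f (\<lambda>x\<in>carrier X. x) = f"
      "compose (carrier X) (\<lambda>x\<in>carrier Y. x) f = f"
      using qTopGrp_Hom_ext[of X \<kappa> f Y] fc[of f X Y]
      by (auto simp: compose_def fun_eq_iff extensional_def)
  next
    fix W X Y Z :: "'a topgrp" and f g h assume "f \<in> Hom (qTopGrp \<kappa>) W X"
    then show "compose (carrier W) (compose (carrier X) h g) f =
        compose (carrier W) h (compose (carrier W) g f)"
      using fc[of f W X] by (auto simp: compose_def fun_eq_iff)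
  next
    fix X assume "X \<in> Obj (qTopGrp \<kappa>)"
    then show "(\<lambda>x\<in>carrier X. x) \<in> Hom (qTopGrp \<kappa>) X X" by (rule idG)
  next
    fix X Y Z f g
    assume "X \<in> Obj (qTopGrp \<kappa>)" "f \<in> Hom (qTopGrp \<kappa>) X Y" "g \<in> Hom (qTopGrp \<kappa>) Y Z"
    then show "compose (carrier X) g f \<in> Hom (qTopGrp \<kappa>) X Z" by (rule cl)
  qed
qed

lemma is_category_TopGrp: "is_category (TopGrp \<kappa>)"
  using is_category_qTopGrp[of \<kappa>] by (auto simp: is_category_def TopGrp_def full_subcat_def)

lemma left_adjoint_group_reflection:
  "left_adjoint (qTopGrp \<kappa>) (TopGrp \<kappa>) group_reflection TopGrp_incl"
proof -
  let ?R = "FObj group_reflection"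
  have Rcar: "carrier (?R G) = carrier G" for G :: "'a topgrp"
    by (simp add: group_reflection_def)
  have Rob: "?R G \<in> Obj (TopGrp \<kappa>)" if "G \<in> Obj (qTopGrp \<kappa>)" for G
    using that topological_group_reflection[of G]
    by (auto simp: TopGrp_def full_subcat_def qTopGrp_def Rcar topological_imp_quasi_topological)
  have Rhom: "hom (?R G) H = hom G H" for G H :: "'a topgrp"
    by (simp add: group_reflection_def)
  have Rhom': "hom G (?R H) = hom G H" for G H :: "'a topgrp"
    by (simp add: group_reflection_def)
  have H_eq: "Hom (TopGrp \<kappa>) (?R G) H = Hom (qTopGrp \<kappa>) G H"
    if "G \<in> Obj (qTopGrp \<kappa>)" "H \<in> Obj (TopGrp \<kappa>)" for G H
  proof -
    have G: "quasi_topological_group G" "topological_group H"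
      using that by (auto simp: TopGrp_def full_subcat_def qTopGrp_def)
    have "topspace (topol (?R G)) = topspace (topol G)"
      using generated_carrier[OF G(1)] G(1) by (simp add: group_reflection_def quasi_topological_group_def)
    then show ?thesis
      using group_reflection_continuous_iff[OF G]
      by (auto simp: TopGrp_def full_subcat_def qTopGrp_def Rhom cmaps_def)
  qed
  have unit: "Hom (qTopGrp \<kappa>) G H \<subseteq> Hom (qTopGrp \<kappa>) G (?R H)"
    if "G \<in> Obj (qTopGrp \<kappa>)" "H \<in> Obj (qTopGrp \<kappa>)" for G H
  proof -
    have q: "quasi_topological_group H" using that by (auto simp: qTopGrp_def)
    have s: "topspace (topol (?R H)) = topspace (topol H)"
      using generated_carrier[OF q] q by (simp add: group_reflection_def quasi_topological_group_def)
    have "continuous_map (topol G) (topol (?R H)) f" if "continuous_map (topol G) (topol H) f" for f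
      using that s group_reflection_coarser[OF q] unfolding continuous_map_def by auto
    then show ?thesis by (auto simp: qTopGrp_def Rhom' cmaps_def)
  qed
  have "is_functor (qTopGrp \<kappa>) (TopGrp \<kappa>) group_reflection"
    unfolding is_functor_def
  proof (intro conjI ballI)
    fix G H f assume "G \<in> Obj (qTopGrp \<kappa>)" "H \<in> Obj (qTopGrp \<kappa>)" "f \<in> Hom (qTopGrp \<kappa>) G H"
    then show "FMap group_reflection G H f \<in> Hom (TopGrp \<kappa>) (?R G) (?R H)"
      using unit[of G H] H_eq[of G "?R H"] Rob[of H] by (auto simp: group_reflection_def)
  next
    show "is_category (qTopGrp \<kappa>)" "is_category (TopGrp \<kappa>)"
      by (rule is_category_qTopGrp is_category_TopGrp)+
  next
    fix G assume "G \<in> Obj (qTopGrp \<kappa>)"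
    then show "?R G \<in> Obj (TopGrp \<kappa>)" by (rule Rob)
  qed (auto simp: group_reflection_def TopGrp_def full_subcat_def qTopGrp_def)
  moreover have "is_functor (TopGrp \<kappa>) (qTopGrp \<kappa>) TopGrp_incl"
    unfolding is_functor_def
  proof (intro conjI ballI)
    show "is_category (TopGrp \<kappa>)" "is_category (qTopGrp \<kappa>)"
      by (rule is_category_qTopGrp is_category_TopGrp)+
  qed (auto simp: TopGrp_incl_def TopGrp_def full_subcat_def)
  moreover have "bij_betw (\<lambda>u. u) (Hom (TopGrp \<kappa>) (?R G) H) (Hom (qTopGrp \<kappa>) G (FObj TopGrp_incl H))"
    if "G \<in> Obj (qTopGrp \<kappa>)" "H \<in> Obj (TopGrp \<kappa>)" for G H
    using H_eq[OF that] by (simp add: TopGrp_incl_def bij_betw_def inj_on_def)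
  moreover have "Comp (TopGrp \<kappa>) (?R G') (?R G) H' (Comp (TopGrp \<kappa>) (?R G) H H' g u)
        (FMap group_reflection G' G h) =
      Comp (qTopGrp \<kappa>) G' G (FObj TopGrp_incl H')
        (Comp (qTopGrp \<kappa>) G (FObj TopGrp_incl H) (FObj TopGrp_incl H') (FMap TopGrp_incl H H' g) u) h"
    for G G' H H' g u h
    by (simp add: TopGrp_incl_def group_reflection_def TopGrp_def full_subcat_def qTopGrp_def)
  ultimately show ?thesis
    unfolding left_adjoint_def by (intro conjI exI[of _ "\<lambda>X Y u. u"] ballI)
qed

section \<open>Condensed sets and condensed groups\<close>

type_synonym ('d, 'e) cset = "('d topology, 'd \<Rightarrow> 'd, 'e set, 'e \<Rightarrow> 'e) fctr"
type_synonym ('d, 'e) cgrp = "('d topology, 'd \<Rightarrow> 'd, 'e monoid, 'e \<Rightarrow> 'e) fctr"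
type_synonym ('d, 'e) cmor = "'d topology \<Rightarrow> 'e \<Rightarrow> 'e"

definition Cond :: "'d rel \<Rightarrow> ('o, 'm) cat
    \<Rightarrow> (('d topology, 'd \<Rightarrow> 'd, 'o, 'm) fctr, 'd topology \<Rightarrow> 'm) cat" where
  "Cond \<delta> E = full_subcat (functor_cat (op_cat (Extr \<delta>)) E)
     (preserves_finite_products (op_cat (Extr \<delta>)) E)"

abbreviation CondSet :: "'d rel \<Rightarrow> 'e rel \<Rightarrow> (('d, 'e) cset, ('d, 'e) cmor) cat" where
  "CondSet \<delta> \<epsilon> \<equiv> Cond \<delta> (Set_cat \<epsilon>)"

abbreviation CondGrp :: "'d rel \<Rightarrow> 'e rel \<Rightarrow> (('d, 'e) cgrp, ('d, 'e) cmor) cat" where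
  "CondGrp \<delta> \<epsilon> \<equiv> Cond \<delta> (Grp_cat \<epsilon>)"

definition forget_group :: "(('d, 'e) cgrp, ('d, 'e) cmor, ('d, 'e) cset, ('d, 'e) cmor) fctr" where
  "forget_group = \<lparr>FObj = (\<lambda>G. \<lparr>FObj = (\<lambda>K. carrier (FObj G K)), FMap = FMap G\<rparr>),
     FMap = (\<lambda>G H \<eta>. \<eta>)\<rparr>"

definition pt :: "'d topology" where
  "pt = discrete_topology {undefined}"

text \<open>
  The values of \<open>\<underline>T\<close> are the sets \<open>Hom(K, T)\<close>. These consist of functions, so they are not
  subsets of the type \<open>'e\<close> that carries the \<open>\<epsilon>\<close>-small sets; \<open>encode A\<close> is a choice of an injection
  of \<open>A\<close> into \<open>'e\<close> (which exists for \<open>\<epsilon>\<close>-small \<open>A\<close>), and the value at \<open>K\<close> is the copy of \<open>Hom(K, T)\<close>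
  under this injection, with all structure transported along it.
\<close>

definition encode :: "'a set \<Rightarrow> 'a \<Rightarrow> 'e" where
  "encode A = (SOME c. inj_on c A)"

definition decode :: "'a set \<Rightarrow> 'e \<Rightarrow> 'a" where
  "decode A = inv_into A (encode A)"

text \<open>
  \<open>T\<close> may live on a type different from \<open>'e\<close>; this is used for profinite sets \<open>T\<close>, which live on \<open>'d\<close>.
\<close>

definition underline :: "'t topology \<Rightarrow> ('d, 'e) cset" where
  "underline T =
    \<lparr>FObj = (\<lambda>K. encode (cmaps K T) ` cmaps K T),
     FMap = (\<lambda>K L f. \<lambda>a \<in> encode (cmaps K T) ` cmaps K T.
        encode (cmaps L T) (compose (topspace L) (decode (cmaps K T) a) f))\<rparr>"

definition underline_grp_obj :: "'e topgrp \<Rightarrow> ('d, 'e) cgrp" where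
  "underline_grp_obj H =
    \<lparr>FObj = (\<lambda>K. let A = cmaps K (topol H) in
        \<lparr>carrier = FObj (underline (topol H)) K,
         mult = (\<lambda>a b. encode A (\<lambda>k\<in>topspace K. decode A a k \<otimes>\<^bsub>H\<^esub> decode A b k)),
         one = encode A (\<lambda>k\<in>topspace K. \<one>\<^bsub>H\<^esub>)\<rparr>),
     FMap = FMap (underline (topol H))\<rparr>"

definition underline_grp ::
    "'d rel \<Rightarrow> ('e topgrp, 'e \<Rightarrow> 'e, ('d, 'e) cgrp, ('d, 'e) cmor) fctr" where
  "underline_grp \<delta> =
    \<lparr>FObj = underline_grp_obj,
     FMap = (\<lambda>G H \<phi>. \<lambda>K\<in>Obj (Extr \<delta>). \<lambda>a \<in> FObj (underline (topol G)) K.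
        encode (cmaps K (topol H)) (compose (topspace K) \<phi> (decode (cmaps K (topol G)) a)))\<rparr>"


section \<open>The underlying topological space of a condensed set\<close>

definition final_topology :: "'a topology \<Rightarrow> ('a \<Rightarrow> 'b) \<Rightarrow> 'b set \<Rightarrow> 'b topology" where
  "final_topology X f B = topology (\<lambda>U. U \<subseteq> B \<and> openin X {x \<in> topspace X. f x \<in> U})"

lemma istopology_final: "istopology (\<lambda>U. U \<subseteq> B \<and> openin X {x \<in> topspace X. f x \<in> U})"
proof -
  have "{x \<in> topspace X. f x \<in> S \<inter> T} = {x \<in> topspace X. f x \<in> S} \<inter> {x \<in> topspace X. f x \<in> T}" for S T
    by auto
  moreover have "{x \<in> topspace X. f x \<in> \<Union>\<K>} = (\<Union>U\<in>\<K>. {x \<in> topspace X. f x \<in> U})" for \<K>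
    by auto
  ultimately show ?thesis
    unfolding istopology_def by (auto simp del: Union_iff intro!: openin_Union)
qed

text \<open>
  The arrows \<open>K \<rightarrow> X\<close> from a profinite set \<open>K\<close> are the arrows \<open>\<underline>K \<rightarrow> X\<close> of condensed sets.
\<close>

definition profinite_over :: "'d rel \<Rightarrow> 'e rel \<Rightarrow> ('d, 'e) cset \<Rightarrow> ('d topology \<times> ('d, 'e) cmor) set" where
  "profinite_over \<delta> \<epsilon> X =
    {(K, \<eta>). profinite_space K \<and> |topspace K| <o \<delta> \<and> \<eta> \<in> Hom (CondSet \<delta> \<epsilon>) (underline K) X}"

definition eval_point :: "('d topology \<times> ('d, 'e) cmor) \<times> 'd \<Rightarrow> 'e" where
  "eval_point = (\<lambda>((K, \<eta>), k). \<eta> pt (encode (cmaps (pt :: 'd topology) K) (\<lambda>x\<in>topspace pt. k)))"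

definition top_space :: "'d rel \<Rightarrow> 'e rel \<Rightarrow> ('d, 'e) cset \<Rightarrow> 'e topology" where
  "top_space \<delta> \<epsilon> X =
    final_topology (sum_topology fst (profinite_over \<delta> \<epsilon> X)) eval_point (FObj X pt)"

definition top_functor ::
    "'d rel \<Rightarrow> 'e rel \<Rightarrow> (('d, 'e) cset, ('d, 'e) cmor, 'e topology, 'e \<Rightarrow> 'e) fctr" where
  "top_functor \<delta> \<epsilon> = \<lparr>FObj = top_space \<delta> \<epsilon>, FMap = (\<lambda>X Y \<eta>. \<eta> pt)\<rparr>"

text \<open>
  The restriction of \<open>top_functor\<close> to condensed groups: the space underlying the condensed set,
  together with the group structure of \<open>G(*)\<close>.
\<close>

definition top_functor_grp ::
    "'d rel \<Rightarrow> 'e rel \<Rightarrow> (('d, 'e) cgrp, ('d, 'e) cmor, 'e topgrp, 'e \<Rightarrow> 'e) fctr" where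
  "top_functor_grp \<delta> \<epsilon> =
    \<lparr>FObj = (\<lambda>G. \<lparr>carrier = carrier (FObj G pt), mult = mult (FObj G pt), one = one (FObj G pt),
        topol = FObj (top_functor \<delta> \<epsilon> \<circ>\<^sub>F forget_group) G\<rparr>),
     FMap = FMap (top_functor \<delta> \<epsilon> \<circ>\<^sub>F forget_group)\<rparr>"

end

(*
  Idea.  Precomposing the maps from profinite sets with a natural endomap of the presheaf of sets
  underlying a condensed group G shows that this endomap is continuous on G( * )^Top; inversion and the
  translations by elements of G( * ) extend to such natural endomaps, whereas joint multiplication is
  not one.  For a topological group H, a continuous homomorphism f : G( * )^Top -> H corresponds to the
  morphism G -> underline H that sends a section s over K to k |-> f (s(k)).  This is continuous
  because s is, by Yoneda, a map from the profinite set K to G.  Conversely, the value at the point of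
  a morphism G -> underline H is continuous along every profinite K -> G, because K is a quotient of
  an extremally disconnected space.  Composing with the adjunction of tau gives the theorem.
*)

theory Submission
  imports Defs
begin

text \<open>Two universes shape the proof. Spaces in \<open>Extr\<close> and profinite sets live on
  \<open>'d\<close>, values on \<open>'e\<close>, and sets of maps enter only through codes in
  \<open>'e\<close>; computing with \<open>underline\<close> therefore rests on smallness bounds,
  which inaccessibility supplies because power sets of small sets are small. The same closure
  property keeps the ultrafilter cover of a \<delta>-small space \<delta>-small. A condensed object
  is defined on \<open>Extr\<close> only. Yoneda thus applies to extremally disconnected K, while
  for a general profinite K an arrow out of \<open>underline K\<close> has to be compared with a
  section over a cover of K. That \<open>underline H\<close> preserves finite products is not
  formal: products in the opposite of \<open>Extr\<close> are coproducts tested on objects of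
  \<open>Extr\<close>, whereas H need be neither compact nor \<delta>-small. Such coproducts must be
  recognised as topological disjoint unions. Joint multiplication is a natural map out of G x G,
  whose space of points can carry a finer topology than the product; this is the gap that \<tau>
  closes. Of \<tau> only the adjunction matters, because all maps to be represented go into
  topological groups.\<close>

section \<open>Small sets\<close>

lemma strongly_inaccessible_Card_order: "strongly_inaccessible \<kappa> \<Longrightarrow> Card_order \<kappa>"
  by (simp add: strongly_inaccessible_def)

lemma strongly_inaccessible_infinite:
  assumes "strongly_inaccessible \<kappa>"
  shows "infinite (Field \<kappa>)"
proof -
  have "natLeq <o |Field \<kappa>|"
    using assms card_of_Field_ordIso ordIso_symmetric ordLess_ordIso_trans
    by (fastforce simp: strongly_inaccessible_def)
  then show ?thesis
    using infinite_iff_natLeq_ordLeq ordLess_imp_ordLeq by blast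
qed

lemma finite_small: "strongly_inaccessible \<kappa> \<Longrightarrow> finite A \<Longrightarrow> |A| <o \<kappa>"
  using finite_iff_ordLess_natLeq ordLess_transitive unfolding strongly_inaccessible_def by blast

lemma small_copy:
  fixes \<kappa> :: "'k rel"
  assumes "|A| <o \<kappa>"
  obtains c :: "'a \<Rightarrow> 'k" where "inj_on c A"
proof -
  obtain B where "|A| =o |B|" "B \<subseteq> Field \<kappa>"
    using assms internalize_card_of_ordLess[of A \<kappa>] by auto
  then obtain f where "bij_betw f A B"
    using card_of_ordIso by blast
  then show thesis
    using that bij_betw_imp_inj_on by blast
qed

lemma small_inj_on:
  assumes "inj_on f A" "f ` A \<subseteq> B" "|B| <o \<kappa>"
  shows "|A| <o \<kappa>"
proof -
  have "|A| \<le>o |B|"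
    using assms(1,2) card_of_ordLeq[of A B] by blast
  then show ?thesis
    using assms(3) by (rule ordLeq_ordLess_trans)
qed

lemma small_subset: "A \<subseteq> B \<Longrightarrow> |B| <o \<kappa> \<Longrightarrow> |A| <o \<kappa>"
  using card_of_mono1 ordLeq_ordLess_trans by blast

lemma small_image: "|A| <o \<kappa> \<Longrightarrow> |f ` A| <o \<kappa>"
  using card_of_image ordLeq_ordLess_trans by blast

text \<open>The strong limit property in \<open>strongly_inaccessible\<close> speaks of sets on the
  type of \<kappa>, so A is first moved there along an injection.\<close>

lemma small_Pow:
  fixes A :: "'a set" and \<kappa> :: "'k rel"
  assumes "strongly_inaccessible \<kappa>" "|A| <o \<kappa>"
  shows "|Pow A| <o \<kappa>"
proof -
  obtain c :: "'a \<Rightarrow> 'k" where c: "inj_on c A"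
    using assms(2) by (rule small_copy)
  have "|c ` A| <o \<kappa>"
    using assms(2) by (rule small_image)
  then have "|Pow (c ` A)| <o \<kappa>"
    using assms(1) by (simp add: strongly_inaccessible_def)
  moreover have "inj_on (image c) (Pow A)"
    using c by (rule inj_on_image_Pow)
  ultimately show ?thesis
    using small_inj_on[of "image c" "Pow A" "Pow (c ` A)"] by blast
qed

lemma small_Times:
  assumes "strongly_inaccessible \<kappa>" "|A| <o \<kappa>" "|B| <o \<kappa>"
  shows "|A \<times> B| <o \<kappa>"
proof -
  have "|A <+> B| <o \<kappa>"
    using assms strongly_inaccessible_infinite strongly_inaccessible_Card_order
    by (blast intro: card_of_Plus_ordLess_infinite_Field)
  then have "|Pow (A <+> B)| <o \<kappa>"
    using assms(1) small_Pow by blast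
  \<comment> \<open>The pair is coded by an unordered two-element set; the tags \<open>Inl\<close>
    and \<open>Inr\<close> keep its components apart, even when A and B share elements.\<close>
  moreover have "inj_on (\<lambda>(a, b). {Inl a, Inr b}) (A \<times> B)"
    by (auto simp: inj_on_def doubleton_eq_iff)
  ultimately show ?thesis
    by (rule small_inj_on[rotated 2]) auto
qed

lemma small_PiE:
  assumes "strongly_inaccessible \<kappa>" "|A| <o \<kappa>" "|B| <o \<kappa>"
  shows "|A \<rightarrow>\<^sub>E B| <o \<kappa>"
proof (rule small_inj_on)
  show "|Pow (A \<times> B)| <o \<kappa>"
    using assms small_Pow small_Times by blast
  show "inj_on (\<lambda>f. (\<lambda>x. (x, f x)) ` A) (A \<rightarrow>\<^sub>E B)"
    by (rule inj_onI, rule PiE_ext) auto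
qed auto


section \<open>Extremally disconnected covers\<close>

text \<open>Homeomorphisms commute with closure. The cover of a profinite set is built inside a
  product and then has to be moved to the type of \<kappa>.\<close>

lemma extremally_disconnected_space_homeomorphic:
  assumes "X homeomorphic_space Y" "extremally_disconnected_space X"
  shows "extremally_disconnected_space Y"
  unfolding extremally_disconnected_space_def
proof (intro allI impI)
  fix U assume U: "openin Y U"
  obtain f where f: "homeomorphic_map Y X f"
    using assms(1) homeomorphic_space homeomorphic_space_sym by blast
  have "openin X (f ` U)"
    using homeomorphic_map_openness[OF f openin_subset[OF U]] U by simp
  then have "openin X (f ` (Y closure_of U))"
    using assms(2) homeomorphic_map_closure_of[OF f openin_subset[OF U]]
    unfolding extremally_disconnected_space_def by metis
  then show "openin Y (Y closure_of U)"
    using homeomorphic_map_openness[OF f closure_of_subset_topspace] by blast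
qed

text \<open>Of two disjoint open neighbourhoods U of x and W of y, the closure of U still misses W,
  and it is open by extremal disconnectedness.\<close>

lemma extremally_disconnected_clopen_separation:
  assumes "Hausdorff_space X" "extremally_disconnected_space X"
    and "x \<in> topspace X" "y \<in> topspace X" "x \<noteq> y"
  obtains V where "openin X V" "closedin X V" "x \<in> V" "y \<notin> V"
proof -
  obtain U W where U: "openin X U" "openin X W" "x \<in> U" "y \<in> W" "disjnt U W"
    using assms unfolding Hausdorff_space_def by meson
  have "W \<inter> X closure_of U = {}"
    using U openin_Int_closure_of_eq_empty[of X W U] by (auto simp: disjnt_def)
  moreover have "x \<in> X closure_of U"
    using closure_of_subset[OF openin_subset[OF U(1)]] U(3) by auto
  ultimately show ?thesis
    using U assms(2) that[of "X closure_of U"] by (auto simp: extremally_disconnected_space_def)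
qed

text \<open>Clopen separation leaves no two points in a connected set. Each object of
  \<open>Extr\<close> is therefore itself among the profinite sets that define the topology of
  \<open>top_space\<close>, which later makes sections over it continuous.\<close>

lemma profinite_space_extremally_disconnected:
  assumes "compact_space X" "Hausdorff_space X" "extremally_disconnected_space X"
  shows "profinite_space X"
  unfolding profinite_space_def
proof (intro conjI allI impI)
  fix S assume S: "connectedin X S"
  have "x = y" if "x \<in> S" "y \<in> S" for x y
  proof (rule ccontr)
    assume "x \<noteq> y"
    moreover have "x \<in> topspace X" "y \<in> topspace X"
      using connectedin_subset_topspace[OF S] that by auto
    ultimately obtain V where "openin X V" "closedin X V" "x \<in> V" "y \<notin> V"
      using extremally_disconnected_clopen_separation[OF assms(2,3)] by metis
    then show False
      using connectedin_clopen_cases[OF S, of V] that by (auto simp: disjnt_iff)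
  qed
  then show "\<exists>a. S \<subseteq> {a}" by blast
qed (use assms in auto)

text \<open>Modelled on the Stone-Cech compactification, where each subset A of the discrete set S
  is the trace of a clopen C. If A is the trace of an open U, density gives U and C the same
  closure, namely that of the image of A; as C is clopen, the closure of U is C.\<close>

lemma extremally_disconnected_space_dense_clopen:
  assumes dense: "X closure_of (e ` S) = topspace X"
    and clopen: "\<And>A. A \<subseteq> S \<Longrightarrow> \<exists>C. openin X C \<and> closedin X C \<and> (\<forall>s\<in>S. e s \<in> C \<longleftrightarrow> s \<in> A)"
  shows "extremally_disconnected_space X"
  unfolding extremally_disconnected_space_def
proof (intro allI impI)
  fix U assume U: "openin X U"
  define A where "A = {s \<in> S. e s \<in> U}"
  obtain C where C: "openin X C" "closedin X C" "\<And>s. s \<in> S \<Longrightarrow> e s \<in> C \<longleftrightarrow> s \<in> A"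
    using clopen[of A] unfolding A_def by auto
  have UA: "U \<inter> e ` S = e ` A" and CA: "C \<inter> e ` S = e ` A"
    using C(3) by (auto simp: A_def)
  have "X closure_of U = X closure_of (e ` A)"
    using closure_of_openin_Int_closure_of[OF U, of "e ` S"] UA openin_subset[OF U]
    by (simp add: dense inf_absorb1)
  moreover have "X closure_of C = X closure_of (e ` A)"
    using closure_of_openin_Int_closure_of[OF C(1), of "e ` S"] CA openin_subset[OF C(1)]
    by (simp add: dense inf_absorb1)
  ultimately show "openin X (X closure_of U)"
    using C by (simp add: closure_of_closedin)
qed

section \<open>Final topologies and copies of a space on another type\<close>

lemma openin_final_topology:
  "openin (final_topology X f B) U \<longleftrightarrow> U \<subseteq> B \<and> openin X {x \<in> topspace X. f x \<in> U}"
  unfolding final_topology_def by (simp add: topology_inverse'[OF istopology_final])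

lemma topspace_final_topology:
  assumes "f \<in> topspace X \<rightarrow> B"
  shows "topspace (final_topology X f B) = B"
proof -
  have "{x \<in> topspace X. f x \<in> B} = topspace X"
    using assms by auto
  then have "openin (final_topology X f B) B"
    by (simp add: openin_final_topology)
  then show ?thesis
    by (meson openin_final_topology openin_subset openin_topspace subset_antisym)
qed

lemma continuous_map_final_topology:
  assumes "f \<in> topspace X \<rightarrow> B"
  shows "continuous_map (final_topology X f B) Y h \<longleftrightarrow>
    h \<in> B \<rightarrow> topspace Y \<and> continuous_map X Y (h \<circ> f)"
proof -
  have "{x \<in> topspace X. f x \<in> {y \<in> B. h y \<in> U}} = {x \<in> topspace X. h (f x) \<in> U}" for U
    using assms by auto
  then show ?thesis
    unfolding continuous_map_def topspace_final_topology[OF assms]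
    using assms by (auto simp: openin_final_topology)
qed

text \<open>The final topology makes the map onto its image a quotient map, and an injective
  quotient map is a homeomorphism.\<close>

lemma homeomorphic_copy:
  assumes "inj_on c (topspace X)"
  shows "homeomorphic_map X (final_topology X c (c ` topspace X)) c"
    (is "homeomorphic_map X ?Y c")
proof -
  have t: "topspace ?Y = c ` topspace X"
    by (rule topspace_final_topology) auto
  have "quotient_map X ?Y c"
    unfolding quotient_map_def t by (auto simp: openin_final_topology)
  then show ?thesis
    using assms by (simp add: homeomorphic_map_def)
qed

text \<open>
  The closure in \<open>2\<^bsup>Pow K\<^esup> \<times> K\<close> of the graph of the map sending \<open>s \<in> K\<close> to its principal ultrafilter is
  a copy of the Stone-Cech compactification of the discrete set \<open>K\<close>; its projection to \<open>K\<close> is the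
  limit map.
\<close>

lemma extremally_disconnected_cover:
  fixes K :: "'a topology" and \<kappa> :: "'k rel"
  assumes \<kappa>: "strongly_inaccessible \<kappa>" and K: "compact_space K" "Hausdorff_space K" "|topspace K| <o \<kappa>"
  obtains E :: "'k topology" and q where "compact_space E" "Hausdorff_space E"
    "extremally_disconnected_space E" "|topspace E| <o \<kappa>" "quotient_map E K q"
proof -
  define S where "S = topspace K"
  define P where "P = product_topology (\<lambda>_::'a set. discrete_topology (UNIV::bool set)) (Pow S)"
  define e where "e s = (\<lambda>A\<in>Pow S. s \<in> A, s)" for s
  define D where "D = (prod_topology P K) closure_of (e ` S)"
  define X where "X = subtopology (prod_topology P K) D"
  have tP: "topspace P = Pow S \<rightarrow>\<^sub>E UNIV"
    by (simp add: P_def)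
  have eS: "e ` S \<subseteq> topspace (prod_topology P K)"
  proof -
    have "restrict f (Pow S) \<in> Pow S \<rightarrow>\<^sub>E UNIV" for f :: "'a set \<Rightarrow> bool"
      by (rule restrict_PiE_iff[THEN iffD2]) simp
    then have "e s \<in> topspace P \<times> topspace K" if "s \<in> S" for s
      using that unfolding e_def tP S_def by (intro SigmaI)
    then show ?thesis
      unfolding topspace_prod_topology by (rule image_subsetI)
  qed
  have eD: "e ` S \<subseteq> D"
    unfolding D_def using eS by (rule closure_of_subset)
  have Dsub: "D \<subseteq> topspace (prod_topology P K)"
    unfolding D_def by (rule closure_of_subset_topspace)
  have tX: "topspace X = D"
    using Dsub unfolding X_def by (rule topspace_subtopology_subset)
  have clD: "closedin (prod_topology P K) D"
    unfolding D_def by simp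
  have cP: "compact_space P"
    by (simp add: P_def compact_space_product_topology compact_space_discrete_topology)
  have hP: "Hausdorff_space P"
    by (simp add: P_def Hausdorff_space_product_topology)
  have cX: "compact_space X"
    unfolding X_def using clD cP K(1)
    by (simp add: closedin_compact_space compact_space_prod_topology compact_space_subtopology)
  have hX: "Hausdorff_space X"
    unfolding X_def using hP K(2) by (simp add: Hausdorff_space_prod_topology Hausdorff_space_subtopology)
  have ed: "extremally_disconnected_space X"
  proof (rule extremally_disconnected_space_dense_clopen)
    show "X closure_of (e ` S) = topspace X"
      unfolding tX unfolding X_def closure_of_subtopology using eD D_def by (simp add: inf_absorb2)
  next
    fix A assume A: "A \<subseteq> S"
    have cont: "continuous_map X (discrete_topology UNIV) (\<lambda>x. fst x A)"
    proof -
      have "continuous_map P (discrete_topology UNIV) (\<lambda>f. f A)"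
        unfolding P_def
        using continuous_map_product_projection[of A "Pow S" "\<lambda>_. discrete_topology (UNIV::bool set)"] A
        by simp
      from continuous_map_compose[OF continuous_map_fst this]
      show ?thesis
        unfolding X_def o_def by (rule continuous_map_from_subtopology)
    qed
    \<comment> \<open>C consists of the points whose ultrafilter component contains A. It is the
      preimage of a point under the coordinate A, hence clopen, and the principal ultrafilter of s
      lies in it exactly when s is in A.\<close>
    show "\<exists>C. openin X C \<and> closedin X C \<and> (\<forall>s\<in>S. e s \<in> C \<longleftrightarrow> s \<in> A)"
    proof (intro exI conjI)
      show "openin X {x \<in> topspace X. fst x A \<in> {True}}"
        by (rule openin_continuous_map_preimage[OF cont]) simp
      show "closedin X {x \<in> topspace X. fst x A \<in> {True}}"
        by (rule closedin_continuous_map_preimage[OF cont]) simp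
      show "\<forall>s\<in>S. (e s \<in> {x \<in> topspace X. fst x A \<in> {True}}) = (s \<in> A)"
        using eD A by (auto simp: tX e_def)
    qed
  qed
  \<comment> \<open>Each point s of K is the second component of \<open>e s\<close>, so the
    projection is onto; a continuous surjection from a compact to a Hausdorff space is a quotient
    map.\<close>
  have q: "quotient_map X K snd"
  proof (rule continuous_imp_quotient_map)
    show c: "continuous_map X K snd"
      unfolding X_def by (rule continuous_map_from_subtopology[OF continuous_map_snd])
    show "snd ` topspace X = topspace K"
    proof
      show "topspace K \<subseteq> snd ` topspace X"
        using eD unfolding tX by (force simp: e_def S_def)
    qed (use c in \<open>simp add: continuous_map_image_subset_topspace\<close>)
  qed (use cX K(2) in auto)
  \<comment> \<open>The cover sits in the product of K with the functions from \<open>Pow S\<close>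
    to two values; two applications of the strong limit property bound it.\<close>
  have "|UNIV :: bool set| <o \<kappa>"
    using \<kappa> by (simp add: finite_small)
  then have "|(Pow S \<rightarrow>\<^sub>E (UNIV :: bool set)) \<times> S| <o \<kappa>"
    using \<kappa> K(3) small_PiE small_Times small_Pow unfolding S_def by blast
  then have sX: "|topspace X| <o \<kappa>"
    by (rule small_subset[rotated]) (use Dsub in \<open>simp add: tX tP S_def\<close>)
  then obtain c :: "_ \<Rightarrow> 'k" where c: "inj_on c (topspace X)"
    by (rule small_copy)
  define E where "E = final_topology X c (c ` topspace X)"
  have h: "homeomorphic_map X E c"
    unfolding E_def using c by (rule homeomorphic_copy)
  then have hs: "X homeomorphic_space E"
    by (rule homeomorphic_map_imp_homeomorphic_space)
  obtain d where d: "homeomorphic_map E X d"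
    using hs homeomorphic_space homeomorphic_space_sym by blast
  show thesis
  proof
    show "compact_space E" "Hausdorff_space E"
      using hs cX hX homeomorphic_compact_space homeomorphic_Hausdorff_space by blast+
    show "extremally_disconnected_space E"
      using hs ed by (rule extremally_disconnected_space_homeomorphic)
    show "|topspace E| <o \<kappa>"
      using small_image[OF sX] homeomorphic_imp_surjective_map[OF h] by metis
    show "quotient_map E K (snd \<circ> d)"
      using d q by (auto simp: homeomorphic_map_def intro: quotient_map_compose)
  qed
qed


section \<open>Functor categories\<close>

lemma is_categoryD:
  assumes "is_category C"
  shows ident_Hom: "X \<in> Obj C \<Longrightarrow> Ident C X \<in> Hom C X X"
    and comp_Hom: "\<lbrakk>X \<in> Obj C; Y \<in> Obj C; Z \<in> Obj C; f \<in> Hom C X Y; g \<in> Hom C Y Z\<rbrakk>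
      \<Longrightarrow> Comp C X Y Z g f \<in> Hom C X Z"
    and comp_ident_right: "\<lbrakk>X \<in> Obj C; Y \<in> Obj C; f \<in> Hom C X Y\<rbrakk> \<Longrightarrow> Comp C X X Y f (Ident C X) = f"
    and comp_ident_left: "\<lbrakk>X \<in> Obj C; Y \<in> Obj C; f \<in> Hom C X Y\<rbrakk> \<Longrightarrow> Comp C X Y Y (Ident C Y) f = f"
    and comp_assoc: "\<lbrakk>W \<in> Obj C; X \<in> Obj C; Y \<in> Obj C; Z \<in> Obj C; f \<in> Hom C W X; g \<in> Hom C X Y;
      h \<in> Hom C Y Z\<rbrakk> \<Longrightarrow> Comp C W X Z (Comp C X Y Z h g) f = Comp C W Y Z h (Comp C W X Y g f)"
  using assms unfolding is_category_def by blast+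

lemma is_functorD:
  assumes "is_functor C D F"
  shows functor_Obj: "X \<in> Obj C \<Longrightarrow> FObj F X \<in> Obj D"
    and functor_Hom: "\<lbrakk>X \<in> Obj C; Y \<in> Obj C; f \<in> Hom C X Y\<rbrakk>
      \<Longrightarrow> FMap F X Y f \<in> Hom D (FObj F X) (FObj F Y)"
    and functor_Ident: "X \<in> Obj C \<Longrightarrow> FMap F X X (Ident C X) = Ident D (FObj F X)"
    and functor_Comp: "\<lbrakk>X \<in> Obj C; Y \<in> Obj C; Z \<in> Obj C; f \<in> Hom C X Y; g \<in> Hom C Y Z\<rbrakk>
      \<Longrightarrow> FMap F X Z (Comp C X Y Z g f) =
        Comp D (FObj F X) (FObj F Y) (FObj F Z) (FMap F Y Z g) (FMap F X Y f)"
  using assms unfolding is_functor_def by blast+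

lemma is_category_op_cat: "is_category C \<Longrightarrow> is_category (op_cat C)"
  unfolding is_category_def op_cat_def by simp

lemma is_category_full_subcat: "is_category C \<Longrightarrow> is_category (full_subcat C P)"
  unfolding is_category_def full_subcat_def by simp

lemma is_functor_functor_comp:
  assumes "is_functor C D F" "is_functor D E G"
  shows "is_functor C E (G \<circ>\<^sub>F F)"
  using assms unfolding is_functor_def functor_comp_def by simp

lemma nat_transD:
  assumes "\<eta> \<in> nat_trans C D F G"
  shows nat_trans_ext: "\<eta> \<in> extensional (Obj C)"
    and nat_trans_Hom: "X \<in> Obj C \<Longrightarrow> \<eta> X \<in> Hom D (FObj F X) (FObj G X)"
    and nat_trans_natural: "\<lbrakk>X \<in> Obj C; Y \<in> Obj C; f \<in> Hom C X Y\<rbrakk> \<Longrightarrow>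
      Comp D (FObj F X) (FObj F Y) (FObj G Y) (\<eta> Y) (FMap F X Y f) =
      Comp D (FObj F X) (FObj G X) (FObj G Y) (FMap G X Y f) (\<eta> X)"
  using assms unfolding nat_trans_def by (auto simp: PiE_def)

lemma is_category_functor_cat:
  assumes C: "is_category C" and D: "is_category D"
  shows "is_category (functor_cat C D)"
proof -
  let ?o = "\<lambda>F G H \<beta> \<alpha>. \<lambda>X\<in>Obj C. Comp D (FObj F X) (FObj G X) (FObj H X) (\<beta> X) (\<alpha> X)"
  have id: "(\<lambda>X\<in>Obj C. Ident D (FObj F X)) \<in> nat_trans C D F F" if F: "is_functor C D F" for F
    unfolding nat_trans_def
  proof (intro CollectI conjI ballI)
    show "(\<lambda>X\<in>Obj C. Ident D (FObj F X)) \<in> (\<Pi>\<^sub>E X\<in>Obj C. Hom D (FObj F X) (FObj F X))"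
      using functor_Obj[OF F] ident_Hom[OF D] by auto
    fix X Y f assume "X \<in> Obj C" "Y \<in> Obj C" "f \<in> Hom C X Y"
    then show "Comp D (FObj F X) (FObj F Y) (FObj F Y) ((\<lambda>X\<in>Obj C. Ident D (FObj F X)) Y) (FMap F X Y f) =
        Comp D (FObj F X) (FObj F X) (FObj F Y) (FMap F X Y f) ((\<lambda>X\<in>Obj C. Ident D (FObj F X)) X)"
      using functor_Obj[OF F] functor_Hom[OF F] comp_ident_left[OF D] comp_ident_right[OF D] by simp
  qed
  have comp: "?o F G H \<beta> \<alpha> \<in> nat_trans C D F H"
    if F: "is_functor C D F" and G: "is_functor C D G" and H: "is_functor C D H"
      and \<alpha>: "\<alpha> \<in> nat_trans C D F G" and \<beta>: "\<beta> \<in> nat_trans C D G H" for F G H \<alpha> \<beta>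
    unfolding nat_trans_def
  proof (intro CollectI conjI ballI)
    note Ob = functor_Obj[OF F] functor_Obj[OF G] functor_Obj[OF H]
    show "?o F G H \<beta> \<alpha> \<in> (\<Pi>\<^sub>E X\<in>Obj C. Hom D (FObj F X) (FObj H X))"
      using Ob nat_trans_Hom[OF \<alpha>] nat_trans_Hom[OF \<beta>] by (auto intro: comp_Hom[OF D])
    fix X Y f assume X: "X \<in> Obj C" and Y: "Y \<in> Obj C" and f: "f \<in> Hom C X Y"
    note Hs = functor_Hom[OF F X Y f] functor_Hom[OF G X Y f] functor_Hom[OF H X Y f]
      nat_trans_Hom[OF \<alpha> X] nat_trans_Hom[OF \<beta> X] nat_trans_Hom[OF \<alpha> Y] nat_trans_Hom[OF \<beta> Y]
    have "Comp D (FObj F X) (FObj F Y) (FObj H Y) (Comp D (FObj F Y) (FObj G Y) (FObj H Y) (\<beta> Y) (\<alpha> Y)) (FMap F X Y f)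
        = Comp D (FObj F X) (FObj G Y) (FObj H Y) (\<beta> Y)
            (Comp D (FObj F X) (FObj F Y) (FObj G Y) (\<alpha> Y) (FMap F X Y f))"
      using X Y Ob Hs by (intro comp_assoc[OF D]) auto
    also have "\<dots> = Comp D (FObj F X) (FObj G Y) (FObj H Y) (\<beta> Y)
            (Comp D (FObj F X) (FObj G X) (FObj G Y) (FMap G X Y f) (\<alpha> X))"
      by (simp add: nat_trans_natural[OF \<alpha> X Y f])
    also have "\<dots> = Comp D (FObj F X) (FObj G X) (FObj H Y)
            (Comp D (FObj G X) (FObj G Y) (FObj H Y) (\<beta> Y) (FMap G X Y f)) (\<alpha> X)"
      using X Y Ob Hs by (intro comp_assoc[OF D, symmetric]) auto
    also have "\<dots> = Comp D (FObj F X) (FObj G X) (FObj H Y)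
            (Comp D (FObj G X) (FObj H X) (FObj H Y) (FMap H X Y f) (\<beta> X)) (\<alpha> X)"
      by (simp add: nat_trans_natural[OF \<beta> X Y f])
    also have "\<dots> = Comp D (FObj F X) (FObj H X) (FObj H Y) (FMap H X Y f)
            (Comp D (FObj F X) (FObj G X) (FObj H X) (\<beta> X) (\<alpha> X))"
      using X Y Ob Hs by (intro comp_assoc[OF D]) auto
    finally show "Comp D (FObj F X) (FObj F Y) (FObj H Y) (?o F G H \<beta> \<alpha> Y) (FMap F X Y f) =
        Comp D (FObj F X) (FObj H X) (FObj H Y) (FMap H X Y f) (?o F G H \<beta> \<alpha> X)"
      using X Y by simp
  qed
  show ?thesis
    unfolding is_category_def
  proof (intro conjI ballI)
    fix F assume "F \<in> Obj (functor_cat C D)"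
    then show "Ident (functor_cat C D) F \<in> Hom (functor_cat C D) F F"
      using id by (simp add: functor_cat_def)
  next
    fix F G H \<alpha> \<beta>
    assume "F \<in> Obj (functor_cat C D)" "G \<in> Obj (functor_cat C D)" "H \<in> Obj (functor_cat C D)"
      "\<alpha> \<in> Hom (functor_cat C D) F G" "\<beta> \<in> Hom (functor_cat C D) G H"
    then show "Comp (functor_cat C D) F G H \<beta> \<alpha> \<in> Hom (functor_cat C D) F H"
      using comp[of F G H \<alpha> \<beta>] by (simp add: functor_cat_def)
  next
    fix F G \<alpha>
    assume "F \<in> Obj (functor_cat C D)" "G \<in> Obj (functor_cat C D)" "\<alpha> \<in> Hom (functor_cat C D) F G"
    then have F: "is_functor C D F" and G: "is_functor C D G" and \<alpha>: "\<alpha> \<in> nat_trans C D F G"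
      by (auto simp: functor_cat_def)
    note * = functor_Obj[OF F] functor_Obj[OF G] nat_trans_Hom[OF \<alpha>] nat_trans_ext[OF \<alpha>]
    show "Comp (functor_cat C D) F F G \<alpha> (Ident (functor_cat C D) F) = \<alpha>"
      using * by (auto simp: functor_cat_def fun_eq_iff extensional_def comp_ident_right[OF D])
    show "Comp (functor_cat C D) F G G (Ident (functor_cat C D) G) \<alpha> = \<alpha>"
      using * by (auto simp: functor_cat_def fun_eq_iff extensional_def comp_ident_left[OF D])
  next
    fix F G H K \<alpha> \<beta> \<gamma>
    assume "F \<in> Obj (functor_cat C D)" "G \<in> Obj (functor_cat C D)" "H \<in> Obj (functor_cat C D)"
      "K \<in> Obj (functor_cat C D)"
      and \<alpha>: "\<alpha> \<in> Hom (functor_cat C D) F G" and \<beta>: "\<beta> \<in> Hom (functor_cat C D) G H"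
      and \<gamma>: "\<gamma> \<in> Hom (functor_cat C D) H K"
    then have "is_functor C D F" "is_functor C D G" "is_functor C D H" "is_functor C D K"
      by (auto simp: functor_cat_def)
    note Ob = this[THEN functor_Obj]
    have "\<alpha> \<in> nat_trans C D F G" "\<beta> \<in> nat_trans C D G H" "\<gamma> \<in> nat_trans C D H K"
      using \<alpha> \<beta> \<gamma> by (auto simp: functor_cat_def)
    note Hs = this[THEN nat_trans_Hom]
    show "Comp (functor_cat C D) F G K (Comp (functor_cat C D) G H K \<gamma> \<beta>) \<alpha> =
        Comp (functor_cat C D) F H K \<gamma> (Comp (functor_cat C D) F G H \<beta> \<alpha>)"
      using Ob Hs by (auto simp: functor_cat_def fun_eq_iff intro!: comp_assoc[OF D])
  qed
qed

text \<open>The bijections \<open>\<psi>\<close> make \<open>F\<close> a left adjoint of \<open>U\<close> relative to \<open>J\<close>.\<close>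

lemma left_adjoint_relative:
  assumes R: "left_adjoint D E R J" and F: "is_functor C D F" and U: "is_functor E C U"
    and bij: "\<And>X Y. X \<in> Obj C \<Longrightarrow> Y \<in> Obj E \<Longrightarrow>
      bij_betw (\<psi> X Y) (Hom D (FObj F X) (FObj J Y)) (Hom C X (FObj U Y))"
    and nat: "\<And>X X' Y Y' h u g. \<lbrakk>X \<in> Obj C; X' \<in> Obj C; Y \<in> Obj E; Y' \<in> Obj E; h \<in> Hom C X' X;
      u \<in> Hom D (FObj F X) (FObj J Y); g \<in> Hom E Y Y'\<rbrakk> \<Longrightarrow>
      \<psi> X' Y' (Comp D (FObj F X') (FObj F X) (FObj J Y')
        (Comp D (FObj F X) (FObj J Y) (FObj J Y') (FMap J Y Y' g) u) (FMap F X' X h)) =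
      Comp C X' X (FObj U Y') (Comp C X (FObj U Y) (FObj U Y') (FMap U Y Y' g) (\<psi> X Y u)) h"
  shows "left_adjoint C E (R \<circ>\<^sub>F F) U"
proof -
  obtain \<phi> where \<phi>: "\<And>X Y. X \<in> Obj D \<Longrightarrow> Y \<in> Obj E \<Longrightarrow>
      bij_betw (\<phi> X Y) (Hom E (FObj R X) Y) (Hom D X (FObj J Y))"
    and \<phi>_nat: "\<And>X X' Y Y' h u g. \<lbrakk>X \<in> Obj D; X' \<in> Obj D; Y \<in> Obj E; Y' \<in> Obj E; h \<in> Hom D X' X;
      u \<in> Hom E (FObj R X) Y; g \<in> Hom E Y Y'\<rbrakk> \<Longrightarrow>
      \<phi> X' Y' (Comp E (FObj R X') (FObj R X) Y' (Comp E (FObj R X) Y Y' g u) (FMap R X' X h)) =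
      Comp D X' X (FObj J Y') (Comp D X (FObj J Y) (FObj J Y') (FMap J Y Y' g) (\<phi> X Y u)) h"
    and R': "is_functor D E R"
    using R unfolding left_adjoint_def by blast
  note Fo = functor_Obj[OF F]
  \<comment> \<open>The adjunction of R is followed by \<psi>. Only hom-sets into objects of the
    form \<open>FObj J Y\<close> occur, so F may fail to have a right adjoint on all of D.\<close>
  have b: "bij_betw (\<psi> X Y \<circ> \<phi> (FObj F X) Y) (Hom E (FObj (R \<circ>\<^sub>F F) X) Y) (Hom C X (FObj U Y))"
    if "X \<in> Obj C" "Y \<in> Obj E" for X Y
    using bij_betw_trans[OF \<phi>[OF Fo] bij] that by (simp add: functor_comp_def)
  have n: "(\<psi> X' Y' \<circ> \<phi> (FObj F X') Y') (Comp E (FObj (R \<circ>\<^sub>F F) X') (FObj (R \<circ>\<^sub>F F) X) Y'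
        (Comp E (FObj (R \<circ>\<^sub>F F) X) Y Y' g u) (FMap (R \<circ>\<^sub>F F) X' X h)) =
      Comp C X' X (FObj U Y') (Comp C X (FObj U Y) (FObj U Y') (FMap U Y Y' g)
        ((\<psi> X Y \<circ> \<phi> (FObj F X) Y) u)) h"
    if "X \<in> Obj C" "X' \<in> Obj C" "Y \<in> Obj E" "Y' \<in> Obj E" "h \<in> Hom C X' X"
      "u \<in> Hom E (FObj (R \<circ>\<^sub>F F) X) Y" "g \<in> Hom E Y Y'" for X X' Y Y' h u g
  proof -
    have "\<phi> (FObj F X) Y u \<in> Hom D (FObj F X) (FObj J Y)"
      using \<phi>[OF Fo[OF that(1)] that(3)] that(6) by (auto simp: functor_comp_def dest: bij_betwE)
    then show ?thesis
      using nat[OF that(1-5) _ that(7)] \<phi>_nat[OF Fo Fo that(3,4) functor_Hom[OF F that(2,1,5)]] that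
      by (simp add: functor_comp_def)
  qed
  show ?thesis
    unfolding left_adjoint_def
    by (intro conjI exI[of _ "\<lambda>X Y. \<psi> X Y \<circ> \<phi> (FObj F X) Y"] ballI is_functor_functor_comp[OF F R'] U)
      (rule b n; assumption)+
qed


section \<open>The categories of small groups and of extremally disconnected spaces\<close>

lemma is_category_Grp_cat: "is_category (Grp_cat \<kappa>)"
proof -
  have "(\<lambda>x\<in>carrier G. x) \<in> hom G G" if "group G" for G :: "'a monoid"
    using that by (auto simp: hom_def group.is_monoid monoid.m_closed)
  moreover have "compose (carrier G) g f \<in> hom G K"
    if "group G" "f \<in> hom G H" "g \<in> hom H K" for G H K :: "'a monoid" and f g
    using that group.hom_compose by blast
  moreover have "f x \<in> carrier H" if "f \<in> hom G H" "x \<in> carrier G" for G H :: "'a monoid" and f x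
    using that by (auto simp: hom_def)
  ultimately show ?thesis
    by (auto simp: is_category_def Grp_cat_def compose_def fun_eq_iff extensional_def)
qed

section \<open>Continuous maps as arrows\<close>

lemma cmaps_ident: "(\<lambda>x\<in>topspace X. x) \<in> cmaps X X"
  unfolding cmaps_def by (auto intro: continuous_map_eq[OF continuous_map_id])

lemma cmaps_compose:
  assumes "f \<in> cmaps X Y" "g \<in> cmaps Y Z"
  shows "compose (topspace X) g f \<in> cmaps X Z"
proof -
  have "continuous_map X Z (g \<circ> f)"
    using assms by (auto simp: cmaps_def intro: continuous_map_compose)
  then show ?thesis
    by (auto simp: cmaps_def compose_def intro: continuous_map_eq)
qed

lemma cmaps_topspace: "f \<in> cmaps X Y \<Longrightarrow> x \<in> topspace X \<Longrightarrow> f x \<in> topspace Y"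
  by (auto simp: cmaps_def continuous_map_def)

lemma cmaps_eqI:
  assumes "f \<in> cmaps X Y" "g \<in> cmaps X Y" "\<And>x. x \<in> topspace X \<Longrightarrow> f x = g x"
  shows "f = g"
  using assms by (auto simp: cmaps_def intro: extensionalityI)

lemma restrict_cmaps: "continuous_map X Y f \<Longrightarrow> restrict f (topspace X) \<in> cmaps X Y"
  by (auto simp: cmaps_def intro: continuous_map_eq)

lemma is_category_Top_cat: "is_category (Top_cat \<kappa>)"
proof -
  have *: "f \<in> extensional (topspace X)" "f \<in> topspace X \<rightarrow> topspace Y" if "f \<in> cmaps X Y"
    for X Y :: "'a topology" and f
    using that by (auto simp: cmaps_def continuous_map_def)
  show ?thesis
    unfolding is_category_def Top_cat_def
    by (simp add: cmaps_ident cmaps_compose compose_assoc[OF *(2)] Id_compose[OF *(2,1)]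
        compose_Id[OF *(2,1)])
qed

section \<open>Unfolding rules for the concrete categories\<close>

lemma Extr_simps [simp]:
  "K \<in> Obj (Extr \<delta>) \<longleftrightarrow> |topspace K| <o \<delta> \<and> compact_space K \<and> Hausdorff_space K \<and>
    extremally_disconnected_space K"
  "Hom (Extr \<delta>) = cmaps"
  "Comp (Extr \<delta>) K L M g f = compose (topspace K) g f"
  "Ident (Extr \<delta>) K = (\<lambda>x\<in>topspace K. x)"
  by (simp_all add: Extr_def full_subcat_def Top_cat_def)

lemma op_cat_simps [simp]:
  "Obj (op_cat C) = Obj C"
  "Hom (op_cat C) X Y = Hom C Y X"
  "Comp (op_cat C) X Y Z g f = Comp C Z Y X f g"
  "Ident (op_cat C) X = Ident C X"
  by (simp_all add: op_cat_def)

lemma Set_cat_simps [simp]: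
  "A \<in> Obj (Set_cat \<kappa>) \<longleftrightarrow> |A| <o \<kappa>"
  "Hom (Set_cat \<kappa>) A B = A \<rightarrow>\<^sub>E B"
  "Comp (Set_cat \<kappa>) A B C g f = compose A g f"
  "Ident (Set_cat \<kappa>) A = (\<lambda>x\<in>A. x)"
  by (simp_all add: Set_cat_def)

lemma Grp_cat_simps [simp]:
  "G \<in> Obj (Grp_cat \<kappa>) \<longleftrightarrow> group G \<and> |carrier G| <o \<kappa>"
  "Hom (Grp_cat \<kappa>) G H = hom G H \<inter> extensional (carrier G)"
  "Comp (Grp_cat \<kappa>) G H K g f = compose (carrier G) g f"
  "Ident (Grp_cat \<kappa>) G = (\<lambda>x\<in>carrier G. x)"
  by (simp_all add: Grp_cat_def)

lemma qTopGrp_simps [simp]: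
  "G \<in> Obj (qTopGrp \<kappa>) \<longleftrightarrow> quasi_topological_group G \<and> |carrier G| <o \<kappa>"
  "Hom (qTopGrp \<kappa>) G H = hom G H \<inter> cmaps (topol G) (topol H)"
  "Comp (qTopGrp \<kappa>) G H K g f = compose (carrier G) g f"
  "Ident (qTopGrp \<kappa>) G = (\<lambda>x\<in>carrier G. x)"
  by (simp_all add: qTopGrp_def)

lemma TopGrp_simps [simp]:
  "G \<in> Obj (TopGrp \<kappa>) \<longleftrightarrow> topological_group G \<and> |carrier G| <o \<kappa>"
  "Hom (TopGrp \<kappa>) G H = hom G H \<inter> cmaps (topol G) (topol H)"
  "Comp (TopGrp \<kappa>) G H K g f = compose (carrier G) g f"
  "Ident (TopGrp \<kappa>) G = (\<lambda>x\<in>carrier G. x)"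
  using topological_imp_quasi_topological by (auto simp: TopGrp_def full_subcat_def)

lemma is_category_Extr: "is_category (Extr \<delta>)"
  unfolding Extr_def by (intro is_category_full_subcat is_category_Top_cat)

lemma is_category_CondGrp: "is_category (CondGrp \<delta> \<epsilon>)"
  unfolding Cond_def
  by (intro is_category_full_subcat is_category_functor_cat is_category_op_cat is_category_Extr
      is_category_Grp_cat)

lemma Cond_Hom: "Hom (Cond \<delta> E) = nat_trans (op_cat (Extr \<delta>)) E"
  by (simp add: Cond_def full_subcat_def functor_cat_def)

lemma Cond_Obj: "X \<in> Obj (Cond \<delta> E) \<longleftrightarrow>
    is_functor (op_cat (Extr \<delta>)) E X \<and> preserves_finite_products (op_cat (Extr \<delta>)) E X"
  by (simp add: Cond_def full_subcat_def functor_cat_def)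

lemma Cond_Comp: "Comp (Cond \<delta> E) X Y Z \<beta> \<alpha> =
    (\<lambda>K\<in>Obj (Extr \<delta>). Comp E (FObj X K) (FObj Y K) (FObj Z K) (\<beta> K) (\<alpha> K))"
  by (simp add: Cond_def full_subcat_def functor_cat_def)

lemma Cond_Ident: "Ident (Cond \<delta> E) X = (\<lambda>K\<in>Obj (Extr \<delta>). Ident E (FObj X K))"
  by (simp add: Cond_def full_subcat_def functor_cat_def)


section \<open>Coproducts of extremally disconnected spaces\<close>

lemma compose_eqD: "compose A g f = h \<Longrightarrow> x \<in> A \<Longrightarrow> g (f x) = h x"
  by (auto simp: compose_def)

text \<open>Maps to a two-point discrete space are the test maps by which the universal property of
  a coproduct in \<open>Extr\<close> is exploited.\<close>

lemma clopen_indicator_cmaps: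
  assumes "openin X V" "closedin X V"
  shows "(\<lambda>x\<in>topspace X. if x \<in> V then a else b) \<in> cmaps X (discrete_topology {a, b})"
proof (rule restrict_cmaps)
  have "openin X {x \<in> topspace X. (if x \<in> V then a else b) \<in> U}" for U
  proof -
    have "openin X (topspace X \<inter> V)" "openin X (topspace X - V)"
      using assms by auto
    moreover have "{x \<in> topspace X. (if x \<in> V then a else b) \<in> U} =
        (if a \<in> U then topspace X \<inter> V else {}) \<union> (if b \<in> U then topspace X - V else {})"
      by auto
    ultimately show ?thesis
      by (auto intro!: openin_Un)
  qed
  then show "continuous_map X (discrete_topology {a, b}) (\<lambda>x. if x \<in> V then a else b)"
    by (auto simp: continuous_map_def)
qed

text \<open>In a discrete space every set is its own closure. The one-point and the two-point space
  are the instances that matter.\<close>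

lemma Obj_Extr_discrete_finite:
  "strongly_inaccessible \<delta> \<Longrightarrow> finite A \<Longrightarrow> discrete_topology A \<in> Obj (Extr \<delta>)"
  by (simp add: finite_small compact_space_discrete_topology extremally_disconnected_space_def
      discrete_topology_closure_of)

text \<open>The universal property of P concerns targets in \<open>Extr\<close>, while T is an
  arbitrary space, even on another type. Testing against two points shows that the legs are jointly
  injective and jointly surjective. So P is the disjoint union as a set, and compactness of the
  finitely many summands makes the glued map continuous.\<close>

lemma Extr_coproduct_gluing:
  fixes \<delta> :: "'d rel" and T :: "'t topology"
  assumes \<delta>: "strongly_inaccessible \<delta>" and I: "finite I"
    and P: "is_product (op_cat (Extr \<delta>)) I X P p"
    and g: "\<And>i. i \<in> I \<Longrightarrow> g i \<in> cmaps (X i) T"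
  shows "\<exists>!h. h \<in> cmaps P T \<and> (\<forall>i\<in>I. compose (topspace (X i)) h (p i) = g i)"
proof -
  \<comment> \<open>The two-point test space needs two distinct elements of \<open>'d\<close>, which
    exist because \<delta> is infinite.\<close>
  have "\<not> finite (UNIV :: 'd set)"
    using strongly_inaccessible_infinite[OF \<delta>] rev_finite_subset[OF _ subset_UNIV, of "Field \<delta>"]
    by auto
  then have "(UNIV :: 'd set) \<noteq> {undefined}"
    by (metis finite.emptyI finite_insert)
  then obtain a b :: 'd where ab: "a \<noteq> b"
    by auto
  let ?D = "discrete_topology {a, b}"
  have cP: "compact_space P" and hP: "Hausdorff_space P" and eP: "extremally_disconnected_space P"
    and X: "\<And>i. i \<in> I \<Longrightarrow> X i \<in> Obj (Extr \<delta>)" and p: "\<And>i. i \<in> I \<Longrightarrow> p i \<in> cmaps (X i) P"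
    using P by (auto simp: is_product_def)
  have univ: "\<exists>!u. u \<in> cmaps P ?D \<and> (\<forall>i\<in>I. compose (topspace (X i)) u (p i) = f i)"
    if "\<And>i. i \<in> I \<Longrightarrow> f i \<in> cmaps (X i) ?D" for f
    using P that Obj_Extr_discrete_finite[OF \<delta>, of "{a, b}"] unfolding is_product_def
    by (simp del: Extr_simps(1))
  have sep: "i = j \<and> x = y"
    if i: "i \<in> I" "x \<in> topspace (X i)" and j: "j \<in> I" "y \<in> topspace (X j)" and eq: "p i x = p j y"
    for i j x y
  proof (rule ccontr)
    assume neq: "\<not> (i = j \<and> x = y)"
    \<comment> \<open>If the two points lie in different summands, W is all of \<open>X i\<close>;
      otherwise it is a clopen separation within the common summand. Extended by the empty set on
      the other summands, it yields a map on P that distinguishes the two images.\<close>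
    have "\<exists>W. openin (X i) W \<and> closedin (X i) W \<and> x \<in> W \<and> \<not> (i = j \<and> y \<in> W)"
    proof (cases "i = j")
      case True
      then obtain W where "openin (X i) W" "closedin (X i) W" "x \<in> W" "y \<notin> W"
        using extremally_disconnected_clopen_separation[of "X i" x y] X[OF i(1)] i j neq by auto
      then show ?thesis by blast
    qed (use i in auto)
    then obtain W where W: "openin (X i) W" "closedin (X i) W" "x \<in> W" "\<not> (i = j \<and> y \<in> W)"
      by blast
    define V where "V k = (if k = i then W else {})" for k
    have "(\<lambda>z\<in>topspace (X k). if z \<in> V k then a else b) \<in> cmaps (X k) ?D" for k
      by (rule clopen_indicator_cmaps) (auto simp: V_def W)
    then obtain u where u: "\<forall>k\<in>I. compose (topspace (X k)) u (p k) = (\<lambda>z\<in>topspace (X k). if z \<in> V k then a else b)"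
      using ex1_implies_ex[OF univ[of "\<lambda>k. \<lambda>z\<in>topspace (X k). if z \<in> V k then a else b"]] by blast
    have "u (p k z) = (if z \<in> V k then a else b)" if "k \<in> I" "z \<in> topspace (X k)" for k z
      using compose_eqD[OF u[rule_format, OF that(1)] that(2)] that(2) by simp
    from this[OF i] this[OF j] show False
      using eq ab W by (auto simp: V_def split: if_splits)
  qed
  \<comment> \<open>Images of compact sets are closed in the Hausdorff space P, and there are
    finitely many. This serves both surjectivity and continuity.\<close>
  have image_closed: "closedin P (\<Union>i\<in>I. p i ` C i)" if "\<And>i. i \<in> I \<Longrightarrow> closedin (X i) (C i)" for C
  proof (rule closedin_Union)
    show "finite ((\<lambda>i. p i ` C i) ` I)" using I by simp
    fix S assume "S \<in> (\<lambda>i. p i ` C i) ` I"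
    then obtain i where i: "i \<in> I" "S = p i ` C i" by blast
    have "compactin (X i) (C i)"
      using X[OF i(1)] that[OF i(1)] closedin_compact_space by auto
    then have "compactin P S"
      using i p by (auto simp: cmaps_def intro: image_compactin)
    then show "closedin P S"
      using hP compactin_imp_closedin by blast
  qed
  \<comment> \<open>A point missed by all legs has a clopen neighbourhood V away from the closed
    union of their images. The indicator of V and that of the empty set then agree on every summand,
    against uniqueness.\<close>
  have cover: "\<exists>i\<in>I. \<exists>x\<in>topspace (X i). p i x = y" if y: "y \<in> topspace P" for y
  proof (rule ccontr)
    define C where "C = (\<Union>i\<in>I. p i ` topspace (X i))"
    assume "\<not> ?thesis"
    then have "y \<in> topspace P - C" and "closedin P C"
      using y image_closed[of "\<lambda>i. topspace (X i)"] by (auto simp: C_def)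
    then obtain U W where U: "openin P U" "openin P W" "y \<in> U" "C \<subseteq> W" "disjnt U W"
      using compact_Hausdorff_imp_regular_space[OF cP hP] unfolding regular_space_def by meson
    define V where "V = P closure_of U"
    have V: "openin P V" "closedin P V" "y \<in> V"
      using eP U closure_of_subset[OF openin_subset[OF U(1)]]
      by (auto simp: V_def extremally_disconnected_space_def)
    have "V \<inter> C = {}"
      using U openin_Int_closure_of_eq_empty[OF U(2), of U] by (auto simp: V_def disjnt_def)
    let ?c = "\<lambda>V. \<lambda>z\<in>topspace P. if z \<in> V then a else b"
    have "?c V \<in> cmaps P ?D" "?c {} \<in> cmaps P ?D"
      using V by (auto intro!: clopen_indicator_cmaps[of P V] clopen_indicator_cmaps[of P "{}", simplified])
    moreover have "compose (topspace (X i)) (?c V) (p i) = (\<lambda>x\<in>topspace (X i). b)"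
        "compose (topspace (X i)) (?c {}) (p i) = (\<lambda>x\<in>topspace (X i). b)" if "i \<in> I" for i
      using \<open>V \<inter> C = {}\<close> that cmaps_topspace[OF p[OF that]]
      by (auto simp: compose_def C_def fun_eq_iff)
    moreover have "(\<lambda>x\<in>topspace (X i). b) \<in> cmaps (X i) ?D" for i
      using clopen_indicator_cmaps[of "X i" "{}" a b] by simp
    ultimately have "?c V = ?c {}"
      using univ[of "\<lambda>i. \<lambda>x\<in>topspace (X i). b"] by blast
    then show False
      using V y ab by (auto simp: fun_eq_iff split: if_splits)
  qed
  \<comment> \<open>The description is met by a unique value: \<open>cover\<close> gives existence
    and \<open>sep\<close> independence of the chosen preimage.\<close>
  define h where "h = (\<lambda>y\<in>topspace P. THE z. \<exists>i\<in>I. \<exists>x\<in>topspace (X i). p i x = y \<and> z = g i x)"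
  have h: "h (p i x) = g i x" if "i \<in> I" "x \<in> topspace (X i)" for i x
  proof -
    have "(THE z. \<exists>j\<in>I. \<exists>y\<in>topspace (X j). p j y = p i x \<and> z = g j y) = g i x"
      by (rule the_equality) (use that sep in \<open>blast+\<close>)
    then show ?thesis
      using cmaps_topspace[OF p[OF that(1)] that(2)] by (simp add: h_def)
  qed
  have "h \<in> cmaps P T"
  proof -
    have "h \<in> topspace P \<rightarrow> topspace T"
      using cover h cmaps_topspace[OF g] by fastforce
    \<comment> \<open>Continuity is checked on closed sets, since the preimage under h is the union
      of the images of the preimages under the \<open>g i\<close>.\<close>
    moreover have "closedin P {y \<in> topspace P. h y \<in> C}" if "closedin T C" for C
    proof -
      have "{y \<in> topspace P. h y \<in> C} = (\<Union>i\<in>I. p i ` {x \<in> topspace (X i). g i x \<in> C})"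
      proof
        show "{y \<in> topspace P. h y \<in> C} \<subseteq> (\<Union>i\<in>I. p i ` {x \<in> topspace (X i). g i x \<in> C})"
          using cover h by force
        show "(\<Union>i\<in>I. p i ` {x \<in> topspace (X i). g i x \<in> C}) \<subseteq> {y \<in> topspace P. h y \<in> C}"
          using h cmaps_topspace[OF p] by auto
      qed
      moreover have "closedin (X i) {x \<in> topspace (X i). g i x \<in> C}" if "i \<in> I" for i
        using g[OF that] \<open>closedin T C\<close> by (auto simp: cmaps_def intro: closedin_continuous_map_preimage)
      ultimately show ?thesis
        using image_closed by simp
    qed
    ultimately show ?thesis
      by (auto simp: cmaps_def continuous_map_closedin h_def)
  qed
  moreover have "compose (topspace (X i)) h (p i) = g i" if "i \<in> I" for i
    using h[OF that] g[OF that] by (auto simp: cmaps_def compose_def fun_eq_iff extensional_def)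
  moreover have "h' = h" if "h' \<in> cmaps P T" "\<forall>i\<in>I. compose (topspace (X i)) h' (p i) = g i" for h'
  proof (rule cmaps_eqI[OF that(1) \<open>h \<in> cmaps P T\<close>])
    fix y assume "y \<in> topspace P"
    then obtain i x where "i \<in> I" "x \<in> topspace (X i)" "p i x = y"
      using cover by blast
    then show "h' y = h y"
      using compose_eqD[of "topspace (X i)" h' "p i" "g i" x] that(2) h by auto
  qed
  ultimately show ?thesis
    by blast
qed


section \<open>The condensed group of a topological group\<close>

text \<open>The choice in \<open>encode\<close> returns an injection as soon as one exists, and
  smallness of A provides one.\<close>

lemma inj_on_encode:
  fixes \<epsilon> :: "'e rel"
  assumes "|A| <o \<epsilon>"
  shows "inj_on (encode A :: 'a \<Rightarrow> 'e) A"
proof -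
  have "\<exists>c :: 'a \<Rightarrow> 'e. inj_on c A"
    using small_copy[OF assms] by blast
  then show ?thesis
    unfolding encode_def by (rule someI_ex)
qed

lemma cmaps_small:
  assumes "strongly_inaccessible \<kappa>" "|topspace K| <o \<kappa>" "|topspace T| <o \<kappa>"
  shows "|cmaps K T| <o \<kappa>"
proof (rule small_subset)
  show "cmaps K T \<subseteq> topspace K \<rightarrow>\<^sub>E topspace T"
    by (auto simp: cmaps_def continuous_map_def PiE_def)
qed (rule small_PiE[OF assms])

section \<open>Pointwise operations on continuous maps into a topological group\<close>

lemma topological_groupD:
  assumes "topological_group H"
  shows topological_group_group: "group H"
    and topological_group_topspace: "topspace (topol H) = carrier H"
    and topological_group_inv: "continuous_map (topol H) (topol H) (\<lambda>x. inv\<^bsub>H\<^esub> x)"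
    and topological_group_mult:
      "continuous_map (prod_topology (topol H) (topol H)) (topol H) (\<lambda>(x, y). x \<otimes>\<^bsub>H\<^esub> y)"
  using assms unfolding topological_group_def by blast+

lemma cmaps_carrier:
  "topological_group H \<Longrightarrow> a \<in> cmaps K (topol H) \<Longrightarrow> k \<in> topspace K \<Longrightarrow> a k \<in> carrier H"
  using cmaps_topspace[of a K "topol H" k] by (simp add: topological_group_topspace)

lemma cmaps_mult:
  assumes H: "topological_group H" and "a \<in> cmaps K (topol H)" "b \<in> cmaps K (topol H)"
  shows "(\<lambda>k\<in>topspace K. a k \<otimes>\<^bsub>H\<^esub> b k) \<in> cmaps K (topol H)"
proof (rule restrict_cmaps)
  have "continuous_map K (prod_topology (topol H) (topol H)) (\<lambda>k. (a k, b k))"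
    using assms by (auto simp: cmaps_def intro: continuous_map_pairedI)
  from continuous_map_compose[OF this topological_group_mult[OF H]]
  show "continuous_map K (topol H) (\<lambda>k. a k \<otimes>\<^bsub>H\<^esub> b k)"
    by (simp add: o_def)
qed

lemma cmaps_inv:
  assumes H: "topological_group H" and "a \<in> cmaps K (topol H)"
  shows "(\<lambda>k\<in>topspace K. inv\<^bsub>H\<^esub> a k) \<in> cmaps K (topol H)"
proof (rule restrict_cmaps)
  have "continuous_map K (topol H) a"
    using assms by (simp add: cmaps_def)
  from continuous_map_compose[OF this topological_group_inv[OF H]]
  show "continuous_map K (topol H) (\<lambda>k. inv\<^bsub>H\<^esub> a k)"
    by (simp add: o_def)
qed

lemma cmaps_const: "c \<in> topspace T \<Longrightarrow> (\<lambda>k\<in>topspace K. c) \<in> cmaps K T"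
  by (simp add: restrict_cmaps)

lemma cmaps_one: "topological_group H \<Longrightarrow> (\<lambda>k\<in>topspace K. \<one>\<^bsub>H\<^esub>) \<in> cmaps K (topol H)"
  using cmaps_const[of "\<one>\<^bsub>H\<^esub>" "topol H" K]
  by (simp add: topological_group_topspace topological_group_group group.is_monoid)

lemma underline_grp_obj_simps:
  "carrier (FObj (underline_grp_obj H) K) = encode (cmaps K (topol H)) ` cmaps K (topol H)"
  "\<one>\<^bsub>FObj (underline_grp_obj H) K\<^esub> = encode (cmaps K (topol H)) (\<lambda>k\<in>topspace K. \<one>\<^bsub>H\<^esub>)"
  "s \<otimes>\<^bsub>FObj (underline_grp_obj H) K\<^esub> t = encode (cmaps K (topol H))
    (\<lambda>k\<in>topspace K. decode (cmaps K (topol H)) s k \<otimes>\<^bsub>H\<^esub> decode (cmaps K (topol H)) t k)"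
  "FMap (underline_grp_obj H) = FMap (underline (topol H))"
  by (simp_all add: underline_grp_obj_def underline_def Let_def)

lemma FObj_underline: "FObj (underline T) K = encode (cmaps K T) ` cmaps K T"
  by (simp add: underline_def)

text \<open>The inequality makes \<delta>-small spaces also \<epsilon>-small, so that maps from such
  a space into an \<epsilon>-small one form an \<epsilon>-small set and can be coded in
  \<open>'e\<close>.\<close>

locale inaccessible_pair =
  fixes \<delta> :: "'d rel" and \<epsilon> :: "'e rel"
  assumes \<delta>: "strongly_inaccessible \<delta>" and \<epsilon>: "strongly_inaccessible \<epsilon>" and \<delta>_less: "\<delta> <o \<epsilon>"
begin

lemma small_lift: "|A| <o \<delta> \<Longrightarrow> |A| <o \<epsilon>"
  using \<delta>_less ordLess_transitive by blast

lemma cmaps_small_lift: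
  "|topspace K| <o \<delta> \<Longrightarrow> |topspace T| <o \<epsilon> \<Longrightarrow> |cmaps K T| <o \<epsilon>"
  using cmaps_small[OF \<epsilon>] small_lift by blast

text \<open>The two bounds make the code faithful. T has a type of its own because it is taken to be
  both the space of a topological group on \<open>'e\<close> and a profinite set on
  \<open>'d\<close>.\<close>

lemma decode_encode:
  fixes K :: "'k topology" and T :: "'t topology"
  assumes "|topspace K| <o \<delta>" "|topspace T| <o \<epsilon>" "a \<in> cmaps K T"
  shows "decode (cmaps K T) (encode (cmaps K T) a :: 'e) = a"
  using inj_on_encode[OF cmaps_small_lift[OF assms(1,2)]] assms(3)
  unfolding decode_def by (rule inv_into_f_f)

lemma encode_eq_iff:
  fixes K :: "'k topology" and T :: "'t topology"
  assumes "|topspace K| <o \<delta>" "|topspace T| <o \<epsilon>" "a \<in> cmaps K T" "b \<in> cmaps K T"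
  shows "(encode (cmaps K T) a :: 'e) = encode (cmaps K T) b \<longleftrightarrow> a = b"
  using decode_encode[OF assms(1,2,3)] decode_encode[OF assms(1,2,4)] by metis

lemma FMap_underline:
  fixes K L :: "'d topology" and T :: "'t topology"
  assumes "|topspace K| <o \<delta>" "|topspace T| <o \<epsilon>" "a \<in> cmaps K T"
  shows "FMap (underline T :: ('d, 'e) cset) K L f (encode (cmaps K T) a) =
    encode (cmaps L T) (compose (topspace L) a f)"
  using assms decode_encode[OF assms] by (simp add: underline_def)

lemma underline_mult:
  fixes K :: "'d topology" and H :: "'e topgrp"
  assumes H: "topological_group H" "|carrier H| <o \<epsilon>" and K: "|topspace K| <o \<delta>"
    and a: "a \<in> cmaps K (topol H)" and b: "b \<in> cmaps K (topol H)"
  shows "encode (cmaps K (topol H)) a \<otimes>\<^bsub>FObj (underline_grp_obj H) K\<^esub> encode (cmaps K (topol H)) b =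
    encode (cmaps K (topol H)) (\<lambda>k\<in>topspace K. a k \<otimes>\<^bsub>H\<^esub> b k)"
  using decode_encode[OF K, of "topol H"] a b H topological_group_topspace[OF H(1)]
  by (simp add: underline_grp_obj_simps)

text \<open>The group laws hold pointwise in H, and the existence of products and inverses among
  continuous maps is the continuity of the operations of H.\<close>

lemma group_underline:
  fixes K :: "'d topology" and H :: "'e topgrp"
  assumes H: "topological_group H" "|carrier H| <o \<epsilon>" and K: "|topspace K| <o \<delta>"
  shows "group (FObj (underline_grp_obj H) K)"
proof -
  interpret H: group H using H(1) by (rule topological_group_group)
  note mult = underline_mult[OF assms] and closed = cmaps_mult[OF H(1)] and one = cmaps_one[OF H(1)]
    and inv = cmaps_inv[OF H(1)] and val = cmaps_carrier[OF H(1)]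
  show ?thesis
  proof (rule groupI)
    fix x y assume "x \<in> carrier (FObj (underline_grp_obj H) K)" "y \<in> carrier (FObj (underline_grp_obj H) K)"
    then show "x \<otimes>\<^bsub>FObj (underline_grp_obj H) K\<^esub> y \<in> carrier (FObj (underline_grp_obj H) K)"
      unfolding underline_grp_obj_simps(1) by (elim imageE) (simp only: mult closed imageI)
  next
    show "\<one>\<^bsub>FObj (underline_grp_obj H) K\<^esub> \<in> carrier (FObj (underline_grp_obj H) K)"
      unfolding underline_grp_obj_simps by (rule imageI[OF one])
  next
    fix x y z assume "x \<in> carrier (FObj (underline_grp_obj H) K)"
      "y \<in> carrier (FObj (underline_grp_obj H) K)" "z \<in> carrier (FObj (underline_grp_obj H) K)"
    then obtain a b c where *: "a \<in> cmaps K (topol H)" "b \<in> cmaps K (topol H)" "c \<in> cmaps K (topol H)"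
      and xyz: "x = encode (cmaps K (topol H)) a" "y = encode (cmaps K (topol H)) b"
        "z = encode (cmaps K (topol H)) c"
      by (auto simp: underline_grp_obj_simps(1))
    show "x \<otimes>\<^bsub>FObj (underline_grp_obj H) K\<^esub> y \<otimes>\<^bsub>FObj (underline_grp_obj H) K\<^esub> z =
        x \<otimes>\<^bsub>FObj (underline_grp_obj H) K\<^esub> (y \<otimes>\<^bsub>FObj (underline_grp_obj H) K\<^esub> z)"
      unfolding xyz using *
      by (simp only: mult closed)
        (auto simp: val H.m_assoc intro!: arg_cong[of _ _ "encode _"] restrict_ext)
  next
    fix x assume "x \<in> carrier (FObj (underline_grp_obj H) K)"
    then obtain a where a: "a \<in> cmaps K (topol H)" and x: "x = encode (cmaps K (topol H)) a"
      by (auto simp: underline_grp_obj_simps(1))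
    have "(\<lambda>k\<in>topspace K. (\<lambda>k\<in>topspace K. \<one>\<^bsub>H\<^esub>) k \<otimes>\<^bsub>H\<^esub> a k) = a"
      by (rule cmaps_eqI[OF closed[OF one a] a]) (use val[OF a] in simp)
    then show "\<one>\<^bsub>FObj (underline_grp_obj H) K\<^esub> \<otimes>\<^bsub>FObj (underline_grp_obj H) K\<^esub> x = x"
      unfolding underline_grp_obj_simps(2) x mult[OF one a] by (rule arg_cong)
    have "(\<lambda>k\<in>topspace K. (\<lambda>k\<in>topspace K. inv\<^bsub>H\<^esub> a k) k \<otimes>\<^bsub>H\<^esub> a k) = (\<lambda>k\<in>topspace K. \<one>\<^bsub>H\<^esub>)"
      by (rule cmaps_eqI[OF closed[OF inv[OF a] a] one]) (use val[OF a] in simp)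
    then have "encode (cmaps K (topol H)) (\<lambda>k\<in>topspace K. inv\<^bsub>H\<^esub> a k) \<otimes>\<^bsub>FObj (underline_grp_obj H) K\<^esub> x =
        \<one>\<^bsub>FObj (underline_grp_obj H) K\<^esub>"
      unfolding underline_grp_obj_simps(2) x mult[OF inv[OF a] a] by (rule arg_cong)
    then show "\<exists>y\<in>carrier (FObj (underline_grp_obj H) K).
        y \<otimes>\<^bsub>FObj (underline_grp_obj H) K\<^esub> x = \<one>\<^bsub>FObj (underline_grp_obj H) K\<^esub>"
      using inv[OF a] unfolding underline_grp_obj_simps(1) by blast
  qed
qed

lemma FMap_underline_hom:
  fixes K L :: "'d topology" and H :: "'e topgrp"
  assumes H: "topological_group H" "|carrier H| <o \<epsilon>" and K: "|topspace K| <o \<delta>" and L: "|topspace L| <o \<delta>"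
    and f: "f \<in> cmaps L K"
  shows "FMap (underline (topol H)) K L f \<in>
    hom (FObj (underline_grp_obj H) K) (FObj (underline_grp_obj H) L)"
proof (rule homI)
  have T: "|topspace (topol H)| <o \<epsilon>"
    using H by (simp add: topological_group_topspace)
  note map = FMap_underline[OF K T]
  fix x assume "x \<in> carrier (FObj (underline_grp_obj H) K)"
  then obtain a where a: "a \<in> cmaps K (topol H)" and x: "x = encode (cmaps K (topol H)) a"
    by (auto simp: underline_grp_obj_simps)
  show "FMap (underline (topol H)) K L f x \<in> carrier (FObj (underline_grp_obj H) L)"
    using cmaps_compose[OF f a] by (simp add: x map[OF a] underline_grp_obj_simps)
  fix y assume "y \<in> carrier (FObj (underline_grp_obj H) K)"
  then obtain b where b: "b \<in> cmaps K (topol H)" and y: "y = encode (cmaps K (topol H)) b"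
    by (auto simp: underline_grp_obj_simps)
  show "FMap (underline (topol H)) K L f (x \<otimes>\<^bsub>FObj (underline_grp_obj H) K\<^esub> y) =
      FMap (underline (topol H)) K L f x \<otimes>\<^bsub>FObj (underline_grp_obj H) L\<^esub> FMap (underline (topol H)) K L f y"
    unfolding x y underline_mult[OF H K a b] map[OF a] map[OF b] map[OF cmaps_mult[OF H(1) a b]]
      underline_mult[OF H L cmaps_compose[OF f a] cmaps_compose[OF f b]]
    by (rule arg_cong[of _ _ "encode _"]) (use cmaps_topspace[OF f] in \<open>auto simp: compose_def fun_eq_iff\<close>)
qed

section \<open>The condensed group of a single topological group\<close>

lemma is_functor_underline_grp_obj:
  fixes H :: "'e topgrp"
  assumes H: "topological_group H" "|carrier H| <o \<epsilon>"
  shows "is_functor (op_cat (Extr \<delta>)) (Grp_cat \<epsilon>) (underline_grp_obj H)"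
  unfolding is_functor_def
proof (intro conjI ballI)
  show "is_category (op_cat (Extr \<delta>))" "is_category (Grp_cat \<epsilon>)"
    by (intro is_category_op_cat is_category_Extr is_category_Grp_cat)+
  have T: "|topspace (topol H)| <o \<epsilon>"
    using H by (simp add: topological_group_topspace)
  have ext: "FMap (underline_grp_obj H) K L f \<in> extensional (carrier (FObj (underline_grp_obj H) K))"
    for K L :: "'d topology" and f
    by (simp add: underline_grp_obj_simps underline_def)
  {
    fix K assume K: "K \<in> Obj (op_cat (Extr \<delta>))"
    then show "FObj (underline_grp_obj H) K \<in> Obj (Grp_cat \<epsilon>)"
      using H T group_underline[OF H, of K] cmaps_small_lift[of K "topol H"]
      by (simp add: underline_grp_obj_simps(1) small_image)
    have sK: "|topspace K| <o \<delta>"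
      using K by simp
    show "FMap (underline_grp_obj H) K K (Ident (op_cat (Extr \<delta>)) K) =
        Ident (Grp_cat \<epsilon>) (FObj (underline_grp_obj H) K)"
    proof (rule extensionalityI[OF ext])
      fix x assume "x \<in> carrier (FObj (underline_grp_obj H) K)"
      then obtain a where a: "a \<in> cmaps K (topol H)" and x: "x = encode (cmaps K (topol H)) a"
        by (auto simp: underline_grp_obj_simps)
      have "compose (topspace K) a (\<lambda>x\<in>topspace K. x) = a"
        by (rule cmaps_eqI[OF cmaps_compose[OF cmaps_ident a] a]) (simp add: compose_def)
      then show "FMap (underline_grp_obj H) K K (Ident (op_cat (Extr \<delta>)) K) x =
          Ident (Grp_cat \<epsilon>) (FObj (underline_grp_obj H) K) x"
        using a by (simp add: x underline_grp_obj_simps FMap_underline[OF sK T])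
    qed simp
  }
  {
    fix K L f assume "K \<in> Obj (op_cat (Extr \<delta>))" "L \<in> Obj (op_cat (Extr \<delta>))" "f \<in> Hom (op_cat (Extr \<delta>)) K L"
    then show "FMap (underline_grp_obj H) K L f \<in>
        Hom (Grp_cat \<epsilon>) (FObj (underline_grp_obj H) K) (FObj (underline_grp_obj H) L)"
      using FMap_underline_hom[OF H, of K L f] ext[of K L f] by (simp add: underline_grp_obj_simps(4))
  }
  fix K L M f g assume K: "K \<in> Obj (op_cat (Extr \<delta>))" and L: "L \<in> Obj (op_cat (Extr \<delta>))"
    and M: "M \<in> Obj (op_cat (Extr \<delta>))" and f: "f \<in> Hom (op_cat (Extr \<delta>)) K L" and g: "g \<in> Hom (op_cat (Extr \<delta>)) L M"
  have sK: "|topspace K| <o \<delta>" and sL: "|topspace L| <o \<delta>" and fm: "f \<in> cmaps L K" and gm: "g \<in> cmaps M L"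
    using K L f g by auto
  show "FMap (underline_grp_obj H) K M (Comp (op_cat (Extr \<delta>)) K L M g f) =
      Comp (Grp_cat \<epsilon>) (FObj (underline_grp_obj H) K) (FObj (underline_grp_obj H) L)
        (FObj (underline_grp_obj H) M) (FMap (underline_grp_obj H) L M g) (FMap (underline_grp_obj H) K L f)"
  proof (rule extensionalityI[OF ext])
    fix x assume "x \<in> carrier (FObj (underline_grp_obj H) K)"
    then obtain a where a: "a \<in> cmaps K (topol H)" and x: "x = encode (cmaps K (topol H)) a"
      by (auto simp: underline_grp_obj_simps)
    have "compose (topspace M) a (compose (topspace M) f g) = compose (topspace M) (compose (topspace L) a f) g"
      using cmaps_topspace[OF gm] by (auto simp: compose_def fun_eq_iff)
    then show "FMap (underline_grp_obj H) K M (Comp (op_cat (Extr \<delta>)) K L M g f) x =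
        Comp (Grp_cat \<epsilon>) (FObj (underline_grp_obj H) K) (FObj (underline_grp_obj H) L)
          (FObj (underline_grp_obj H) M) (FMap (underline_grp_obj H) L M g) (FMap (underline_grp_obj H) K L f) x"
      using a by (simp add: x underline_grp_obj_simps FMap_underline[OF sK T a]
          FMap_underline[OF sL T cmaps_compose[OF fm a]] compose_eq)
  qed simp
qed

text \<open>A product cone in the opposite of \<open>Extr\<close> is a coproduct cone of spaces, so
  by gluing a section over P is the same as a family of sections over the \<open>X i\<close>. That
  the glued sections depend homomorphically on an element of Z follows from uniqueness of
  gluing.\<close>

lemma preserves_finite_products_underline_grp_obj:
  fixes H :: "'e topgrp"
  assumes H: "topological_group H" "|carrier H| <o \<epsilon>"
  shows "preserves_finite_products (op_cat (Extr \<delta>)) (Grp_cat \<epsilon>) (underline_grp_obj H)"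
  unfolding preserves_finite_products_def
proof (intro allI impI)
  fix I X P p assume I: "finite I" and P: "is_product (op_cat (Extr \<delta>)) I X P p"
  let ?G = "FObj (underline_grp_obj H)" and ?M = "\<lambda>K. cmaps K (topol H)"
  note F = is_functor_underline_grp_obj[OF H]
  have T: "|topspace (topol H)| <o \<epsilon>"
    using H by (simp add: topological_group_topspace)
  have Po: "P \<in> Obj (op_cat (Extr \<delta>))" and Xo: "\<And>i. i \<in> I \<Longrightarrow> X i \<in> Obj (op_cat (Extr \<delta>))"
    and po: "\<And>i. i \<in> I \<Longrightarrow> p i \<in> Hom (op_cat (Extr \<delta>)) P (X i)"
    using P unfolding is_product_def by auto
  have sP: "|topspace P| <o \<delta>" and sX: "\<And>i. i \<in> I \<Longrightarrow> |topspace (X i)| <o \<delta>"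
    and p: "\<And>i. i \<in> I \<Longrightarrow> p i \<in> cmaps (X i) P"
    using Po Xo po by auto
  note glue = Extr_coproduct_gluing[OF \<delta> I P]
  note mapP = FMap_underline[OF sP T]
  show "is_product (Grp_cat \<epsilon>) I (\<lambda>i. ?G (X i)) (?G P) (\<lambda>i. FMap (underline_grp_obj H) P (X i) (p i))"
    unfolding is_product_def
  proof (intro conjI ballI allI impI)
    show "?G P \<in> Obj (Grp_cat \<epsilon>)"
      using functor_Obj[OF F Po] .
    show "?G (X i) \<in> Obj (Grp_cat \<epsilon>)" if "i \<in> I" for i
      using functor_Obj[OF F Xo[OF that]] .
    show "FMap (underline_grp_obj H) P (X i) (p i) \<in> Hom (Grp_cat \<epsilon>) (?G P) (?G (X i))" if "i \<in> I" for i
      using functor_Hom[OF F Po Xo[OF that] po[OF that]] .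
  next
    fix Z f assume Z: "Z \<in> Obj (Grp_cat \<epsilon>)" and f: "\<forall>i\<in>I. f i \<in> Hom (Grp_cat \<epsilon>) Z (?G (X i))"
    define g where "g z i = decode (?M (X i)) (f i z)" for z i
    have g: "g z i \<in> ?M (X i)" and fg: "f i z = encode (?M (X i)) (g z i)"
      if "z \<in> carrier Z" "i \<in> I" for z i
    proof -
      have "f i z \<in> encode (?M (X i)) ` ?M (X i)"
        using hom_in_carrier[of "f i" Z "?G (X i)" z] f that by (simp add: underline_grp_obj_simps(1))
      then show "g z i \<in> ?M (X i)" "f i z = encode (?M (X i)) (g z i)"
        using decode_encode[OF sX[OF that(2)] T] by (auto simp: g_def)
    qed
    \<comment> \<open>For each z the components \<open>f i z\<close> are decoded to maps on the
      summands, and these are glued to one map on P.\<close>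
    have "\<exists>h. \<forall>z\<in>carrier Z. h z \<in> ?M P \<and> (\<forall>i\<in>I. compose (topspace (X i)) (h z) (p i) = g z i)"
      using glue[of "g _" "topol H"] g by (intro bchoice) blast
    then obtain h where h: "\<And>z. z \<in> carrier Z \<Longrightarrow> h z \<in> ?M P"
        and hg: "\<And>z i. z \<in> carrier Z \<Longrightarrow> i \<in> I \<Longrightarrow> compose (topspace (X i)) (h z) (p i) = g z i"
      by blast
    \<comment> \<open>Uniqueness of gluing, applied to the family of restrictions of a
      itself.\<close>
    have unique: "a = b" if a: "a \<in> ?M P" and b: "b \<in> ?M P"
      and eq: "\<And>i. i \<in> I \<Longrightarrow> compose (topspace (X i)) a (p i) = compose (topspace (X i)) b (p i)" for a b
    proof -
      have "\<exists>!h. h \<in> ?M P \<and> (\<forall>i\<in>I. compose (topspace (X i)) h (p i) = compose (topspace (X i)) a (p i))"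
        by (rule glue) (rule cmaps_compose[OF p a])
      then show ?thesis
        using a b eq by (metis (no_types, lifting))
    qed
    define u where "u = (\<lambda>z\<in>carrier Z. encode (?M P) (h z) :: 'e)"
    have u: "u \<in> Hom (Grp_cat \<epsilon>) Z (?G P)"
    proof -
      have "u \<in> hom Z (?G P)"
      proof (rule homI)
        fix x assume x: "x \<in> carrier Z"
        then show "u x \<in> carrier (?G P)"
          using h by (simp add: u_def underline_grp_obj_simps(1))
        fix y assume y: "y \<in> carrier Z"
        have xy: "x \<otimes>\<^bsub>Z\<^esub> y \<in> carrier Z"
          using x y Z by (simp add: group.is_monoid monoid.m_closed)
        \<comment> \<open>Both sides restrict to the same map on each summand, because each
          \<open>f i\<close> is a homomorphism and products of sections are pointwise.\<close>
        have "h (x \<otimes>\<^bsub>Z\<^esub> y) = (\<lambda>k\<in>topspace P. h x k \<otimes>\<^bsub>H\<^esub> h y k)"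
        proof (rule unique[OF h[OF xy] cmaps_mult[OF H(1) h[OF x] h[OF y]]])
          fix i assume i: "i \<in> I"
          have "encode (?M (X i)) (g (x \<otimes>\<^bsub>Z\<^esub> y) i) = f i (x \<otimes>\<^bsub>Z\<^esub> y)"
            using fg[OF xy i] by simp
          also have "\<dots> = f i x \<otimes>\<^bsub>?G (X i)\<^esub> f i y"
            using f i x y by (auto simp: hom_def)
          also have "\<dots> = encode (?M (X i)) (\<lambda>k\<in>topspace (X i). g x i k \<otimes>\<^bsub>H\<^esub> g y i k)"
            unfolding fg[OF x i] fg[OF y i] by (rule underline_mult[OF H sX[OF i] g[OF x i] g[OF y i]])
          finally have "g (x \<otimes>\<^bsub>Z\<^esub> y) i = (\<lambda>k\<in>topspace (X i). g x i k \<otimes>\<^bsub>H\<^esub> g y i k)"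
            using encode_eq_iff[OF sX[OF i] T g[OF xy i] cmaps_mult[OF H(1) g[OF x i] g[OF y i]]] by simp
          then show "compose (topspace (X i)) (h (x \<otimes>\<^bsub>Z\<^esub> y)) (p i) =
              compose (topspace (X i)) (\<lambda>k\<in>topspace P. h x k \<otimes>\<^bsub>H\<^esub> h y k) (p i)"
            unfolding hg[OF xy i] using cmaps_topspace[OF p[OF i]]
            by (auto simp: hg[OF x i, symmetric] hg[OF y i, symmetric] compose_def fun_eq_iff)
        qed
        then show "u (x \<otimes>\<^bsub>Z\<^esub> y) = u x \<otimes>\<^bsub>?G P\<^esub> u y"
          using x y xy by (simp add: u_def underline_mult[OF H sP h h])
      qed
      then show ?thesis
        by (simp add: u_def)
    qed
    have uf: "Comp (Grp_cat \<epsilon>) Z (?G P) (?G (X i)) (FMap (underline_grp_obj H) P (X i) (p i)) u = f i"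
      if i: "i \<in> I" for i
    proof (rule extensionalityI)
      show "Comp (Grp_cat \<epsilon>) Z (?G P) (?G (X i)) (FMap (underline_grp_obj H) P (X i) (p i)) u \<in>
          extensional (carrier Z)"
        by simp
      show "f i \<in> extensional (carrier Z)"
        using f i by simp
      fix z assume z: "z \<in> carrier Z"
      then show "Comp (Grp_cat \<epsilon>) Z (?G P) (?G (X i)) (FMap (underline_grp_obj H) P (X i) (p i)) u z = f i z"
        by (simp add: compose_eq u_def underline_grp_obj_simps(4) mapP[OF h] hg[OF z i] fg[OF z i])
    qed
    show "\<exists>!u. u \<in> Hom (Grp_cat \<epsilon>) Z (?G P) \<and>
        (\<forall>i\<in>I. Comp (Grp_cat \<epsilon>) Z (?G P) (?G (X i)) (FMap (underline_grp_obj H) P (X i) (p i)) u = f i)"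
    proof (rule ex1I[of _ u])
      fix v assume v: "v \<in> Hom (Grp_cat \<epsilon>) Z (?G P) \<and>
        (\<forall>i\<in>I. Comp (Grp_cat \<epsilon>) Z (?G P) (?G (X i)) (FMap (underline_grp_obj H) P (X i) (p i)) v = f i)"
      show "v = u"
      proof (rule extensionalityI)
        show "v \<in> extensional (carrier Z)" "u \<in> extensional (carrier Z)"
          using u v by auto
        fix z assume z: "z \<in> carrier Z"
        then have "v z \<in> carrier (?G P)"
          using v by (auto simp: hom_def)
        then obtain a where a: "a \<in> ?M P" and va: "v z = encode (?M P) a"
          by (auto simp: underline_grp_obj_simps(1))
        have "compose (topspace (X i)) a (p i) = compose (topspace (X i)) (h z) (p i)" if i: "i \<in> I" for i
        proof -
          have "FMap (underline_grp_obj H) P (X i) (p i) (v z) = f i z"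
            using compose_eqD[of "carrier Z" _ v "f i" z] v i z by simp
          then have "(encode (?M (X i)) (compose (topspace (X i)) a (p i)) :: 'e) = encode (?M (X i)) (g z i)"
            by (simp add: va underline_grp_obj_simps(4) mapP[OF a] fg[OF z i])
          then show ?thesis
            using encode_eq_iff[OF sX[OF i] T cmaps_compose[OF p[OF i] a] g[OF z i]] hg[OF z i] by simp
        qed
        then have "a = h z"
          by (rule unique[OF a h[OF z]])
        then show "v z = u z"
          using z by (simp add: va u_def)
      qed
    qed (use u uf in blast)
  qed
qed

end

section \<open>Functoriality in the topological group\<close>

lemma (in inaccessible_pair) FMap_underline_grp:
  fixes G :: "'e topgrp"
  assumes G: "topological_group G" "|carrier G| <o \<epsilon>" and K: "K \<in> Obj (Extr \<delta>)"
    and a: "a \<in> cmaps K (topol G)"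
  shows "FMap (underline_grp \<delta>) G H \<phi> K (encode (cmaps K (topol G)) a) =
    encode (cmaps K (topol H)) (compose (topspace K) \<phi> a)"
  using K a decode_encode[of K "topol G" a] G
  by (simp add: underline_grp_def FObj_underline topological_group_topspace)

lemma (in inaccessible_pair) FMap_underline_grp_nat_trans:
  fixes G H :: "'e topgrp"
  assumes G: "G \<in> Obj (TopGrp \<epsilon>)" and H: "H \<in> Obj (TopGrp \<epsilon>)" and \<phi>: "\<phi> \<in> Hom (TopGrp \<epsilon>) G H"
  shows "FMap (underline_grp \<delta>) G H \<phi> \<in>
    nat_trans (op_cat (Extr \<delta>)) (Grp_cat \<epsilon>) (underline_grp_obj G) (underline_grp_obj H)"
  unfolding nat_trans_def
proof (intro CollectI conjI ballI PiE_I)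
  let ?U = underline_grp_obj
  have G': "topological_group G" "|carrier G| <o \<epsilon>" and H': "topological_group H" "|carrier H| <o \<epsilon>"
    and \<phi>': "\<phi> \<in> hom G H" "\<phi> \<in> cmaps (topol G) (topol H)"
    using G H \<phi> by auto
  have TG: "|topspace (topol G)| <o \<epsilon>" and TH: "|topspace (topol H)| <o \<epsilon>"
    using G' H' by (simp_all add: topological_group_topspace)
  note map = FMap_underline_grp[OF G']
  have ext: "FMap (underline_grp \<delta>) G H \<phi> K \<in> extensional (carrier (FObj (?U G) K))"
    if "K \<in> Obj (Extr \<delta>)" for K
    using that by (simp add: underline_grp_def underline_grp_obj_simps(1) FObj_underline)
  {
    fix K assume "K \<in> Obj (op_cat (Extr \<delta>))"
    then have K: "K \<in> Obj (Extr \<delta>)" and sK: "|topspace K| <o \<delta>"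
      by auto
    have "FMap (underline_grp \<delta>) G H \<phi> K \<in> hom (FObj (?U G) K) (FObj (?U H) K)"
    proof (rule homI)
      fix x assume "x \<in> carrier (FObj (?U G) K)"
      then obtain a where a: "a \<in> cmaps K (topol G)" and x: "x = encode (cmaps K (topol G)) a"
        by (auto simp: underline_grp_obj_simps(1))
      show "FMap (underline_grp \<delta>) G H \<phi> K x \<in> carrier (FObj (?U H) K)"
        unfolding x map[OF K a] underline_grp_obj_simps(1) by (rule imageI cmaps_compose[OF a \<phi>'(2)])+
      fix y assume "y \<in> carrier (FObj (?U G) K)"
      then obtain b where b: "b \<in> cmaps K (topol G)" and y: "y = encode (cmaps K (topol G)) b"
        by (auto simp: underline_grp_obj_simps(1))
      show "FMap (underline_grp \<delta>) G H \<phi> K (x \<otimes>\<^bsub>FObj (?U G) K\<^esub> y) =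
          FMap (underline_grp \<delta>) G H \<phi> K x \<otimes>\<^bsub>FObj (?U H) K\<^esub> FMap (underline_grp \<delta>) G H \<phi> K y"
        unfolding x y underline_mult[OF G' sK a b] map[OF K a] map[OF K b]
          map[OF K cmaps_mult[OF G'(1) a b]]
          underline_mult[OF H' sK cmaps_compose[OF a \<phi>'(2)] cmaps_compose[OF b \<phi>'(2)]]
        by (rule arg_cong[of _ _ "encode _"])
          (use hom_mult[OF \<phi>'(1)] cmaps_carrier[OF G'(1) a] cmaps_carrier[OF G'(1) b] in \<open>auto simp: compose_def fun_eq_iff\<close>)
    qed
    then show "FMap (underline_grp \<delta>) G H \<phi> K \<in> Hom (Grp_cat \<epsilon>) (FObj (?U G) K) (FObj (?U H) K)"
      using ext[OF K] by simp
  }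
  {
    fix K :: "'d topology" assume "K \<notin> Obj (op_cat (Extr \<delta>))"
    then show "FMap (underline_grp \<delta>) G H \<phi> K = undefined"
      unfolding underline_grp_def by (simp del: Extr_simps(1))
  }
  fix K L f assume "K \<in> Obj (op_cat (Extr \<delta>))" "L \<in> Obj (op_cat (Extr \<delta>))" "f \<in> Hom (op_cat (Extr \<delta>)) K L"
  then have K: "K \<in> Obj (Extr \<delta>)" and L: "L \<in> Obj (Extr \<delta>)" and sK: "|topspace K| <o \<delta>"
    and f: "f \<in> cmaps L K"
    by auto
  show "Comp (Grp_cat \<epsilon>) (FObj (?U G) K) (FObj (?U G) L) (FObj (?U H) L)
        (FMap (underline_grp \<delta>) G H \<phi> L) (FMap (?U G) K L f) =
      Comp (Grp_cat \<epsilon>) (FObj (?U G) K) (FObj (?U H) K) (FObj (?U H) L)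
        (FMap (?U H) K L f) (FMap (underline_grp \<delta>) G H \<phi> K)"
    unfolding Grp_cat_simps
  proof (rule extensionalityI)
    fix x assume "x \<in> carrier (FObj (?U G) K)"
    moreover then obtain a where a: "a \<in> cmaps K (topol G)" and x: "x = encode (cmaps K (topol G)) a"
      by (auto simp: underline_grp_obj_simps(1))
    have "compose (topspace L) \<phi> (compose (topspace L) a f) = compose (topspace L) (compose (topspace K) \<phi> a) f"
      using cmaps_topspace[OF f] by (auto simp: compose_def fun_eq_iff)
    ultimately show "compose (carrier (FObj (?U G) K)) (FMap (underline_grp \<delta>) G H \<phi> L) (FMap (?U G) K L f) x =
        compose (carrier (FObj (?U G) K)) (FMap (?U H) K L f) (FMap (underline_grp \<delta>) G H \<phi> K) x"
      by (simp add: compose_eq x underline_grp_obj_simps(4) map[OF K a] FMap_underline[OF sK TG a]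
          map[OF L cmaps_compose[OF f a]] FMap_underline[OF sK TH cmaps_compose[OF a \<phi>'(2)]])
  qed (rule compose_extensional)+
qed

lemma (in inaccessible_pair) is_functor_underline_grp:
  "is_functor (TopGrp \<epsilon>) (CondGrp \<delta> \<epsilon>) (underline_grp \<delta>)"
  unfolding is_functor_def
proof (intro conjI ballI)
  show "is_category (TopGrp \<epsilon>)" "is_category (CondGrp \<delta> \<epsilon>)"
    by (rule is_category_TopGrp is_category_CondGrp)+
  have FObj: "FObj (underline_grp \<delta>) = (underline_grp_obj :: 'e topgrp \<Rightarrow> ('d, 'e) cgrp)"
    by (simp add: underline_grp_def)
  {
    fix G :: "'e topgrp" assume "G \<in> Obj (TopGrp \<epsilon>)"
    then show "FObj (underline_grp \<delta>) G \<in> Obj (CondGrp \<delta> \<epsilon>)"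
      by (simp add: FObj Cond_Obj is_functor_underline_grp_obj preserves_finite_products_underline_grp_obj)
  next
    fix G H :: "'e topgrp" and \<phi>
    assume "G \<in> Obj (TopGrp \<epsilon>)" "H \<in> Obj (TopGrp \<epsilon>)" "\<phi> \<in> Hom (TopGrp \<epsilon>) G H"
    then show "FMap (underline_grp \<delta>) G H \<phi> \<in>
        Hom (CondGrp \<delta> \<epsilon>) (FObj (underline_grp \<delta>) G) (FObj (underline_grp \<delta>) H)"
      unfolding FObj Cond_Hom by (rule FMap_underline_grp_nat_trans)
  }
  {
    fix G :: "'e topgrp" assume "G \<in> Obj (TopGrp \<epsilon>)"
    then have G: "topological_group G" "|carrier G| <o \<epsilon>"
      by auto
    have "FMap (underline_grp \<delta>) G G (\<lambda>x\<in>carrier G. x) K = (\<lambda>x\<in>carrier (FObj (underline_grp_obj G) K). x)"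
      if K: "K \<in> Obj (Extr \<delta>)" for K
    proof (rule extensionalityI)
      show "FMap (underline_grp \<delta>) G G (\<lambda>x\<in>carrier G. x) K \<in> extensional (carrier (FObj (underline_grp_obj G) K))"
        using K by (simp add: underline_grp_def underline_grp_obj_simps(1) FObj_underline)
      fix x assume x: "x \<in> carrier (FObj (underline_grp_obj G) K)"
      then obtain a where a: "a \<in> cmaps K (topol G)" and xa: "x = encode (cmaps K (topol G)) a"
        by (auto simp: underline_grp_obj_simps(1))
      have "compose (topspace K) (\<lambda>x\<in>carrier G. x) a = a"
        using cmaps_carrier[OF G(1) a] a by (auto simp: cmaps_def intro!: Id_compose)
      then show "FMap (underline_grp \<delta>) G G (\<lambda>x\<in>carrier G. x) K x = (\<lambda>x\<in>carrier (FObj (underline_grp_obj G) K). x) x"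
        using x unfolding xa by (simp add: FMap_underline_grp[OF G K a])
    qed simp
    then show "FMap (underline_grp \<delta>) G G (Ident (TopGrp \<epsilon>) G) =
        Ident (CondGrp \<delta> \<epsilon>) (FObj (underline_grp \<delta>) G)"
      unfolding FObj Cond_Ident TopGrp_simps Grp_cat_simps
      by (intro extensionalityI[of _ "Obj (Extr \<delta>)"])
        (simp_all add: underline_grp_def del: Extr_simps(1))
  next
    fix G H J :: "'e topgrp" and \<phi> \<psi>
    assume "G \<in> Obj (TopGrp \<epsilon>)" "H \<in> Obj (TopGrp \<epsilon>)" "J \<in> Obj (TopGrp \<epsilon>)"
      and \<phi>: "\<phi> \<in> Hom (TopGrp \<epsilon>) G H" and \<psi>: "\<psi> \<in> Hom (TopGrp \<epsilon>) H J"
    then have G: "topological_group G" "|carrier G| <o \<epsilon>" and H: "topological_group H" "|carrier H| <o \<epsilon>"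
      and \<phi>': "\<phi> \<in> cmaps (topol G) (topol H)"
      by auto
    have "FMap (underline_grp \<delta>) G J (compose (carrier G) \<psi> \<phi>) K =
        compose (carrier (FObj (underline_grp_obj G) K)) (FMap (underline_grp \<delta>) H J \<psi> K) (FMap (underline_grp \<delta>) G H \<phi> K)"
      if K: "K \<in> Obj (Extr \<delta>)" for K
    proof (rule extensionalityI)
      show "FMap (underline_grp \<delta>) G J (compose (carrier G) \<psi> \<phi>) K \<in> extensional (carrier (FObj (underline_grp_obj G) K))"
        using K by (simp add: underline_grp_def underline_grp_obj_simps(1) FObj_underline)
      fix x assume x: "x \<in> carrier (FObj (underline_grp_obj G) K)"
      then obtain a where a: "a \<in> cmaps K (topol G)" and xa: "x = encode (cmaps K (topol G)) a"
        by (auto simp: underline_grp_obj_simps(1))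
      have "compose (topspace K) (compose (carrier G) \<psi> \<phi>) a = compose (topspace K) \<psi> (compose (topspace K) \<phi> a)"
        using cmaps_carrier[OF G(1) a] by (auto simp: compose_def fun_eq_iff)
      then show "FMap (underline_grp \<delta>) G J (compose (carrier G) \<psi> \<phi>) K x =
          compose (carrier (FObj (underline_grp_obj G) K)) (FMap (underline_grp \<delta>) H J \<psi> K) (FMap (underline_grp \<delta>) G H \<phi> K) x"
        using x unfolding xa
        by (simp add: compose_eq FMap_underline_grp[OF G K a] FMap_underline_grp[OF H K cmaps_compose[OF a \<phi>']])
    qed simp
    then show "FMap (underline_grp \<delta>) G J (Comp (TopGrp \<epsilon>) G H J \<psi> \<phi>) =
        Comp (CondGrp \<delta> \<epsilon>) (FObj (underline_grp \<delta>) G) (FObj (underline_grp \<delta>) H) (FObj (underline_grp \<delta>) J)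
          (FMap (underline_grp \<delta>) H J \<psi>) (FMap (underline_grp \<delta>) G H \<phi>)"
      unfolding FObj Cond_Comp TopGrp_simps Grp_cat_simps
      by (intro extensionalityI[of _ "Obj (Extr \<delta>)"])
        (simp_all add: underline_grp_def del: Extr_simps(1))
  }
qed


section \<open>The underlying topological space\<close>

lemma continuous_map_sum_topology:
  "continuous_map (sum_topology X I) Y f \<longleftrightarrow> (\<forall>i\<in>I. continuous_map (X i) Y (\<lambda>x. f (i, x)))"
proof -
  have "{x. (i, x) \<in> {p \<in> Sigma I (topspace \<circ> X). f p \<in> U}} = {x \<in> topspace (X i). f (i, x) \<in> U}"
    if "i \<in> I" for i U
    using that by auto
  then have o: "openin (sum_topology X I) {p \<in> topspace (sum_topology X I). f p \<in> U} \<longleftrightarrow>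
      (\<forall>i\<in>I. openin (X i) {x \<in> topspace (X i). f (i, x) \<in> U})" for U
    unfolding topspace_sum_topology openin_sum_topology by (auto cong: ball_cong)
  have fs: "f \<in> topspace (sum_topology X I) \<rightarrow> topspace Y \<longleftrightarrow>
      (\<forall>i\<in>I. (\<lambda>x. f (i, x)) \<in> topspace (X i) \<rightarrow> topspace Y)"
    by (auto simp: Pi_iff)
  show ?thesis
    unfolding continuous_map_def fs o by blast
qed

text \<open>An element k of a space as an arrow from the one-point space; the restriction makes the
  function extensional, as arrows of \<open>Extr\<close> are. Pulling a section back along it is
  evaluation at k.\<close>

abbreviation point :: "'k \<Rightarrow> 'd \<Rightarrow> 'k" where
  "point k \<equiv> (\<lambda>_\<in>topspace (pt :: 'd topology). k)"

lemma topspace_pt [simp]: "topspace pt = {undefined}"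
  by (simp add: pt_def)

lemma cmaps_pt_eq_point: "b \<in> cmaps (pt :: 'd topology) T \<Longrightarrow> b = point (b undefined)"
  by (rule extensionalityI[of _ "{undefined}"]) (auto simp: cmaps_def)

lemma compose_point: "compose (topspace (pt :: 'd topology)) f (point k) = point (f k)"
  by (auto simp: compose_def fun_eq_iff)

section \<open>Natural maps between presheaves of sets\<close>

lemma nat_trans_ComponentD:
  assumes "\<eta> \<in> nat_trans (op_cat (Extr \<delta>)) (Set_cat \<epsilon>) X Y" "K \<in> Obj (Extr \<delta>)"
  shows "\<eta> K \<in> FObj X K \<rightarrow>\<^sub>E FObj Y K"
  using nat_trans_Hom[OF assms(1), of K] assms(2) by (simp del: Extr_simps(1))

lemma nat_trans_SetD:
  assumes "\<eta> \<in> nat_trans (op_cat (Extr \<delta>)) (Set_cat \<epsilon>) X Y"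
    and "K \<in> Obj (Extr \<delta>)" "L \<in> Obj (Extr \<delta>)" "f \<in> cmaps L K" "s \<in> FObj X K"
  shows "\<eta> L (FMap X K L f s) = FMap Y K L f (\<eta> K s)"
proof -
  have "compose (FObj X K) (\<eta> L) (FMap X K L f) = compose (FObj X K) (FMap Y K L f) (\<eta> K)"
    using nat_trans_natural[OF assms(1), of K L f] assms(2-4) by (simp del: Extr_simps(1))
  from compose_eqD[OF this assms(5)] show ?thesis
    using assms(5) by (simp add: compose_eq)
qed

lemma nat_trans_SetI:
  assumes "\<eta> \<in> extensional (Obj (Extr \<delta>))"
    and "\<And>K. K \<in> Obj (Extr \<delta>) \<Longrightarrow> \<eta> K \<in> FObj X K \<rightarrow>\<^sub>E FObj Y K"
    and "\<And>K L f s. \<lbrakk>K \<in> Obj (Extr \<delta>); L \<in> Obj (Extr \<delta>); f \<in> cmaps L K; s \<in> FObj X K\<rbrakk> \<Longrightarrow>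
      \<eta> L (FMap X K L f s) = FMap Y K L f (\<eta> K s)"
  shows "\<eta> \<in> nat_trans (op_cat (Extr \<delta>)) (Set_cat \<epsilon>) X Y"
  using assms by (auto simp: nat_trans_def PiE_def compose_def simp del: Extr_simps(1) intro!: restrict_ext)

text \<open>Of the source only closure under restriction is asked, which for
  \<open>underline K\<close> with K profinite comes directly from
  \<open>FMap_underline_mem\<close>.\<close>

lemma nat_trans_Set_comp:
  assumes \<zeta>: "\<zeta> \<in> nat_trans (op_cat (Extr \<delta>)) (Set_cat \<epsilon>) X Y"
    and \<eta>: "\<eta> \<in> nat_trans (op_cat (Extr \<delta>)) (Set_cat \<epsilon>) Y Z"
    and X: "\<And>K L f s. \<lbrakk>K \<in> Obj (Extr \<delta>); L \<in> Obj (Extr \<delta>); f \<in> cmaps L K; s \<in> FObj X K\<rbrakk> \<Longrightarrow> FMap X K L f s \<in> FObj X L"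
  shows "(\<lambda>K\<in>Obj (Extr \<delta>). \<lambda>s\<in>FObj X K. \<eta> K (\<zeta> K s)) \<in> nat_trans (op_cat (Extr \<delta>)) (Set_cat \<epsilon>) X Z"
proof (rule nat_trans_SetI)
  note comp = nat_trans_ComponentD[OF \<zeta>] nat_trans_ComponentD[OF \<eta>]
  have mem: "\<zeta> K s \<in> FObj Y K" if "K \<in> Obj (Extr \<delta>)" "s \<in> FObj X K" for K s
    using comp(1)[OF that(1)] that(2) by auto
  {
    fix K assume "K \<in> Obj (Extr \<delta>)"
    then show "(\<lambda>K\<in>Obj (Extr \<delta>). \<lambda>s\<in>FObj X K. \<eta> K (\<zeta> K s)) K \<in> FObj X K \<rightarrow>\<^sub>E FObj Z K"
      using comp by (auto simp del: Extr_simps(1))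
  }
  fix K L f s assume *: "K \<in> Obj (Extr \<delta>)" "L \<in> Obj (Extr \<delta>)" "f \<in> cmaps L K" "s \<in> FObj X K"
  then show "(\<lambda>K\<in>Obj (Extr \<delta>). \<lambda>s\<in>FObj X K. \<eta> K (\<zeta> K s)) L (FMap X K L f s) =
      FMap Z K L f ((\<lambda>K\<in>Obj (Extr \<delta>). \<lambda>s\<in>FObj X K. \<eta> K (\<zeta> K s)) K s)"
    using X[OF *] nat_trans_SetD[OF \<zeta> *] nat_trans_SetD[OF \<eta> *(1-3) mem[OF *(1,4)]]
    by (simp del: Extr_simps(1))
qed simp

text \<open>An inverse image chosen by \<open>inv_into\<close> lies in the set even where the coding
  is not injective, so this holds for spaces of any size.\<close>

lemma FMap_underline_mem:
  assumes "s \<in> FObj (underline T) K" "f \<in> cmaps L K"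
  shows "FMap (underline T) K L f s \<in> FObj (underline T) L"
proof -
  have "decode (cmaps K T) s \<in> cmaps K T"
    using assms(1) unfolding decode_def FObj_underline by (rule inv_into_into)
  from cmaps_compose[OF assms(2) this] show ?thesis
    using assms(1) unfolding FObj_underline by (simp add: underline_def)
qed

section \<open>The quotient topology on the points of a condensed set\<close>

context inaccessible_pair
begin

lemma Obj_Extr_pt: "pt \<in> Obj (Extr \<delta>)"
  unfolding pt_def by (rule Obj_Extr_discrete_finite[OF \<delta>]) simp

lemma Obj_Extr_small: "K \<in> Obj (Extr \<delta>) \<Longrightarrow> |topspace K| <o \<delta>"
  by simp

lemma point_cmaps: "k \<in> topspace K \<Longrightarrow> point k \<in> cmaps (pt :: 'd topology) K"
  by (rule cmaps_const)

lemma point_encode_mem: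
  "k \<in> topspace K \<Longrightarrow> encode (cmaps (pt :: 'd topology) K) (point k) \<in> FObj (underline K :: ('d, 'e) cset) pt"
  unfolding FObj_underline by (intro imageI point_cmaps)

lemma eval_point_mem:
  assumes "\<eta> \<in> nat_trans (op_cat (Extr \<delta>)) (Set_cat \<epsilon>) (underline K) X" "k \<in> topspace K"
  shows "\<eta> pt (encode (cmaps (pt :: 'd topology) K) (point k)) \<in> FObj X pt"
  using nat_trans_ComponentD[OF assms(1) Obj_Extr_pt] point_encode_mem[OF assms(2)] by (rule PiE_mem)

lemma eval_point_funcset:
  "eval_point \<in> topspace (sum_topology fst (profinite_over \<delta> \<epsilon> X)) \<rightarrow> FObj X pt"
  using eval_point_mem by (auto simp: eval_point_def profinite_over_def Cond_Hom)

lemma topspace_top_space: "topspace (top_space \<delta> \<epsilon> X) = FObj X pt"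
  unfolding top_space_def by (rule topspace_final_topology[OF eval_point_funcset])

text \<open>The universal properties of the final topology and of the disjoint union combined:
  continuity becomes a test along each profinite set over X.\<close>

lemma continuous_map_top_space:
  "continuous_map (top_space \<delta> \<epsilon> X) Y f \<longleftrightarrow> f \<in> FObj X pt \<rightarrow> topspace Y \<and>
    (\<forall>(K, \<eta>)\<in>profinite_over \<delta> \<epsilon> X.
      continuous_map K Y (\<lambda>k. f (\<eta> pt (encode (cmaps (pt :: 'd topology) K) (point k)))))"
  unfolding top_space_def continuous_map_final_topology[OF eval_point_funcset] continuous_map_sum_topology
  by (auto simp: eval_point_def o_def split_beta)

text \<open>This is the universal property applied to the identity of the quotient space.\<close>

lemma continuous_map_eval_point:
  assumes "(K, \<eta>) \<in> profinite_over \<delta> \<epsilon> X"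
  shows "continuous_map K (top_space \<delta> \<epsilon> X) (\<lambda>k. \<eta> pt (encode (cmaps (pt :: 'd topology) K) (point k)))"
  using continuous_map_top_space[of X "top_space \<delta> \<epsilon> X" "\<lambda>x. x"] assms by auto

text \<open>Composition with \<eta> turns a profinite set over X into the same profinite set over Y.
  Naturality is that of maps of sets, which admits inversion and translations, although these need
  not be homomorphisms.\<close>

lemma nat_trans_continuous:
  assumes \<eta>: "\<eta> \<in> nat_trans (op_cat (Extr \<delta>)) (Set_cat \<epsilon>) X Y"
  shows "continuous_map (top_space \<delta> \<epsilon> X) (top_space \<delta> \<epsilon> Y) (\<eta> pt)"
  unfolding continuous_map_top_space
proof (intro conjI ballI, goal_cases)
  case 1
  then show ?case
    using nat_trans_ComponentD[OF \<eta> Obj_Extr_pt] by (auto simp: topspace_top_space)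
next
  case (2 p)
  then obtain K \<zeta> where p: "p = (K, \<zeta>)" and K: "profinite_space K" "|topspace K| <o \<delta>"
    and \<zeta>: "\<zeta> \<in> nat_trans (op_cat (Extr \<delta>)) (Set_cat \<epsilon>) (underline K) X"
    by (auto simp: profinite_over_def Cond_Hom)
  define \<theta> where "\<theta> = (\<lambda>L\<in>Obj (Extr \<delta>). \<lambda>s\<in>FObj (underline K :: ('d, 'e) cset) L. \<eta> L (\<zeta> L s))"
  have "\<theta> \<in> nat_trans (op_cat (Extr \<delta>)) (Set_cat \<epsilon>) (underline K) Y"
    unfolding \<theta>_def using FMap_underline_mem by (intro nat_trans_Set_comp[OF \<zeta> \<eta>]) auto
  then have "(K, \<theta>) \<in> profinite_over \<delta> \<epsilon> Y"
    using K by (simp add: profinite_over_def Cond_Hom)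
  then have "continuous_map K (top_space \<delta> \<epsilon> Y) (\<lambda>k. \<theta> pt (encode (cmaps (pt :: 'd topology) K) (point k)))"
    by (rule continuous_map_eval_point)
  then have "continuous_map K (top_space \<delta> \<epsilon> Y) (\<lambda>k. \<eta> pt (\<zeta> pt (encode (cmaps (pt :: 'd topology) K) (point k))))"
  proof (rule continuous_map_eq)
    fix k assume "k \<in> topspace K"
    then show "\<theta> pt (encode (cmaps (pt :: 'd topology) K) (point k)) =
        \<eta> pt (\<zeta> pt (encode (cmaps (pt :: 'd topology) K) (point k)))"
      unfolding \<theta>_def restrict_apply'[OF Obj_Extr_pt] by (intro restrict_apply' point_encode_mem)
  qed
  then show ?case
    by (simp add: p)
qed

text \<open>
  A morphism \<open>\<underline>K \<rightarrow> \<underline>T\<close> only sees maps from extremally disconnected spaces to \<open>K\<close>, so continuity of the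
  induced map \<open>K \<rightarrow> T\<close> is tested on an extremally disconnected cover of \<open>K\<close>.
\<close>

lemma nat_trans_underline_continuous:
  fixes T :: "'e topology"
  assumes T: "|topspace T| <o \<epsilon>" and K: "profinite_space K" "|topspace K| <o \<delta>"
    and \<eta>: "\<eta> \<in> nat_trans (op_cat (Extr \<delta>)) (Set_cat \<epsilon>) (underline K) (underline T)"
  shows "continuous_map K T
    (\<lambda>k. decode (cmaps (pt :: 'd topology) T) (\<eta> pt (encode (cmaps (pt :: 'd topology) K) (point k))) undefined)"
    (is "continuous_map K T ?f")
proof -
  have "compact_space K" "Hausdorff_space K"
    using K(1) by (simp_all add: profinite_space_def)
  then obtain E :: "'d topology" and q where "compact_space E" "Hausdorff_space E"
      "extremally_disconnected_space E" "|topspace E| <o \<delta>" and q: "quotient_map E K q"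
    using K(2) by (rule extremally_disconnected_cover[OF \<delta>])
  then have E: "E \<in> Obj (Extr \<delta>)"
    by simp
  define p where "p = restrict q (topspace E)"
  have p: "p \<in> cmaps E K"
    unfolding p_def using q by (intro restrict_cmaps quotient_imp_continuous_map)
  have K': "|topspace K| <o \<epsilon>"
    using K(2) by (rule small_lift)
  \<comment> \<open>The covering map is itself a section of \<open>underline K\<close> over E. Its
    image under \<eta> is the code of a continuous map b on E, from which the continuity on K is
    drawn.\<close>
  have s: "encode (cmaps E K) p \<in> FObj (underline K) E"
    unfolding FObj_underline using p by (rule imageI)
  have "\<eta> E (encode (cmaps E K) p) \<in> FObj (underline T) E"
    using nat_trans_ComponentD[OF \<eta> E] s by (rule PiE_mem)
  then obtain b where b: "b \<in> cmaps E T" and \<eta>b: "\<eta> E (encode (cmaps E K) p) = encode (cmaps E T) b"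
    unfolding FObj_underline by blast
  \<comment> \<open>Naturality along each point e of E identifies the candidate map on K, composed
    with q, with b; the quotient property of q then descends continuity.\<close>
  have "?f (q e) = b e" if e: "e \<in> topspace E" for e
  proof -
    have "encode (cmaps (pt :: 'd topology) K) (point (q e)) =
        FMap (underline K :: ('d, 'e) cset) E pt (point e) (encode (cmaps E K) p)"
      unfolding FMap_underline[OF Obj_Extr_small[OF E] K' p] compose_point
      using e by (simp add: p_def del: topspace_pt)
    also have "\<eta> pt \<dots> = FMap (underline T) E pt (point e) (encode (cmaps E T) b)"
      unfolding \<eta>b[symmetric] by (rule nat_trans_SetD[OF \<eta> E Obj_Extr_pt point_cmaps[OF e] s])
    also have "\<dots> = encode (cmaps (pt :: 'd topology) T) (point (b e))"
      by (simp only: FMap_underline[OF Obj_Extr_small[OF E] T b] compose_point)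
    finally have "\<eta> pt (encode (cmaps (pt :: 'd topology) K) (point (q e))) = encode (cmaps (pt :: 'd topology) T) (point (b e))" .
    then show ?thesis
      using decode_encode[OF Obj_Extr_small[OF Obj_Extr_pt] T point_cmaps[OF cmaps_topspace[OF b e]]] by simp
  qed
  then have "continuous_map E T (?f \<circ> q)"
    using b by (auto simp: cmaps_def intro: continuous_map_eq)
  then show ?thesis
    using continuous_compose_quotient_map_eq[OF q] by blast
qed

end


section \<open>Condensed groups have quasi-topological underlying groups\<close>

lemma forget_group_simps [simp]:
  "FObj (FObj forget_group G) K = carrier (FObj G K)"
  "FMap (FObj forget_group G) = FMap G"
  by (simp_all add: forget_group_def)

lemma forget_underline_grp_obj: "FObj forget_group (underline_grp_obj H) = underline (topol H)"
  by (simp add: forget_group_def underline_grp_obj_def underline_def Let_def)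

lemma top_functor_grp_simps [simp]:
  "carrier (FObj (top_functor_grp \<delta> \<epsilon>) G) = carrier (FObj G pt)"
  "mult (FObj (top_functor_grp \<delta> \<epsilon>) G) = mult (FObj G pt)"
  "one (FObj (top_functor_grp \<delta> \<epsilon>) G) = one (FObj G pt)"
  "topol (FObj (top_functor_grp \<delta> \<epsilon>) G) = top_space \<delta> \<epsilon> (FObj forget_group G)"
  "FMap (top_functor_grp \<delta> \<epsilon>) G H \<eta> = \<eta> pt"
  by (simp_all add: top_functor_grp_def functor_comp_def top_functor_def forget_group_def)

lemma group_top_functor_grp [simp]: "group (FObj (top_functor_grp \<delta> \<epsilon>) G) \<longleftrightarrow> group (FObj G pt)"
  unfolding group_def group_axioms_def monoid_def Units_def top_functor_grp_simps ..

lemma inv_top_functor_grp [simp]: "m_inv (FObj (top_functor_grp \<delta> \<epsilon>) G) = m_inv (FObj G pt)"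
  by (simp add: fun_eq_iff m_inv_def)

lemma hom_top_functor_grp [simp]:
  "hom (FObj (top_functor_grp \<delta> \<epsilon>) G) H = hom (FObj G pt) H"
  "hom H' (FObj (top_functor_grp \<delta> \<epsilon>) G) = hom H' (FObj G pt)"
  by (simp_all add: hom_def)

section \<open>Natural maps between presheaves of groups\<close>

lemma nat_trans_GrpD:
  assumes "\<eta> \<in> nat_trans (op_cat (Extr \<delta>)) (Grp_cat \<epsilon>) G H" "K \<in> Obj (Extr \<delta>)"
  shows nat_trans_Grp_hom: "\<eta> K \<in> hom (FObj G K) (FObj H K)"
    and nat_trans_Grp_ext: "\<eta> K \<in> extensional (carrier (FObj G K))"
  using nat_trans_Hom[OF assms(1), of K] assms(2) by (simp_all del: Extr_simps(1))

lemma nat_trans_forget_group: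
  assumes \<eta>: "\<eta> \<in> nat_trans (op_cat (Extr \<delta>)) (Grp_cat \<epsilon>) G H"
  shows "\<eta> \<in> nat_trans (op_cat (Extr \<delta>)) (Set_cat \<epsilon>) (FObj forget_group G) (FObj forget_group H)"
proof (rule nat_trans_SetI)
  show "\<eta> \<in> extensional (Obj (Extr \<delta>))"
    using nat_trans_ext[OF \<eta>] by (simp del: Extr_simps(1))
  show "\<eta> K \<in> FObj (FObj forget_group G) K \<rightarrow>\<^sub>E FObj (FObj forget_group H) K" if "K \<in> Obj (Extr \<delta>)" for K
    using nat_trans_Grp_hom[OF \<eta> that] nat_trans_Grp_ext[OF \<eta> that] by (simp add: hom_def PiE_def)
  fix K L f s
  assume *: "K \<in> Obj (Extr \<delta>)" "L \<in> Obj (Extr \<delta>)" "f \<in> cmaps L K" "s \<in> FObj (FObj forget_group G) K"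
  have "compose (carrier (FObj G K)) (\<eta> L) (FMap G K L f) = compose (carrier (FObj G K)) (FMap H K L f) (\<eta> K)"
    using nat_trans_natural[OF \<eta>, of K L f] *(1-3) by (simp del: Extr_simps(1))
  from compose_eqD[OF this] show "\<eta> L (FMap (FObj forget_group G) K L f s) = FMap (FObj forget_group H) K L f (\<eta> K s)"
    using *(4) by (simp add: compose_eq)
qed

lemma nat_trans_Grp_natural:
  assumes "\<eta> \<in> nat_trans (op_cat (Extr \<delta>)) (Grp_cat \<epsilon>) G H"
    and "K \<in> Obj (Extr \<delta>)" "L \<in> Obj (Extr \<delta>)" "f \<in> cmaps L K" "s \<in> carrier (FObj G K)"
  shows "\<eta> L (FMap G K L f s) = FMap H K L f (\<eta> K s)"
  using nat_trans_SetD[OF nat_trans_forget_group[OF assms(1)] assms(2-4)] assms(5) by simp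

lemma nat_trans_GrpI:
  assumes "\<eta> \<in> extensional (Obj (Extr \<delta>))"
    and "\<And>K. K \<in> Obj (Extr \<delta>) \<Longrightarrow> \<eta> K \<in> hom (FObj G K) (FObj H K)"
    and "\<And>K. K \<in> Obj (Extr \<delta>) \<Longrightarrow> \<eta> K \<in> extensional (carrier (FObj G K))"
    and "\<And>K L f s. \<lbrakk>K \<in> Obj (Extr \<delta>); L \<in> Obj (Extr \<delta>); f \<in> cmaps L K; s \<in> carrier (FObj G K)\<rbrakk> \<Longrightarrow>
      \<eta> L (FMap G K L f s) = FMap H K L f (\<eta> K s)"
  shows "\<eta> \<in> nat_trans (op_cat (Extr \<delta>)) (Grp_cat \<epsilon>) G H"
  using assms by (auto simp: nat_trans_def PiE_def compose_def simp del: Extr_simps(1) intro!: restrict_ext)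

lemma nat_trans_Grp_eqI:
  assumes \<eta>: "\<eta> \<in> nat_trans (op_cat (Extr \<delta>)) (Grp_cat \<epsilon>) G H"
    and \<theta>: "\<theta> \<in> nat_trans (op_cat (Extr \<delta>)) (Grp_cat \<epsilon>) G H"
    and eq: "\<And>K s. \<lbrakk>K \<in> Obj (Extr \<delta>); s \<in> carrier (FObj G K)\<rbrakk> \<Longrightarrow> \<eta> K s = \<theta> K s"
  shows "\<eta> = \<theta>"
proof (rule extensionalityI)
  show "\<eta> \<in> extensional (Obj (Extr \<delta>))" "\<theta> \<in> extensional (Obj (Extr \<delta>))"
    using nat_trans_ext[OF \<eta>] nat_trans_ext[OF \<theta>] by (simp_all del: Extr_simps(1))
  fix K assume K: "K \<in> Obj (Extr \<delta>)"
  show "\<eta> K = \<theta> K"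
    by (rule extensionalityI[OF nat_trans_Grp_ext[OF \<eta> K] nat_trans_Grp_ext[OF \<theta> K] eq[OF K]])
qed

lemma condensed_groupD:
  assumes G: "is_functor (op_cat (Extr \<delta>)) (Grp_cat \<epsilon>) G" and K: "K \<in> Obj (Extr \<delta>)"
  shows condensed_group_group: "group (FObj G K)"
    and condensed_group_small: "|carrier (FObj G K)| <o \<epsilon>"
    and condensed_group_hom: "\<lbrakk>L \<in> Obj (Extr \<delta>); f \<in> cmaps L K\<rbrakk> \<Longrightarrow> FMap G K L f \<in> hom (FObj G K) (FObj G L)"
    and condensed_group_ident: "s \<in> carrier (FObj G K) \<Longrightarrow> FMap G K K (\<lambda>x\<in>topspace K. x) s = s"
    and condensed_group_comp: "\<lbrakk>L \<in> Obj (Extr \<delta>); M \<in> Obj (Extr \<delta>); f \<in> cmaps L K; g \<in> cmaps M L;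
      s \<in> carrier (FObj G K)\<rbrakk> \<Longrightarrow>
      FMap G K M (compose (topspace M) f g) s = FMap G L M g (FMap G K L f s)"
proof -
  show "group (FObj G K)" "|carrier (FObj G K)| <o \<epsilon>"
    using functor_Obj[OF G, of K] K by (simp_all del: Extr_simps(1))
  show "FMap G K L f \<in> hom (FObj G K) (FObj G L)" if "L \<in> Obj (Extr \<delta>)" "f \<in> cmaps L K"
    using functor_Hom[OF G, of K L f] K that by (simp del: Extr_simps(1))
  show "FMap G K K (\<lambda>x\<in>topspace K. x) s = s" if "s \<in> carrier (FObj G K)"
    using functor_Ident[OF G, of K] K that by (simp del: Extr_simps(1))
  show "FMap G K M (compose (topspace M) f g) s = FMap G L M g (FMap G K L f s)"
    if "L \<in> Obj (Extr \<delta>)" "M \<in> Obj (Extr \<delta>)" "f \<in> cmaps L K" "g \<in> cmaps M L" "s \<in> carrier (FObj G K)"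
    using functor_Comp[OF G, of K L M f g] K that by (simp del: Extr_simps(1) add: compose_eq)
qed

context inaccessible_pair
begin

lemma ident_pt: "(\<lambda>x\<in>topspace (pt :: 'd topology). x) = point undefined"
  by (auto simp: fun_eq_iff)

lemma condensed_group_point_ident:
  assumes "is_functor (op_cat (Extr \<delta>)) (Grp_cat \<epsilon>) G" "s \<in> carrier (FObj G pt)"
  shows "FMap G pt pt (point undefined) s = s"
  using condensed_group_ident[OF assms(1) Obj_Extr_pt assms(2)] by (simp only: ident_pt)

text \<open>Inversion is natural because restriction maps are homomorphisms. To translate over every
  K, an element a over the point is replaced by its pullback to K, the constant section.\<close>

lemma quasi_topological_group_top_functor_grp:
  assumes G: "is_functor (op_cat (Extr \<delta>)) (Grp_cat \<epsilon>) G"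
  shows "quasi_topological_group (FObj (top_functor_grp \<delta> \<epsilon>) G)"
proof -
  let ?X = "FObj forget_group G" and ?T = "top_space \<delta> \<epsilon> (FObj forget_group G)"
  note grp = condensed_group_group[OF G] and hom = condensed_group_hom[OF G]
  have T: "topspace ?T = carrier (FObj G pt)"
    by (simp add: topspace_top_space)
  interpret pt: group "FObj G pt"
    by (rule grp[OF Obj_Extr_pt])
  \<comment> \<open>The family has to be restricted to the carriers to count as a transformation; at
    the point this changes nothing on the space.\<close>
  have continuous: "continuous_map ?T ?T (\<eta> pt)"
    if "\<And>K s. K \<in> Obj (Extr \<delta>) \<Longrightarrow> s \<in> carrier (FObj G K) \<Longrightarrow> \<eta> K s \<in> carrier (FObj G K)"
      and "\<And>K L f s. \<lbrakk>K \<in> Obj (Extr \<delta>); L \<in> Obj (Extr \<delta>); f \<in> cmaps L K; s \<in> carrier (FObj G K)\<rbrakk>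
        \<Longrightarrow> \<eta> L (FMap G K L f s) = FMap G K L f (\<eta> K s)" for \<eta>
  proof -
    define \<theta> where "\<theta> = (\<lambda>K\<in>Obj (Extr \<delta>). \<lambda>s\<in>carrier (FObj G K). \<eta> K s)"
    have "\<theta> \<in> nat_trans (op_cat (Extr \<delta>)) (Set_cat \<epsilon>) ?X ?X"
      by (rule nat_trans_SetI)
        (use that hom_in_carrier[OF hom] in \<open>auto simp: \<theta>_def simp del: Extr_simps(1)\<close>)
    from nat_trans_continuous[OF this] show ?thesis
      by (rule continuous_map_eq) (use Obj_Extr_pt in \<open>simp add: \<theta>_def T del: Extr_simps(1)\<close>)
  qed
  have inv: "continuous_map ?T ?T (\<lambda>x. inv\<^bsub>FObj G pt\<^esub> x)"
  proof (rule continuous[of "\<lambda>K s. inv\<^bsub>FObj G K\<^esub> s"])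
    fix K L f s assume *: "K \<in> Obj (Extr \<delta>)" "L \<in> Obj (Extr \<delta>)" "f \<in> cmaps L K" "s \<in> carrier (FObj G K)"
    interpret group_hom "FObj G K" "FObj G L" "FMap G K L f"
      using grp[OF *(1)] grp[OF *(2)] hom[OF *(1-3)] by (simp add: group_hom_def group_hom_axioms_def)
    show "inv\<^bsub>FObj G L\<^esub> (FMap G K L f s) = FMap G K L f (inv\<^bsub>FObj G K\<^esub> s)"
      using *(4) by simp
  qed (rule group.inv_closed[OF grp])
  \<comment> \<open>The constant section with value a: the pullback along the unique map from K to
    the point, whose only element is \<open>undefined\<close>.\<close>
  define c where "c K = FMap G pt K (\<lambda>_\<in>topspace K. undefined)" for K
  have const: "(\<lambda>_\<in>topspace K. undefined) \<in> cmaps K (pt :: 'd topology)" for K :: "'d topology"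
    by (rule cmaps_const) simp
  have c_mem: "c K a \<in> carrier (FObj G K)" if "K \<in> Obj (Extr \<delta>)" "a \<in> carrier (FObj G pt)" for K a
    unfolding c_def using hom[OF Obj_Extr_pt that(1) const] that(2) by (rule hom_in_carrier)
  have c_nat: "FMap G K L f (c K a) = c L a"
    if *: "K \<in> Obj (Extr \<delta>)" "L \<in> Obj (Extr \<delta>)" "f \<in> cmaps L K" and a: "a \<in> carrier (FObj G pt)" for K L f a
  proof -
    have "compose (topspace L) (\<lambda>_\<in>topspace K. undefined) f = (\<lambda>_\<in>topspace L. undefined :: 'd)"
      using cmaps_topspace[OF *(3)] by (auto simp: compose_def fun_eq_iff)
    then show ?thesis
      unfolding c_def using condensed_group_comp[OF G Obj_Extr_pt *(1,2) const *(3) a] by simp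
  qed
  \<comment> \<open>The unique map from the point to itself is the identity, so over the point the
    family is translation by a itself.\<close>
  have c_pt: "c pt a = a" if "a \<in> carrier (FObj G pt)" for a
    unfolding c_def using condensed_group_point_ident[OF G that] .
  have left: "continuous_map ?T ?T (\<lambda>x. a \<otimes>\<^bsub>FObj G pt\<^esub> x)" if a: "a \<in> carrier (FObj G pt)" for a
  proof -
    have "continuous_map ?T ?T (\<lambda>x. c pt a \<otimes>\<^bsub>FObj G pt\<^esub> x)"
    proof (rule continuous[of "\<lambda>K s. c K a \<otimes>\<^bsub>FObj G K\<^esub> s"])
      fix K s assume "K \<in> Obj (Extr \<delta>)" "s \<in> carrier (FObj G K)"
      then show "c K a \<otimes>\<^bsub>FObj G K\<^esub> s \<in> carrier (FObj G K)"
        using monoid.m_closed[OF group.is_monoid[OF grp]] c_mem[OF _ a] by simp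
    next
      fix K L f s assume *: "K \<in> Obj (Extr \<delta>)" "L \<in> Obj (Extr \<delta>)" "f \<in> cmaps L K" "s \<in> carrier (FObj G K)"
      show "c L a \<otimes>\<^bsub>FObj G L\<^esub> FMap G K L f s = FMap G K L f (c K a \<otimes>\<^bsub>FObj G K\<^esub> s)"
        using hom_mult[OF hom[OF *(1-3)] c_mem[OF *(1) a] *(4)] c_nat[OF *(1-3) a] by simp
    qed
    then show ?thesis
      by (simp add: c_pt[OF a])
  qed
  have right: "continuous_map ?T ?T (\<lambda>x. x \<otimes>\<^bsub>FObj G pt\<^esub> a)" if a: "a \<in> carrier (FObj G pt)" for a
  proof -
    have "continuous_map ?T ?T (\<lambda>x. x \<otimes>\<^bsub>FObj G pt\<^esub> c pt a)"
    proof (rule continuous[of "\<lambda>K s. s \<otimes>\<^bsub>FObj G K\<^esub> c K a"])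
      fix K s assume "K \<in> Obj (Extr \<delta>)" "s \<in> carrier (FObj G K)"
      then show "s \<otimes>\<^bsub>FObj G K\<^esub> c K a \<in> carrier (FObj G K)"
        using monoid.m_closed[OF group.is_monoid[OF grp]] c_mem[OF _ a] by simp
    next
      fix K L f s assume *: "K \<in> Obj (Extr \<delta>)" "L \<in> Obj (Extr \<delta>)" "f \<in> cmaps L K" "s \<in> carrier (FObj G K)"
      show "FMap G K L f s \<otimes>\<^bsub>FObj G L\<^esub> c L a = FMap G K L f (s \<otimes>\<^bsub>FObj G K\<^esub> c K a)"
        using hom_mult[OF hom[OF *(1-3)] *(4) c_mem[OF *(1) a]] c_nat[OF *(1-3) a] by simp
    qed
    then show ?thesis
      by (simp add: c_pt[OF a])
  qed
  show ?thesis
    unfolding quasi_topological_group_def using T inv left right pt.is_group by simp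
qed

lemma CondGrp_functor: "G \<in> Obj (CondGrp \<delta> \<epsilon>) \<Longrightarrow> is_functor (op_cat (Extr \<delta>)) (Grp_cat \<epsilon>) G"
  by (simp add: Cond_Obj)

lemma top_functor_grp_Hom:
  assumes "\<eta> \<in> nat_trans (op_cat (Extr \<delta>)) (Grp_cat \<epsilon>) G H"
  shows "\<eta> pt \<in> Hom (qTopGrp \<epsilon>) (FObj (top_functor_grp \<delta> \<epsilon>) G) (FObj (top_functor_grp \<delta> \<epsilon>) H)"
  using nat_trans_continuous[OF nat_trans_forget_group[OF assms]] nat_trans_GrpD[OF assms Obj_Extr_pt]
  by (simp add: cmaps_def topspace_top_space)

lemma is_functor_top_functor_grp:
  "is_functor (CondGrp \<delta> \<epsilon>) (qTopGrp \<epsilon>) (top_functor_grp \<delta> \<epsilon>)"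
  unfolding is_functor_def
proof (intro conjI ballI)
  show "is_category (CondGrp \<delta> \<epsilon>)" "is_category (qTopGrp \<epsilon>)"
    by (rule is_category_CondGrp is_category_qTopGrp)+
  fix G assume G: "G \<in> Obj (CondGrp \<delta> \<epsilon>)"
  then show "FObj (top_functor_grp \<delta> \<epsilon>) G \<in> Obj (qTopGrp \<epsilon>)"
    using quasi_topological_group_top_functor_grp[OF CondGrp_functor[OF G]]
      condensed_group_small[OF CondGrp_functor[OF G] Obj_Extr_pt] by simp
  show "FMap (top_functor_grp \<delta> \<epsilon>) G G (Ident (CondGrp \<delta> \<epsilon>) G) =
      Ident (qTopGrp \<epsilon>) (FObj (top_functor_grp \<delta> \<epsilon>) G)"
    unfolding top_functor_grp_simps Cond_Ident qTopGrp_simps Grp_cat_simps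
    by (rule restrict_apply'[OF Obj_Extr_pt])
next
  fix G H \<eta> assume "\<eta> \<in> Hom (CondGrp \<delta> \<epsilon>) G H"
  then show "FMap (top_functor_grp \<delta> \<epsilon>) G H \<eta> \<in>
      Hom (qTopGrp \<epsilon>) (FObj (top_functor_grp \<delta> \<epsilon>) G) (FObj (top_functor_grp \<delta> \<epsilon>) H)"
    unfolding Cond_Hom top_functor_grp_simps by (rule top_functor_grp_Hom)
next
  fix G H J \<eta> \<theta>
  show "FMap (top_functor_grp \<delta> \<epsilon>) G J (Comp (CondGrp \<delta> \<epsilon>) G H J \<theta> \<eta>) =
      Comp (qTopGrp \<epsilon>) (FObj (top_functor_grp \<delta> \<epsilon>) G) (FObj (top_functor_grp \<delta> \<epsilon>) H)
        (FObj (top_functor_grp \<delta> \<epsilon>) J) (FMap (top_functor_grp \<delta> \<epsilon>) H J \<theta>) (FMap (top_functor_grp \<delta> \<epsilon>) G H \<eta>)"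
    unfolding top_functor_grp_simps Cond_Comp qTopGrp_simps Grp_cat_simps
    by (rule restrict_apply'[OF Obj_Extr_pt])
qed

end


section \<open>The adjunction\<close>

text \<open>The term \<open>FMap G K pt (point k) s\<close> is the value of the section s at
  k.\<close>

definition transpose_to_underline ::
    "'d rel \<Rightarrow> ('d, 'e) cgrp \<Rightarrow> 'e topgrp \<Rightarrow> ('e \<Rightarrow> 'e) \<Rightarrow> ('d, 'e) cmor" where
  "transpose_to_underline \<delta> G H f = (\<lambda>K\<in>Obj (Extr \<delta>). \<lambda>s\<in>carrier (FObj G K).
     encode (cmaps K (topol H)) (\<lambda>k\<in>topspace K. f (FMap G K pt (point k) s)))"

text \<open>A section of \<open>underline\<close> over the point is the code of a map defined on the
  single element \<open>undefined\<close>; decoding and evaluating there recovers an element of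
  H.\<close>

definition transpose_from_underline ::
    "('d, 'e) cgrp \<Rightarrow> 'e topgrp \<Rightarrow> ('d, 'e) cmor \<Rightarrow> 'e \<Rightarrow> 'e" where
  "transpose_from_underline G H \<eta> =
     (\<lambda>x\<in>carrier (FObj G pt). decode (cmaps (pt :: 'd topology) (topol H)) (\<eta> pt x) undefined)"

context inaccessible_pair
begin

text \<open>By the Yoneda lemma, a section over \<open>K\<close> is a morphism \<open>\<underline>K \<rightarrow> G\<close>.\<close>

lemma section_continuous:
  assumes G: "is_functor (op_cat (Extr \<delta>)) (Grp_cat \<epsilon>) G"
    and K: "K \<in> Obj (Extr \<delta>)" and s: "s \<in> carrier (FObj G K)"
  shows "continuous_map K (top_space \<delta> \<epsilon> (FObj forget_group G)) (\<lambda>k. FMap G K pt (point k) s)"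
proof -
  \<comment> \<open>The Yoneda transformation of s: a map from L to K, given by its code t, is sent
    to the pullback of s along it.\<close>
  define \<zeta> where "\<zeta> = (\<lambda>L\<in>Obj (Extr \<delta>). \<lambda>t\<in>FObj (underline K :: ('d, 'e) cset) L.
    FMap G K L (decode (cmaps L K) t) s)"
  have sK: "|topspace K| <o \<epsilon>"
    using Obj_Extr_small[OF K] by (rule small_lift)
  have \<zeta>: "\<zeta> L (encode (cmaps L K) a) = FMap G K L a s" if L: "L \<in> Obj (Extr \<delta>)" and a: "a \<in> cmaps L K" for L a
    unfolding \<zeta>_def restrict_apply'[OF L] FObj_underline restrict_apply'[OF imageI[OF a]]
      decode_encode[OF Obj_Extr_small[OF L] sK a] ..
  have "\<zeta> \<in> nat_trans (op_cat (Extr \<delta>)) (Set_cat \<epsilon>) (underline K) (FObj forget_group G)"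
  proof (rule nat_trans_SetI)
    show "\<zeta> \<in> extensional (Obj (Extr \<delta>))"
      by (simp add: \<zeta>_def)
    show "\<zeta> L \<in> FObj (underline K) L \<rightarrow>\<^sub>E FObj (FObj forget_group G) L" if L: "L \<in> Obj (Extr \<delta>)" for L
    proof (rule PiE_I)
      fix t assume "t \<in> FObj (underline K :: ('d, 'e) cset) L"
      then obtain a where a: "a \<in> cmaps L K" and t: "t = encode (cmaps L K) a"
        unfolding FObj_underline by blast
      show "\<zeta> L t \<in> FObj (FObj forget_group G) L"
        unfolding t \<zeta>[OF L a] forget_group_simps
        using condensed_group_hom[OF G K L a] s by (rule hom_in_carrier)
    next
      fix t assume "t \<notin> FObj (underline K :: ('d, 'e) cset) L"
      then show "\<zeta> L t = undefined"
        unfolding \<zeta>_def restrict_apply'[OF L] by simp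
    qed
    fix L M f t assume L: "L \<in> Obj (Extr \<delta>)" and M: "M \<in> Obj (Extr \<delta>)" and f: "f \<in> cmaps M L"
      and "t \<in> FObj (underline K :: ('d, 'e) cset) L"
    then obtain a where a: "a \<in> cmaps L K" and t: "t = encode (cmaps L K) a"
      unfolding FObj_underline by blast
    show "\<zeta> M (FMap (underline K) L M f t) = FMap (FObj forget_group G) L M f (\<zeta> L t)"
      unfolding t FMap_underline[OF Obj_Extr_small[OF L] sK a] \<zeta>[OF L a] \<zeta>[OF M cmaps_compose[OF f a]]
        forget_group_simps
      by (rule condensed_group_comp[OF G K L M a f s])
  qed
  \<comment> \<open>K is extremally disconnected, hence profinite, so \<zeta> is one of the maps
    defining the quotient topology; on points it sends k to the value of s at k.\<close>
  then have "(K, \<zeta>) \<in> profinite_over \<delta> \<epsilon> (FObj forget_group G)"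
    using K profinite_space_extremally_disconnected[of K] by (simp add: profinite_over_def Cond_Hom)
  from continuous_map_eval_point[OF this] show ?thesis
    by (rule continuous_map_eq) (rule \<zeta>[OF Obj_Extr_pt point_cmaps])
qed

lemma transpose_section_cmaps:
  assumes G: "is_functor (op_cat (Extr \<delta>)) (Grp_cat \<epsilon>) G"
    and f: "f \<in> cmaps (top_space \<delta> \<epsilon> (FObj forget_group G)) T"
    and K: "K \<in> Obj (Extr \<delta>)" and s: "s \<in> carrier (FObj G K)"
  shows "(\<lambda>k\<in>topspace K. f (FMap G K pt (point k) s)) \<in> cmaps K T"
proof (rule restrict_cmaps)
  have "continuous_map (top_space \<delta> \<epsilon> (FObj forget_group G)) T f"
    using f by (simp add: cmaps_def)
  from continuous_map_compose[OF section_continuous[OF G K s] this]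
  show "continuous_map K T (\<lambda>k. f (FMap G K pt (point k) s))"
    by (simp add: o_def)
qed

lemma transpose_to_underline_apply:
  "K \<in> Obj (Extr \<delta>) \<Longrightarrow> s \<in> carrier (FObj G K) \<Longrightarrow> transpose_to_underline \<delta> G H f K s =
    encode (cmaps K (topol H)) (\<lambda>k\<in>topspace K. f (FMap G K pt (point k) s))"
  by (simp add: transpose_to_underline_def del: Extr_simps(1))

text \<open>Evaluation at k and f are both homomorphisms, which gives multiplicativity at each k.
  Naturality holds because the value at k of the pullback of s along g is the value of s at
  \<open>g k\<close>.\<close>

lemma transpose_to_underline_nat_trans:
  assumes G: "is_functor (op_cat (Extr \<delta>)) (Grp_cat \<epsilon>) G"
    and H: "topological_group H" "|carrier H| <o \<epsilon>"
    and f: "f \<in> hom (FObj G pt) H" "f \<in> cmaps (top_space \<delta> \<epsilon> (FObj forget_group G)) (topol H)"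
  shows "transpose_to_underline \<delta> G H f \<in>
    nat_trans (op_cat (Extr \<delta>)) (Grp_cat \<epsilon>) G (underline_grp_obj H)"
proof (rule nat_trans_GrpI)
  note app = transpose_to_underline_apply and sec = transpose_section_cmaps[OF G f(2)]
  have T: "|topspace (topol H)| <o \<epsilon>"
    using H by (simp add: topological_group_topspace)
  show "transpose_to_underline \<delta> G H f \<in> extensional (Obj (Extr \<delta>))"
    by (simp add: transpose_to_underline_def)
  show "transpose_to_underline \<delta> G H f K \<in> extensional (carrier (FObj G K))" if "K \<in> Obj (Extr \<delta>)" for K
    using that by (simp add: transpose_to_underline_def)
  show "transpose_to_underline \<delta> G H f K \<in> hom (FObj G K) (FObj (underline_grp_obj H) K)"
    if K: "K \<in> Obj (Extr \<delta>)" for K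
  proof (rule homI)
    fix s assume s: "s \<in> carrier (FObj G K)"
    show "transpose_to_underline \<delta> G H f K s \<in> carrier (FObj (underline_grp_obj H) K)"
      unfolding app[OF K s] underline_grp_obj_simps(1) by (rule imageI[OF sec[OF K s]])
    fix t assume t: "t \<in> carrier (FObj G K)"
    have st: "s \<otimes>\<^bsub>FObj G K\<^esub> t \<in> carrier (FObj G K)"
      using condensed_group_group[OF G K] s t by (simp add: group.is_monoid monoid.m_closed)
    have "f (FMap G K pt (point k) (s \<otimes>\<^bsub>FObj G K\<^esub> t)) =
        f (FMap G K pt (point k) s) \<otimes>\<^bsub>H\<^esub> f (FMap G K pt (point k) t)" if "k \<in> topspace K" for k
    proof -
      have h: "FMap G K pt (point k) \<in> hom (FObj G K) (FObj G pt)"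
        using condensed_group_hom[OF G K Obj_Extr_pt point_cmaps[OF that]] .
      show ?thesis
        by (simp only: hom_mult[OF h s t] hom_mult[OF f(1) hom_in_carrier[OF h s] hom_in_carrier[OF h t]])
    qed
    then show "transpose_to_underline \<delta> G H f K (s \<otimes>\<^bsub>FObj G K\<^esub> t) =
        transpose_to_underline \<delta> G H f K s \<otimes>\<^bsub>FObj (underline_grp_obj H) K\<^esub> transpose_to_underline \<delta> G H f K t"
      unfolding app[OF K s] app[OF K t] app[OF K st]
        underline_mult[OF H Obj_Extr_small[OF K] sec[OF K s] sec[OF K t]]
      by (intro arg_cong[of _ _ "encode _"] restrict_ext) simp
  qed
  fix K L g s assume K: "K \<in> Obj (Extr \<delta>)" and L: "L \<in> Obj (Extr \<delta>)" and g: "g \<in> cmaps L K"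
    and s: "s \<in> carrier (FObj G K)"
  have gs: "FMap G K L g s \<in> carrier (FObj G L)"
    using condensed_group_hom[OF G K L g] s by (rule hom_in_carrier)
  have "FMap G L pt (point k) (FMap G K L g s) = FMap G K pt (point (g k)) s" if "k \<in> topspace L" for k
    using condensed_group_comp[OF G K L Obj_Extr_pt g point_cmaps[OF that] s] by (simp only: compose_point)
  then show "transpose_to_underline \<delta> G H f L (FMap G K L g s) =
      FMap (underline_grp_obj H) K L g (transpose_to_underline \<delta> G H f K s)"
    unfolding app[OF K s] app[OF L gs] underline_grp_obj_simps(4)
      FMap_underline[OF Obj_Extr_small[OF K] T sec[OF K s]]
    unfolding compose_def
    by (intro arg_cong[of _ _ "encode _"] restrict_ext) (simp add: cmaps_topspace[OF g] del: topspace_pt)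
qed

text \<open>Maps out of the one-point space are constants, so the component of \<eta> at the point
  can be handled through elements of H.\<close>

lemma nat_trans_underline_point:
  assumes H: "topological_group H" "|carrier H| <o \<epsilon>"
    and \<eta>: "\<eta> \<in> nat_trans (op_cat (Extr \<delta>)) (Grp_cat \<epsilon>) G (underline_grp_obj H)"
    and x: "x \<in> carrier (FObj G pt)"
  obtains h where "h \<in> carrier H" "\<eta> pt x = encode (cmaps (pt :: 'd topology) (topol H)) (point h)"
    "decode (cmaps (pt :: 'd topology) (topol H)) (\<eta> pt x) undefined = h"
proof -
  have T: "|topspace (topol H)| <o \<epsilon>"
    using H by (simp add: topological_group_topspace)
  have "\<eta> pt x \<in> carrier (FObj (underline_grp_obj H) (pt :: 'd topology))"
    using nat_trans_Grp_hom[OF \<eta> Obj_Extr_pt] x by (rule hom_in_carrier)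
  then obtain b where b: "b \<in> cmaps (pt :: 'd topology) (topol H)"
    and \<eta>b: "\<eta> pt x = encode (cmaps (pt :: 'd topology) (topol H)) b"
    unfolding underline_grp_obj_simps(1) by blast
  show thesis
  proof (rule that[of "b undefined"])
    show "b undefined \<in> carrier H"
      using cmaps_carrier[OF H(1) b] by simp
    show "\<eta> pt x = encode (cmaps (pt :: 'd topology) (topol H)) (point (b undefined))"
      using \<eta>b cmaps_pt_eq_point[OF b] by (rule back_subst[where P = "\<lambda>c. \<eta> pt x = encode _ c"])
    show "decode (cmaps (pt :: 'd topology) (topol H)) (\<eta> pt x) undefined = b undefined"
      unfolding \<eta>b decode_encode[OF Obj_Extr_small[OF Obj_Extr_pt] T b] ..
  qed
qed

text \<open>Products over the point are pointwise, whence multiplicativity. For continuity, a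
  profinite set K over G followed by \<eta> is an arrow from \<open>underline K\<close> to
  \<open>underline (topol H)\<close>, to which the cover argument applies.\<close>

lemma transpose_from_underline_Hom:
  assumes G: "is_functor (op_cat (Extr \<delta>)) (Grp_cat \<epsilon>) G"
    and H: "topological_group H" "|carrier H| <o \<epsilon>"
    and \<eta>: "\<eta> \<in> nat_trans (op_cat (Extr \<delta>)) (Grp_cat \<epsilon>) G (underline_grp_obj H)"
  shows "transpose_from_underline G H \<eta> \<in> hom (FObj G pt) H"
    and "transpose_from_underline G H \<eta> \<in> cmaps (top_space \<delta> \<epsilon> (FObj forget_group G)) (topol H)"
proof -
  let ?f = "transpose_from_underline G H \<eta>"
  have T: "|topspace (topol H)| <o \<epsilon>"
    using H by (simp add: topological_group_topspace)
  note pnt = nat_trans_underline_point[OF H \<eta>]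
  have val: "?f x = decode (cmaps (pt :: 'd topology) (topol H)) (\<eta> pt x) undefined" if "x \<in> carrier (FObj G pt)" for x
    using that by (simp add: transpose_from_underline_def)
  have mem: "?f x \<in> carrier H" if "x \<in> carrier (FObj G pt)" for x
    using pnt[OF that] val[OF that] by metis
  show "?f \<in> hom (FObj G pt) H"
  proof (rule homI[OF mem])
    fix x y assume x: "x \<in> carrier (FObj G pt)" and y: "y \<in> carrier (FObj G pt)"
    have xy: "x \<otimes>\<^bsub>FObj G pt\<^esub> y \<in> carrier (FObj G pt)"
      using condensed_group_group[OF G Obj_Extr_pt] x y by (simp add: group.is_monoid monoid.m_closed)
    obtain a where a: "a \<in> carrier H" "\<eta> pt x = encode (cmaps (pt :: 'd topology) (topol H)) (point a)" "?f x = a"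
      using pnt[OF x] val[OF x] by metis
    obtain b where b: "b \<in> carrier H" "\<eta> pt y = encode (cmaps (pt :: 'd topology) (topol H)) (point b)" "?f y = b"
      using pnt[OF y] val[OF y] by metis
    have c: "point a \<in> cmaps (pt :: 'd topology) (topol H)" "point b \<in> cmaps (pt :: 'd topology) (topol H)"
      using a(1) b(1) topological_group_topspace[OF H(1)] by (simp_all only: point_cmaps)
    have "\<eta> pt (x \<otimes>\<^bsub>FObj G pt\<^esub> y) = \<eta> pt x \<otimes>\<^bsub>FObj (underline_grp_obj H) (pt :: 'd topology)\<^esub> \<eta> pt y"
      using nat_trans_Grp_hom[OF \<eta> Obj_Extr_pt] x y by (rule hom_mult)
    also have "\<dots> = encode (cmaps (pt :: 'd topology) (topol H))
        (\<lambda>k\<in>topspace (pt :: 'd topology). (point a :: 'd \<Rightarrow> 'e) k \<otimes>\<^bsub>H\<^esub> (point b :: 'd \<Rightarrow> 'e) k)"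
      unfolding a(2) b(2) by (rule underline_mult[OF H Obj_Extr_small[OF Obj_Extr_pt] c])
    finally show "?f (x \<otimes>\<^bsub>FObj G pt\<^esub> y) = ?f x \<otimes>\<^bsub>H\<^esub> ?f y"
      unfolding val[OF xy] a(3) b(3)
      using decode_encode[OF Obj_Extr_small[OF Obj_Extr_pt] T cmaps_mult[OF H(1) c]] by simp
  qed
  have "continuous_map (top_space \<delta> \<epsilon> (FObj forget_group G)) (topol H) ?f"
    unfolding continuous_map_top_space
  proof (intro conjI ballI, goal_cases)
    case 1
    then show ?case
      using mem by (simp add: topological_group_topspace[OF H(1)])
  next
    case (2 p)
    then obtain K \<zeta> where p: "p = (K, \<zeta>)" and K: "profinite_space K" "|topspace K| <o \<delta>"
      and \<zeta>: "\<zeta> \<in> nat_trans (op_cat (Extr \<delta>)) (Set_cat \<epsilon>) (underline K) (FObj forget_group G)"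
      by (auto simp: profinite_over_def Cond_Hom)
    define \<theta> where "\<theta> = (\<lambda>L\<in>Obj (Extr \<delta>). \<lambda>s\<in>FObj (underline K :: ('d, 'e) cset) L. \<eta> L (\<zeta> L s))"
    have \<eta>': "\<eta> \<in> nat_trans (op_cat (Extr \<delta>)) (Set_cat \<epsilon>) (FObj forget_group G) (underline (topol H))"
      using nat_trans_forget_group[OF \<eta>] by (simp only: forget_underline_grp_obj)
    have "\<theta> \<in> nat_trans (op_cat (Extr \<delta>)) (Set_cat \<epsilon>) (underline K) (underline (topol H))"
      unfolding \<theta>_def using FMap_underline_mem by (intro nat_trans_Set_comp[OF \<zeta> \<eta>']) auto
    from nat_trans_underline_continuous[OF T K this]
    have "continuous_map K (topol H) (\<lambda>k. ?f (\<zeta> pt (encode (cmaps (pt :: 'd topology) K) (point k))))"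
    proof (rule continuous_map_eq)
      fix k assume k: "k \<in> topspace K"
      have "\<theta> pt (encode (cmaps (pt :: 'd topology) K) (point k)) = \<eta> pt (\<zeta> pt (encode (cmaps (pt :: 'd topology) K) (point k)))"
        unfolding \<theta>_def restrict_apply'[OF Obj_Extr_pt] by (rule restrict_apply'[OF point_encode_mem[OF k]])
      moreover have "\<zeta> pt (encode (cmaps (pt :: 'd topology) K) (point k)) \<in> carrier (FObj G pt)"
        using eval_point_mem[OF \<zeta> k] by simp
      ultimately show "decode (cmaps (pt :: 'd topology) (topol H)) (\<theta> pt (encode (cmaps (pt :: 'd topology) K) (point k))) undefined =
          ?f (\<zeta> pt (encode (cmaps (pt :: 'd topology) K) (point k)))"
        by (simp only: val)
    qed
    then show ?case
      by (simp only: p prod.case)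
  qed
  then show "?f \<in> cmaps (top_space \<delta> \<epsilon> (FObj forget_group G)) (topol H)"
    by (simp add: cmaps_def topspace_top_space transpose_from_underline_def)
qed

text \<open>A section over the point is its own value there, since evaluation at the only point is
  pullback along the identity.\<close>

lemma transpose_from_to_underline:
  assumes G: "is_functor (op_cat (Extr \<delta>)) (Grp_cat \<epsilon>) G"
    and H: "topological_group H" "|carrier H| <o \<epsilon>"
    and f: "f \<in> cmaps (top_space \<delta> \<epsilon> (FObj forget_group G)) (topol H)"
  shows "transpose_from_underline G H (transpose_to_underline \<delta> G H f) = f"
proof (rule extensionalityI)
  show "transpose_from_underline G H (transpose_to_underline \<delta> G H f) \<in> extensional (carrier (FObj G pt))"
    by (simp add: transpose_from_underline_def)
  show "f \<in> extensional (carrier (FObj G pt))"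
    using f by (simp add: cmaps_def topspace_top_space)
  fix x assume x: "x \<in> carrier (FObj G pt)"
  have T: "|topspace (topol H)| <o \<epsilon>"
    using H by (simp add: topological_group_topspace)
  show "transpose_from_underline G H (transpose_to_underline \<delta> G H f) x = f x"
    unfolding transpose_from_underline_def restrict_apply'[OF x] transpose_to_underline_apply[OF Obj_Extr_pt x]
      decode_encode[OF Obj_Extr_small[OF Obj_Extr_pt] T transpose_section_cmaps[OF G f Obj_Extr_pt x]]
    using condensed_group_point_ident[OF G x] by simp
qed

text \<open>A section of \<open>underline\<close> over K is the code of a map and so is determined
  by its values; naturality of \<eta> along each point of K computes them from the component at the
  point.\<close>

lemma transpose_to_from_underline:
  assumes G: "is_functor (op_cat (Extr \<delta>)) (Grp_cat \<epsilon>) G"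
    and H: "topological_group H" "|carrier H| <o \<epsilon>"
    and \<eta>: "\<eta> \<in> nat_trans (op_cat (Extr \<delta>)) (Grp_cat \<epsilon>) G (underline_grp_obj H)"
  shows "transpose_to_underline \<delta> G H (transpose_from_underline G H \<eta>) = \<eta>"
proof (rule nat_trans_Grp_eqI[OF _ \<eta>])
  have T: "|topspace (topol H)| <o \<epsilon>"
    using H by (simp add: topological_group_topspace)
  show "transpose_to_underline \<delta> G H (transpose_from_underline G H \<eta>) \<in>
      nat_trans (op_cat (Extr \<delta>)) (Grp_cat \<epsilon>) G (underline_grp_obj H)"
    using transpose_from_underline_Hom[OF G H \<eta>] by (rule transpose_to_underline_nat_trans[OF G H])
  fix K s assume K: "K \<in> Obj (Extr \<delta>)" and s: "s \<in> carrier (FObj G K)"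
  have "\<eta> K s \<in> carrier (FObj (underline_grp_obj H) K)"
    using nat_trans_Grp_hom[OF \<eta> K] s by (rule hom_in_carrier)
  then obtain b where b: "b \<in> cmaps K (topol H)" and \<eta>b: "\<eta> K s = encode (cmaps K (topol H)) b"
    unfolding underline_grp_obj_simps(1) by blast
  have "transpose_from_underline G H \<eta> (FMap G K pt (point k) s) = b k" if k: "k \<in> topspace K" for k
  proof -
    have "FMap G K pt (point k) s \<in> carrier (FObj G pt)"
      using condensed_group_hom[OF G K Obj_Extr_pt point_cmaps[OF k]] s by (rule hom_in_carrier)
    moreover have "\<eta> pt (FMap G K pt (point k) s) = encode (cmaps (pt :: 'd topology) (topol H)) (point (b k))"
      unfolding nat_trans_Grp_natural[OF \<eta> K Obj_Extr_pt point_cmaps[OF k] s] \<eta>b underline_grp_obj_simps(4)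
      by (simp only: FMap_underline[OF Obj_Extr_small[OF K] T b] compose_point)
    ultimately show ?thesis
      using decode_encode[OF Obj_Extr_small[OF Obj_Extr_pt] T point_cmaps[OF cmaps_topspace[OF b k]]]
      by (simp add: transpose_from_underline_def)
  qed
  then have "(\<lambda>k\<in>topspace K. transpose_from_underline G H \<eta> (FMap G K pt (point k) s)) = b"
    using b by (auto simp: cmaps_def intro!: extensionalityI[of _ "topspace K"])
  then show "transpose_to_underline \<delta> G H (transpose_from_underline G H \<eta>) K s = \<eta> K s"
    unfolding transpose_to_underline_apply[OF K s] \<eta>b by (rule arg_cong)
qed

text \<open>Over K both sides send s to the code of the map taking k to g applied to f of the value
  of \<open>\<eta> K s\<close> at k.\<close>

lemma transpose_to_underline_natural:
  assumes G: "is_functor (op_cat (Extr \<delta>)) (Grp_cat \<epsilon>) G" and G': "is_functor (op_cat (Extr \<delta>)) (Grp_cat \<epsilon>) G'"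
    and H: "H \<in> Obj (TopGrp \<epsilon>)" and H': "H' \<in> Obj (TopGrp \<epsilon>)"
    and \<eta>: "\<eta> \<in> nat_trans (op_cat (Extr \<delta>)) (Grp_cat \<epsilon>) G' G"
    and f: "f \<in> hom (FObj G pt) H" "f \<in> cmaps (top_space \<delta> \<epsilon> (FObj forget_group G)) (topol H)"
    and g: "g \<in> Hom (TopGrp \<epsilon>) H H'"
  shows "transpose_to_underline \<delta> G' H' (compose (carrier (FObj G' pt)) (compose (carrier (FObj G pt)) g f) (\<eta> pt)) =
    Comp (CondGrp \<delta> \<epsilon>) G' G (underline_grp_obj H')
      (Comp (CondGrp \<delta> \<epsilon>) G (underline_grp_obj H) (underline_grp_obj H')
        (FMap (underline_grp \<delta>) H H' g) (transpose_to_underline \<delta> G H f)) \<eta>"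
    (is "?l = ?r")
proof (rule extensionalityI)
  have h: "topological_group H" "|carrier H| <o \<epsilon>"
    using H by auto
  show "?l \<in> extensional (Obj (Extr \<delta>))"
    by (simp add: transpose_to_underline_def)
  show "?r \<in> extensional (Obj (Extr \<delta>))"
    by (simp add: Cond_Comp)
  fix K assume K: "K \<in> Obj (Extr \<delta>)"
  show "?l K = ?r K"
  proof (rule extensionalityI)
    show "?l K \<in> extensional (carrier (FObj G' K))"
      using K by (simp add: transpose_to_underline_def)
    show "?r K \<in> extensional (carrier (FObj G' K))"
      using K by (simp add: Cond_Comp)
    fix s assume s: "s \<in> carrier (FObj G' K)"
    have \<eta>s: "\<eta> K s \<in> carrier (FObj G K)"
      using nat_trans_Grp_hom[OF \<eta> K] s by (rule hom_in_carrier)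
    have "compose (carrier (FObj G' pt)) (compose (carrier (FObj G pt)) g f) (\<eta> pt) (FMap G' K pt (point k) s) =
        g (f (FMap G K pt (point k) (\<eta> K s)))" if k: "k \<in> topspace K" for k
    proof -
      have 1: "FMap G' K pt (point k) s \<in> carrier (FObj G' pt)"
        using condensed_group_hom[OF G' K Obj_Extr_pt point_cmaps[OF k]] s by (rule hom_in_carrier)
      have 2: "FMap G K pt (point k) (\<eta> K s) \<in> carrier (FObj G pt)"
        using condensed_group_hom[OF G K Obj_Extr_pt point_cmaps[OF k]] \<eta>s by (rule hom_in_carrier)
      show ?thesis
        by (simp only: compose_eq[OF 1] nat_trans_Grp_natural[OF \<eta> K Obj_Extr_pt point_cmaps[OF k] s] compose_eq[OF 2])
    qed
    then have "?l K s = encode (cmaps K (topol H')) (compose (topspace K) g (\<lambda>k\<in>topspace K. f (FMap G K pt (point k) (\<eta> K s))))"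
      unfolding transpose_to_underline_apply[OF K s] compose_def
      by (intro arg_cong[of _ _ "encode _"] restrict_ext) (simp add: compose_def del: topspace_pt)
    also have "\<dots> = FMap (underline_grp \<delta>) H H' g K (transpose_to_underline \<delta> G H f K (\<eta> K s))"
      unfolding transpose_to_underline_apply[OF K \<eta>s]
      by (rule FMap_underline_grp[OF h K transpose_section_cmaps[OF G f(2) K \<eta>s], symmetric])
    also have "\<dots> = ?r K s"
      unfolding Cond_Comp Grp_cat_simps restrict_apply'[OF K] compose_eq[OF s] compose_eq[OF \<eta>s] ..
    finally show "?l K s = ?r K s" .
  qed
qed

text \<open>The transposes represent quasi-topological homomorphisms into a topological group, which
  is a bijection relative to the inclusion \<open>TopGrp_incl\<close>; composing it with the
  adjunction of \<tau> needs no knowledge of how \<tau> is built.\<close>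

lemma left_adjoint_comp_top_functor_grp:
  assumes \<tau>: "left_adjoint (qTopGrp \<epsilon>) (TopGrp \<epsilon>) \<tau> TopGrp_incl"
  shows "left_adjoint (CondGrp \<delta> \<epsilon>) (TopGrp \<epsilon>) (\<tau> \<circ>\<^sub>F top_functor_grp \<delta> \<epsilon>) (underline_grp \<delta>)"
proof (rule left_adjoint_relative[where \<psi> = "transpose_to_underline \<delta>"])
  have incl: "FObj TopGrp_incl H = H" "FMap TopGrp_incl H H' f = f" for H H' :: "'e topgrp" and f
    by (simp_all add: TopGrp_incl_def)
  have FObj: "FObj (underline_grp \<delta>) = (underline_grp_obj :: 'e topgrp \<Rightarrow> ('d, 'e) cgrp)"
    by (simp add: underline_grp_def)
  show "left_adjoint (qTopGrp \<epsilon>) (TopGrp \<epsilon>) \<tau> TopGrp_incl"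
    by (rule \<tau>)
  show "is_functor (CondGrp \<delta> \<epsilon>) (qTopGrp \<epsilon>) (top_functor_grp \<delta> \<epsilon>)"
    by (rule is_functor_top_functor_grp)
  show "is_functor (TopGrp \<epsilon>) (CondGrp \<delta> \<epsilon>) (underline_grp \<delta>)"
    by (rule is_functor_underline_grp)
  {
    fix G and H :: "'e topgrp" assume "G \<in> Obj (CondGrp \<delta> \<epsilon>)" and "H \<in> Obj (TopGrp \<epsilon>)"
    then have G: "is_functor (op_cat (Extr \<delta>)) (Grp_cat \<epsilon>) G" and H: "topological_group H" "|carrier H| <o \<epsilon>"
      by (auto intro: CondGrp_functor)
    show "bij_betw (transpose_to_underline \<delta> G H)
        (Hom (qTopGrp \<epsilon>) (FObj (top_functor_grp \<delta> \<epsilon>) G) (FObj TopGrp_incl H))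
        (Hom (CondGrp \<delta> \<epsilon>) G (FObj (underline_grp \<delta>) H))"
      unfolding incl FObj Cond_Hom qTopGrp_simps hom_top_functor_grp top_functor_grp_simps
    proof (rule bij_betw_byWitness[where f' = "transpose_from_underline G H"])
      show "\<forall>f\<in>hom (FObj G pt) H \<inter> cmaps (top_space \<delta> \<epsilon> (FObj forget_group G)) (topol H).
          transpose_from_underline G H (transpose_to_underline \<delta> G H f) = f"
        using transpose_from_to_underline[OF G H] by blast
      show "\<forall>\<eta>\<in>nat_trans (op_cat (Extr \<delta>)) (Grp_cat \<epsilon>) G (underline_grp_obj H).
          transpose_to_underline \<delta> G H (transpose_from_underline G H \<eta>) = \<eta>"
        using transpose_to_from_underline[OF G H] by blast
      show "transpose_to_underline \<delta> G H ` (hom (FObj G pt) H \<inter>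
            cmaps (top_space \<delta> \<epsilon> (FObj forget_group G)) (topol H)) \<subseteq>
          nat_trans (op_cat (Extr \<delta>)) (Grp_cat \<epsilon>) G (underline_grp_obj H)"
        using transpose_to_underline_nat_trans[OF G H] by blast
      show "transpose_from_underline G H ` nat_trans (op_cat (Extr \<delta>)) (Grp_cat \<epsilon>) G (underline_grp_obj H) \<subseteq>
          hom (FObj G pt) H \<inter> cmaps (top_space \<delta> \<epsilon> (FObj forget_group G)) (topol H)"
        using transpose_from_underline_Hom[OF G H] by blast
    qed
  }
  fix G G' and H H' :: "'e topgrp" and \<eta> f g
  assume *: "G \<in> Obj (CondGrp \<delta> \<epsilon>)" "G' \<in> Obj (CondGrp \<delta> \<epsilon>)"
    and **: "H \<in> Obj (TopGrp \<epsilon>)" "H' \<in> Obj (TopGrp \<epsilon>)"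
    and \<eta>: "\<eta> \<in> Hom (CondGrp \<delta> \<epsilon>) G' G"
    and f: "f \<in> Hom (qTopGrp \<epsilon>) (FObj (top_functor_grp \<delta> \<epsilon>) G) (FObj TopGrp_incl H)"
    and g: "g \<in> Hom (TopGrp \<epsilon>) H H'"
  show "transpose_to_underline \<delta> G' H'
      (Comp (qTopGrp \<epsilon>) (FObj (top_functor_grp \<delta> \<epsilon>) G') (FObj (top_functor_grp \<delta> \<epsilon>) G) (FObj TopGrp_incl H')
        (Comp (qTopGrp \<epsilon>) (FObj (top_functor_grp \<delta> \<epsilon>) G) (FObj TopGrp_incl H) (FObj TopGrp_incl H')
          (FMap TopGrp_incl H H' g) f) (FMap (top_functor_grp \<delta> \<epsilon>) G' G \<eta>)) =
      Comp (CondGrp \<delta> \<epsilon>) G' G (FObj (underline_grp \<delta>) H')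
        (Comp (CondGrp \<delta> \<epsilon>) G (FObj (underline_grp \<delta>) H) (FObj (underline_grp \<delta>) H')
          (FMap (underline_grp \<delta>) H H' g) (transpose_to_underline \<delta> G H f)) \<eta>"
    unfolding incl FObj qTopGrp_simps top_functor_grp_simps
    by (rule transpose_to_underline_natural[OF *[THEN CondGrp_functor] ** \<eta>[unfolded Cond_Hom] _ _ g])
      (use f in \<open>simp_all add: incl\<close>)
qed

end

text \<open>Left adjoints are determined up to isomorphism, so \<tau> ranges over all of them;
  \<open>left_adjoint_group_reflection\<close> shows that \<open>group_reflection\<close> is
  one.\<close>

theorem mainTheorem3:
  fixes \<delta> :: "'d rel" and \<epsilon> :: "'e rel"
  assumes "strongly_inaccessible \<delta>" and "strongly_inaccessible \<epsilon>" and "\<delta> <o \<epsilon>"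
  shows "is_functor (CondGrp \<delta> \<epsilon>) (qTopGrp \<epsilon>) (top_functor_grp \<delta> \<epsilon>) \<and>
    (\<forall>\<tau>. left_adjoint (qTopGrp \<epsilon>) (TopGrp \<epsilon>) \<tau> TopGrp_incl \<longrightarrow>
      left_adjoint (CondGrp \<delta> \<epsilon>) (TopGrp \<epsilon>) (\<tau> \<circ>\<^sub>F top_functor_grp \<delta> \<epsilon>) (underline_grp \<delta>))"
proof -
  interpret inaccessible_pair \<delta> \<epsilon>
    using assms by unfold_locales
  show ?thesis
    using is_functor_top_functor_grp left_adjoint_comp_top_functor_grp by blast
qed

end
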